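(* Let $L$ be a Lagrangian. Then the graph of every absolutely continuous function $f\colon[a,b]\to\mathbb{R}$ ($a<b$), and every vertical line $\{x_0\}\times\mathbb{R}$ ($x_0\in\mathbb{R}$), meets the universal singular set of $L$ in a set of linear measure zero.
   Context: A function $\omega\colon\mathbb{R}\to\mathbb{R}$ is superlinear if $\lim_{|p|\to\infty}\omega(p)/|p|=\infty$. A Lagrangian is a function $L\colon\mathbb{R}^3\to\mathbb{R}$ that is Borel measurable, bounded from below, locally bounded from above, and for which there is a superlinear function $\omega\colon\mathbb{R}\to\mathbb{R}$ with $L(x,y,p)\ge\omega(p)$ for all $(x,y,p)\in\mathbb{R}^3$. $AC[a,b]$ denotes the absolutely continuous real-valued functions on $[a,b]$. For $a<b$ and $u\in AC[a,b]$ put $\mathcal{L}(u;a,b)=\int_a^b L(x,u(x),u'(x))\,dx\in(-\infty,\infty]$, $\mathcal{L}(a,A;b,B)=\inf\{\mathcal{L}(v;a,b):v\in AC[a,b],\ v(a)=A,\ v(b)=B\}$, and define the excess $\mathcal{E}(u;a,b)=\mathcal{L}(u;a,b)-\mathcal{L}(a,u(a);b,u(b))$. A function $u\in C[a,b]$ is a generalized minimizer for $L$ on $[a,b]$ if its restriction to $(a,b)$ is a locally uniform limit of a sequence $u_n\in AC[a_n,b_n]$ with $\mathcal{E}(u_n;a_n,b_n)\to0$ (in particular $\limsup a_n\le a$ and $\liminf b_n\ge b$). The universal singular set of $L$ is the set of all $(x_0,y_0)\in\mathbb{R}^2$ for which there are $a\le x_0\le b$ with $a<b$ and a generalized minimizer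 $u$ for $L$ on $[a,b]$ such that $u(x_0)=y_0$ and $u$ has infinite derivative ($+\infty$ or $-\infty$; one-sided if $x_0$ is an endpoint) at $x_0$. Linear measure is one-dimensional Hausdorff measure $\mathcal{H}^1$. *)

theory Defs
  imports "HOL-Analysis.Analysis"
begin

definition superlinear :: "(real \<Rightarrow> real) \<Rightarrow> bool" where
  "superlinear \<omega> \<longleftrightarrow> filterlim (\<lambda>p. \<omega> p / \<bar>p\<bar>) at_top at_infinity"

definition lagrangian :: "(real \<times> real \<times> real \<Rightarrow> real) \<Rightarrow> bool" where
  "lagrangian L \<longleftrightarrow>
     L \<in> borel_measurable borel \<and>
     bdd_below (range L) \<and>
     (\<forall>z. \<exists>r>0. bdd_above (L ` ball z r)) \<and>
     (\<exists>\<omega>. superlinear \<omega> \<and> (\<forall>x y p. L (x, y, p) \<ge> \<omega> p))"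

definition AC_on :: "real \<Rightarrow> real \<Rightarrow> (real \<Rightarrow> real) \<Rightarrow> bool" where
  "AC_on a b u \<longleftrightarrow>
     (\<forall>\<epsilon>>0. \<exists>\<delta>>0. \<forall>I :: (real \<times> real) set.
        finite I \<longrightarrow> (\<forall>(s, t)\<in>I. a \<le> s \<and> s < t \<and> t \<le> b) \<longrightarrow>
        disjoint_family_on (\<lambda>(s, t). {s<..<t}) I \<longrightarrow>
        (\<Sum>(s, t)\<in>I. t - s) < \<delta> \<longrightarrow>
        (\<Sum>(s, t)\<in>I. \<bar>u t - u s\<bar>) < \<epsilon>)"

(* Functions on [a, b] are represented by total functions whose values outside [a, b] are
   irrelevant: deriv u is affected by them only at the two endpoints, a null set.
   The integral is that of the positive part minus that of the negative part (ennreal cuts off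
   at 0); if L is bounded from below, the second is finite, so the difference lies in
   (-\<infinity>, \<infinity>] and the case \<infinity> - \<infinity> does not occur. *)
definition action ::
  "(real \<times> real \<times> real \<Rightarrow> real) \<Rightarrow> (real \<Rightarrow> real) \<Rightarrow> real \<Rightarrow> real \<Rightarrow> ereal" where
  "action L u a b =
     enn2ereal (\<integral>\<^sup>+x\<in>{a..b}. ennreal (L (x, u x, deriv u x)) \<partial>lborel)
     - enn2ereal (\<integral>\<^sup>+x\<in>{a..b}. ennreal (- L (x, u x, deriv u x)) \<partial>lborel)"

definition min_action ::
  "(real \<times> real \<times> real \<Rightarrow> real) \<Rightarrow> real \<Rightarrow> real \<Rightarrow> real \<Rightarrow> real \<Rightarrow> ereal" where
  "min_action L a A b B = Inf {action L v a b | v. AC_on a b v \<and> v a = A \<and> v b = B}"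

definition excess ::
  "(real \<times> real \<times> real \<Rightarrow> real) \<Rightarrow> (real \<Rightarrow> real) \<Rightarrow> real \<Rightarrow> real \<Rightarrow> ereal" where
  "excess L u a b = action L u a b - min_action L a (u a) b (u b)"

(* Local uniform convergence on (a, b): each point has a neighbourhood which lies in the domain
   [an n, bn n] of un n for all large n, and on which un converges uniformly to u. *)
definition generalized_minimizer ::
  "(real \<times> real \<times> real \<Rightarrow> real) \<Rightarrow> real \<Rightarrow> real \<Rightarrow> (real \<Rightarrow> real) \<Rightarrow> bool" where
  "generalized_minimizer L a b u \<longleftrightarrow>
     continuous_on {a..b} u \<and>
     (\<exists>(un :: nat \<Rightarrow> real \<Rightarrow> real) an bn.
        (\<forall>n. an n < bn n \<and> AC_on (an n) (bn n) (un n)) \<and>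
        (\<lambda>n. excess L (un n) (an n) (bn n)) \<longlonglongrightarrow> 0 \<and>
        (\<forall>x\<in>{a<..<b}. \<exists>r>0. ball x r \<subseteq> {a<..<b} \<and>
           (\<forall>\<^sub>F n in sequentially. ball x r \<subseteq> {an n..bn n}) \<and>
           uniform_limit (ball x r) un u sequentially))"

definition has_infinite_derivative_on :: "(real \<Rightarrow> real) \<Rightarrow> real \<Rightarrow> real set \<Rightarrow> bool" where
  "has_infinite_derivative_on u x\<^sub>0 S \<longleftrightarrow>
     filterlim (\<lambda>x. (u x - u x\<^sub>0) / (x - x\<^sub>0)) at_top (at x\<^sub>0 within S) \<or>
     filterlim (\<lambda>x. (u x - u x\<^sub>0) / (x - x\<^sub>0)) at_bot (at x\<^sub>0 within S)"

definition universal_singular_set ::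
  "(real \<times> real \<times> real \<Rightarrow> real) \<Rightarrow> (real \<times> real) set" where
  "universal_singular_set L =
     {(x\<^sub>0, y\<^sub>0). \<exists>a b u. a < b \<and> a \<le> x\<^sub>0 \<and> x\<^sub>0 \<le> b \<and> generalized_minimizer L a b u \<and>
        u x\<^sub>0 = y\<^sub>0 \<and> has_infinite_derivative_on u x\<^sub>0 {a..b}}"

(* One-dimensional Hausdorff (outer) measure. Covers consist of bounded sets because the
   library's diameter, a real number, is unspecified for unbounded ones. Finite covers are
   included, since covering sets may be empty (diameter 0). *)
definition hausdorff1_pre :: "real \<Rightarrow> 'a::metric_space set \<Rightarrow> ennreal" where
  "hausdorff1_pre \<delta> A =
     (INF C \<in> {C :: nat \<Rightarrow> 'a set. A \<subseteq> (\<Union>i. C i) \<and> (\<forall>i. bounded (C i) \<and> diameter (C i) \<le> \<delta>)}.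
        \<Sum>i. ennreal (diameter (C i)))"

definition hausdorff1 :: "'a::metric_space set \<Rightarrow> ennreal" where
  "hausdorff1 A = (SUP \<delta>\<in>{0<..}. hausdorff1_pre \<delta> A)"

end

theory Submission
  imports Defs
begin

text \<open>Let \<open>u\<close> be a generalized minimizer through \<open>(x0, y0)\<close> whose right derivative at \<open>x0\<close> is \<open>+\<infinity>\<close>, and
consider the least action \<open>W(x, y)\<close> of curves from \<open>(x, y)\<close> to a fixed target on the right. A curve that
starts at \<open>(x0, y0 + d)\<close> can stay at that height until \<open>u\<close> has climbed there and then join \<open>u\<close>. The
waiting takes time \<open>o(d)\<close> at bounded cost per unit of time, whereas \<open>u\<close> pays more than \<open>K * d\<close> for
climbing the height \<open>d\<close>, however large \<open>K\<close> is, because \<open>L\<close> is superlinear. Hence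
\<open>W(x0, y0 + d) \<le> W(x0, y0) - K * d\<close> for small \<open>d\<close>: along the vertical line, \<open>W\<close> has the one-sided
derivative \<open>-\<infinity>\<close> at \<open>y0\<close>. Likewise, a curve that starts at a point \<open>(t', f t')\<close> with \<open>t' < x0\<close> and runs
along a line of bounded slope passes over \<open>(x0, f x0)\<close>, provided that the left difference quotients
of \<open>f\<close> at \<open>x0\<close> are bounded, so \<open>t \<mapsto> W(t, f t)\<close> has the left derivative \<open>+\<infinity>\<close> at \<open>x0\<close>. An arbitrary real
function has an infinite left derivative only on a null set (\<open>infinite_left_derivative_negligible\<close>),
and the difference quotients of an absolutely continuous function are unbounded only on a null set
(\<open>AC_on_unbounded_quotients_negligible\<close>). Null sets of parameters yield sets of linear measure zero on
the graph and on the line (\<open>hausdorff1_AC_image_null\<close>).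

Two points need care. First, the minimizers through different singular points end at different
places, while \<open>W\<close> needs one target. Take countably many targets \<open>(q, B)\<close>, with \<open>q\<close> rational and \<open>B > u q\<close> an
integer. An almost optimal curve \<open>w\<close> from \<open>(x0, y0)\<close> to \<open>(q, B)\<close> starts below the competitor built from
\<open>u\<close> and ends above it, so they cross, and exchanging their tails at the crossing passes the saving on
from \<open>u\<close> to \<open>w\<close>. Secondly, \<open>u\<close> is only a limit of almost minimizers on the open interval, which need not
reach \<open>x0\<close>. These are compared with other curves from a point \<open>s\<close> just to the right of \<open>x0\<close>. To make it
cheap to get from \<open>(s, u s)\<close> to \<open>w\<close>, the function \<open>W\<close> is replaced by \<open>approach_value\<close>, whose curves have to
be constant near their starting point: a short line of slope \<open>-1\<close> leads from \<open>(s, u s)\<close> down to height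
\<open>y0\<close>, where \<open>w\<close> still is. The resulting estimate is \<open>approach_value_descent\<close>.

The argument uses four properties of the action (locale \<open>curve_cost\<close>): locality, additivity,
superlinear cost of climbing, and bounded cost of slow curves. They are invariant under \<open>x \<mapsto> - x\<close> and
\<open>y \<mapsto> - y\<close>, which disposes of left derivatives and of the derivative \<open>-\<infinity>\<close>. For the action of a Lagrangian
the cost of climbing is bounded below by means of \<open>\<bar>u b - u a\<bar> \<le> \<integral>\<bar>u'\<bar>\<close>; this rests on the almost
everywhere differentiability of absolutely continuous functions (\<open>AC_on_differentiable_ae\<close>), proved by
a Vitali covering together with a Hahn decomposition of the increments, and on the fundamental
theorem of calculus for them (\<open>AC_on_deriv_has_integral\<close>).\<close>

section \<open>Packings and absolutely continuous functions\<close>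

text \<open>The families of intervals that absolute continuity quantifies over. They also serve as the disjoint
families that covering arguments select.\<close>

definition packing :: "real \<Rightarrow> real \<Rightarrow> (real \<times> real) set \<Rightarrow> bool" where
  "packing a b I \<longleftrightarrow> finite I \<and> (\<forall>(s, t)\<in>I. a \<le> s \<and> s < t \<and> t \<le> b) \<and>
     disjoint_family_on (\<lambda>(s, t). {s<..<t}) I"

lemma AC_on_packing:
  "AC_on a b u \<longleftrightarrow> (\<forall>\<epsilon>>0. \<exists>\<delta>>0. \<forall>I. packing a b I \<longrightarrow> (\<Sum>(s, t)\<in>I. t - s) < \<delta> \<longrightarrow>
     (\<Sum>(s, t)\<in>I. \<bar>u t - u s\<bar>) < \<epsilon>)"
  unfolding AC_on_def packing_def by (simp only: imp_conjL)

lemma AC_onE: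
  assumes "AC_on a b u" "0 < \<epsilon>"
  obtains \<delta> where "0 < \<delta>" "\<And>I. packing a b I \<Longrightarrow> (\<Sum>(s, t)\<in>I. t - s) < \<delta> \<Longrightarrow>
     (\<Sum>(s, t)\<in>I. \<bar>u t - u s\<bar>) < \<epsilon>"
  using assms unfolding AC_on_packing by blast

lemma packing_subset: "packing a b I \<Longrightarrow> I' \<subseteq> I \<Longrightarrow> packing a b I'"
  unfolding packing_def by (auto intro: finite_subset disjoint_family_on_mono)

lemma packing_mono: "packing a b I \<Longrightarrow> a' \<le> a \<Longrightarrow> b \<le> b' \<Longrightarrow> packing a' b' I"
  unfolding packing_def by force

lemma packing_single: "a \<le> s \<Longrightarrow> s < t \<Longrightarrow> t \<le> b \<Longrightarrow> packing a b {(s, t)}"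
  unfolding packing_def by (auto simp: disjoint_family_on_def)

lemma packing_disjointD:
  assumes "packing a b I" "(s, t) \<in> I" "(s', t') \<in> I" "(s, t) \<noteq> (s', t')"
  shows "t \<le> s' \<or> t' \<le> s"
proof (rule ccontr)
  assume "\<not> ?thesis"
  moreover have "s < t" "s' < t'" using assms unfolding packing_def by auto
  ultimately have "max s s' < min t t'" by auto
  then obtain z where "max s s' < z" "z < min t t'" using dense by blast
  then have "z \<in> {s<..<t} \<inter> {s'<..<t'}" by auto
  then show False using assms unfolding packing_def disjoint_family_on_def by fastforce
qed

lemma packing_disjointI:
  assumes "finite I" "\<And>s t. (s, t) \<in> I \<Longrightarrow> a \<le> s \<and> s < t \<and> t \<le> b"
    "\<And>s t s' t'. (s, t) \<in> I \<Longrightarrow> (s', t') \<in> I \<Longrightarrow> (s, t) \<noteq> (s', t') \<Longrightarrow> t \<le> s' \<or> t' \<le> s"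
  shows "packing a b I"
  unfolding packing_def disjoint_family_on_def using assms by fastforce

lemma packing_image:
  fixes p q :: "'i \<Rightarrow> real"
  assumes "finite I" and pq: "\<And>i. i \<in> I \<Longrightarrow> a \<le> p i \<and> p i < q i \<and> q i \<le> b"
    and sep: "\<And>i j. i \<in> I \<Longrightarrow> j \<in> I \<Longrightarrow> i \<noteq> j \<Longrightarrow> q i \<le> p j \<or> q j \<le> p i"
  shows "packing a b ((\<lambda>i. (p i, q i)) ` I)"
    and "(\<Sum>(s, t)\<in>(\<lambda>i. (p i, q i)) ` I. f s t) = (\<Sum>i\<in>I. f (p i) (q i))"
proof -
  show "packing a b ((\<lambda>i. (p i, q i)) ` I)"
  proof (rule packing_disjointI)
    fix s t s' t' assume "(s, t) \<in> (\<lambda>i. (p i, q i)) ` I" "(s', t') \<in> (\<lambda>i. (p i, q i)) ` I"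
      "(s, t) \<noteq> (s', t')"
    then show "t \<le> s' \<or> t' \<le> s" using sep by blast
  qed (use assms(1) pq in auto)
  have "inj_on (\<lambda>i. (p i, q i)) I"
  proof (rule inj_onI, rule ccontr)
    fix i j assume "i \<in> I" "j \<in> I" "(p i, q i) = (p j, q j)" "i \<noteq> j"
    then show False using sep[of i j] pq[of i] pq[of j] by auto
  qed
  then show "(\<Sum>(s, t)\<in>(\<lambda>i. (p i, q i)) ` I. f s t) = (\<Sum>i\<in>I. f (p i) (q i))"
    by (simp add: sum.reindex)
qed

lemma packing_measure:
  assumes "packing a b I" "U \<in> lmeasurable" "\<And>s t. (s, t) \<in> I \<Longrightarrow> {s<..<t} \<subseteq> U"
  shows "(\<Sum>(s, t)\<in>I. t - s) \<le> measure lebesgue U"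
proof -
  have fin: "finite I" using assms unfolding packing_def by auto
  have st: "a \<le> s \<and> s < t \<and> t \<le> b" if "(s, t) \<in> I" for s t
    using assms that unfolding packing_def by auto
  have meas: "(case i of (s, t) \<Rightarrow> {s<..<t :: real}) \<in> lmeasurable" for i
    using lmeasurable_box[of "fst i" "snd i"] by (simp add: case_prod_beta)
  have "(\<Sum>(s, t)\<in>I. t - s) = (\<Sum>i\<in>I. measure lebesgue (case i of (s, t) \<Rightarrow> {s<..<t}))"
    by (intro sum.cong) (auto dest: st)
  also have "\<dots> = measure lebesgue (\<Union>i\<in>I. case i of (s, t) \<Rightarrow> {s<..<t})"
    using assms(1) fin meas unfolding packing_def disjoint_family_on_def
    by (intro measure_UNION'[symmetric]) (auto simp: pairwise_def disjnt_def)
  also have "\<dots> \<le> measure lebesgue U"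
  proof (rule measure_mono_fmeasurable)
    show "(\<Union>i\<in>I. case i of (s, t) \<Rightarrow> {s<..<t}) \<in> sets lebesgue"
      using fmeasurable.finite_UN[OF fin, of _ lebesgue] meas by (blast dest: fmeasurableD)
  qed (use assms(2,3) in auto)
  finally show ?thesis .
qed

lemma packing_length:
  assumes "packing a b I" "a \<le> b"
  shows "(\<Sum>(s, t)\<in>I. t - s) \<le> b - a"
proof -
  have "(\<Sum>(s, t)\<in>I. t - s) \<le> measure lebesgue {a..b}"
    using assms by (intro packing_measure) (auto simp: packing_def)
  then show ?thesis using assms by simp
qed

lemma AC_on_subset:
  assumes "AC_on a b u" "a \<le> a'" "b' \<le> b"
  shows "AC_on a' b' u"
  using assms packing_mono unfolding AC_on_packing by meson

lemma AC_on_cong: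
  assumes "AC_on a b u" "\<And>x. x \<in> {a..b} \<Longrightarrow> u x = v x"
  shows "AC_on a b v"
proof -
  have "(\<Sum>(s, t)\<in>I. \<bar>u t - u s\<bar>) = (\<Sum>(s, t)\<in>I. \<bar>v t - v s\<bar>)" if "packing a b I" for I
    using that assms(2) unfolding packing_def by (intro sum.cong) fastforce+
  then show ?thesis using assms(1) unfolding AC_on_packing by metis
qed

lemma AC_on_uniform_modulus:
  assumes "AC_on a b u" "0 < \<epsilon>"
  obtains \<delta> where "0 < \<delta>"
    "\<And>s t. a \<le> s \<Longrightarrow> s \<le> t \<Longrightarrow> t \<le> b \<Longrightarrow> t - s < \<delta> \<Longrightarrow> \<bar>u t - u s\<bar> < \<epsilon>"
proof -
  obtain \<delta> where \<delta>: "\<delta> > 0" "\<And>I. packing a b I \<Longrightarrow> (\<Sum>(s, t)\<in>I. t - s) < \<delta> \<Longrightarrow>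
     (\<Sum>(s, t)\<in>I. \<bar>u t - u s\<bar>) < \<epsilon>"
    using AC_onE[OF assms] by blast
  show thesis
  proof (rule that[OF \<delta>(1)])
    fix s t assume "a \<le> s" "s \<le> t" "t \<le> b" "t - s < \<delta>"
    then show "\<bar>u t - u s\<bar> < \<epsilon>"
      using \<delta>(2)[OF packing_single, of s t] assms(2) by (cases "s = t") auto
  qed
qed

lemma AC_on_imp_continuous_on:
  assumes "AC_on a b u"
  shows "continuous_on {a..b} u"
  unfolding continuous_on_iff
proof (intro ballI allI impI)
  fix x e :: real assume x: "x \<in> {a..b}" and "0 < e"
  obtain \<delta> where "0 < \<delta>"
    "\<And>s t. a \<le> s \<Longrightarrow> s \<le> t \<Longrightarrow> t \<le> b \<Longrightarrow> t - s < \<delta> \<Longrightarrow> \<bar>u t - u s\<bar> < e"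
    using AC_on_uniform_modulus[OF assms \<open>0 < e\<close>] by metis
  note \<delta> = this
  show "\<exists>d>0. \<forall>x'\<in>{a..b}. dist x' x < d \<longrightarrow> dist (u x') (u x) < e"
  proof (intro exI[of _ \<delta>] conjI ballI impI)
    fix x' assume "x' \<in> {a..b}" "dist x' x < \<delta>"
    then show "dist (u x') (u x) < e"
      using x \<delta>(2)[of x x'] \<delta>(2)[of x' x] unfolding dist_real_def by (cases "x \<le> x'") auto
  qed (rule \<delta>(1))
qed

lemma AC_on_add:
  assumes "AC_on a b u" "AC_on a b v"
  shows "AC_on a b (\<lambda>x. u x + v x)"
  unfolding AC_on_packing
proof (intro allI impI)
  fix e :: real assume "e > 0"
  then have e2: "e / 2 > 0" by simp
  obtain d1 where d1: "d1 > 0"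
    "\<And>I. packing a b I \<Longrightarrow> (\<Sum>(s, t)\<in>I. t - s) < d1 \<Longrightarrow> (\<Sum>(s, t)\<in>I. \<bar>u t - u s\<bar>) < e/2"
    using AC_onE[OF assms(1) e2] by blast
  obtain d2 where d2: "d2 > 0"
    "\<And>I. packing a b I \<Longrightarrow> (\<Sum>(s, t)\<in>I. t - s) < d2 \<Longrightarrow> (\<Sum>(s, t)\<in>I. \<bar>v t - v s\<bar>) < e/2"
    using AC_onE[OF assms(2) e2] by blast
  show "\<exists>\<delta>>0. \<forall>I. packing a b I \<longrightarrow> (\<Sum>(s, t)\<in>I. t - s) < \<delta> \<longrightarrow>
          (\<Sum>(s, t)\<in>I. \<bar>u t + v t - (u s + v s)\<bar>) < e"
  proof (intro exI[of _ "min d1 d2"] conjI allI impI)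
    fix I assume I: "packing a b I" "(\<Sum>(s, t)\<in>I. t - s) < min d1 d2"
    have "(\<Sum>(s, t)\<in>I. \<bar>u t + v t - (u s + v s)\<bar>) \<le> (\<Sum>(s, t)\<in>I. \<bar>u t - u s\<bar> + \<bar>v t - v s\<bar>)"
      by (intro sum_mono) auto
    also have "\<dots> = (\<Sum>(s, t)\<in>I. \<bar>u t - u s\<bar>) + (\<Sum>(s, t)\<in>I. \<bar>v t - v s\<bar>)"
      by (simp add: sum.distrib case_prod_beta)
    also have "\<dots> < e" using d1(2)[OF I(1)] d2(2)[OF I(1)] I(2) by simp
    finally show "(\<Sum>(s, t)\<in>I. \<bar>u t + v t - (u s + v s)\<bar>) < e" .
  qed (use d1 d2 in auto)
qed

lemma AC_on_uminus: "AC_on a b u \<Longrightarrow> AC_on a b (\<lambda>x. - u x)"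
proof -
  assume "AC_on a b u"
  moreover have "\<bar>- u t - - u s\<bar> = \<bar>u t - u s\<bar>" for s t by linarith
  ultimately show "AC_on a b (\<lambda>x. - u x)" unfolding AC_on_packing by (simp only:)
qed

lemma AC_on_lipschitz:
  assumes "\<And>x y. x \<in> {a..b} \<Longrightarrow> y \<in> {a..b} \<Longrightarrow> \<bar>u x - u y\<bar> \<le> M * \<bar>x - y\<bar>"
  shows "AC_on a b u"
  unfolding AC_on_packing
proof (intro allI impI)
  fix e :: real assume "e > 0"
  show "\<exists>\<delta>>0. \<forall>I. packing a b I \<longrightarrow> (\<Sum>(s, t)\<in>I. t - s) < \<delta> \<longrightarrow> (\<Sum>(s, t)\<in>I. \<bar>u t - u s\<bar>) < e"
  proof (intro exI[of _ "e / (\<bar>M\<bar> + 1)"] conjI allI impI)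
    fix I assume I: "packing a b I" "(\<Sum>(s, t)\<in>I. t - s) < e / (\<bar>M\<bar> + 1)"
    have "\<bar>u t - u s\<bar> \<le> (\<bar>M\<bar> + 1) * (t - s)" if "(s, t) \<in> I" for s t
    proof -
      have *: "a \<le> s" "s < t" "t \<le> b" using that I unfolding packing_def by auto
      then have "\<bar>u t - u s\<bar> \<le> M * (t - s)" using assms[of t s] by auto
      also have "\<dots> \<le> (\<bar>M\<bar> + 1) * (t - s)" using * by (intro mult_right_mono) auto
      finally show ?thesis .
    qed
    then have "(\<Sum>(s, t)\<in>I. \<bar>u t - u s\<bar>) \<le> (\<Sum>(s, t)\<in>I. (\<bar>M\<bar> + 1) * (t - s))"
      by (intro sum_mono) auto
    also have "\<dots> = (\<bar>M\<bar> + 1) * (\<Sum>(s, t)\<in>I. t - s)"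
      by (simp add: sum_distrib_left case_prod_beta)
    also have "\<dots> < e" using I(2) by (simp add: pos_less_divide_eq mult.commute)
    finally show "(\<Sum>(s, t)\<in>I. \<bar>u t - u s\<bar>) < e" .
  qed (use \<open>e > 0\<close> in auto)
qed

text \<open>A monotone change of variable that does not increase lengths sends packings to packings, once the
intervals that it collapses are dropped. With \<open>min\<close> and \<open>max\<close> as changes of variable this gives the
gluing of curves below.\<close>

lemma AC_on_compose_mono:
  assumes "AC_on a b u"
    and "\<And>s t. a' \<le> s \<Longrightarrow> s \<le> t \<Longrightarrow> t \<le> b' \<Longrightarrow> a \<le> \<phi> s \<and> \<phi> s \<le> \<phi> t \<and> \<phi> t \<le> b \<and> \<phi> t - \<phi> s \<le> t - s"
  shows "AC_on a' b' (\<lambda>x. u (\<phi> x))"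
  unfolding AC_on_packing
proof (intro allI impI)
  fix e :: real assume "e > 0"
  then obtain d where d: "d > 0"
    "\<And>I. packing a b I \<Longrightarrow> (\<Sum>(s, t)\<in>I. t - s) < d \<Longrightarrow> (\<Sum>(s, t)\<in>I. \<bar>u t - u s\<bar>) < e"
    using AC_onE[OF assms(1)] by blast
  show "\<exists>\<delta>>0. \<forall>I. packing a' b' I \<longrightarrow> (\<Sum>(s, t)\<in>I. t - s) < \<delta> \<longrightarrow>
      (\<Sum>(s, t)\<in>I. \<bar>u (\<phi> t) - u (\<phi> s)\<bar>) < e"
  proof (intro exI[of _ d] conjI allI impI)
    fix I assume I: "packing a' b' I" "(\<Sum>(s, t)\<in>I. t - s) < d"
    define I' where "I' = {(s, t) \<in> I. \<phi> s < \<phi> t}"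
    have fin: "finite I" "finite I'" using I unfolding packing_def I'_def
      by (auto intro: finite_subset[of _ I])
    have st: "a' \<le> s \<and> s < t \<and> t \<le> b'" if "(s, t) \<in> I" for s t
      using I that unfolding packing_def by auto
    have sep: "\<phi> t \<le> \<phi> s' \<or> \<phi> t' \<le> \<phi> s"
      if "(s, t) \<in> I" "(s', t') \<in> I" "(s, t) \<noteq> (s', t')" for s t s' t'
      using packing_disjointD[OF I(1) that] assms(2) st[OF that(1)] st[OF that(2)]
      by (metis less_eq_real_def order_trans)
    define p q where "p = (\<lambda>i :: real \<times> real. \<phi> (fst i))" and "q = (\<lambda>i :: real \<times> real. \<phi> (snd i))"
    have pq: "a \<le> p i \<and> p i < q i \<and> q i \<le> b" if "i \<in> I'" for i
      using that assms(2) st[of "fst i" "snd i"] unfolding I'_def p_def q_def by force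
    have sep': "q i \<le> p j \<or> q j \<le> p i" if "i \<in> I'" "j \<in> I'" "i \<noteq> j" for i j
      using that sep[of "fst i" "snd i" "fst j" "snd j"] unfolding I'_def p_def q_def by (auto simp: prod_eq_iff)
    note image = packing_image[of I' a p q b, OF fin(2) pq sep', simplified]
    have "(\<Sum>(s, t)\<in>(\<lambda>i. (p i, q i)) ` I'. t - s) < d"
    proof -
      have "(\<Sum>(s, t)\<in>(\<lambda>i. (p i, q i)) ` I'. t - s) = (\<Sum>i\<in>I'. q i - p i)" by (rule image(2))
      also have "\<dots> \<le> (\<Sum>(s, t)\<in>I'. t - s)"
        using assms(2) st unfolding I'_def p_def q_def by (intro sum_mono) force
      also have "\<dots> \<le> (\<Sum>(s, t)\<in>I. t - s)"
        using fin st unfolding I'_def by (intro sum_mono2) force+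
      finally show ?thesis using I(2) by simp
    qed
    then have "(\<Sum>(s, t)\<in>(\<lambda>i. (p i, q i)) ` I'. \<bar>u t - u s\<bar>) < e" using d(2) image(1) by blast
    then have "(\<Sum>(s, t)\<in>I'. \<bar>u (\<phi> t) - u (\<phi> s)\<bar>) < e"
      by (subst (asm) image(2)) (simp add: p_def q_def case_prod_unfold)
    also have "(\<Sum>(s, t)\<in>I'. \<bar>u (\<phi> t) - u (\<phi> s)\<bar>) = (\<Sum>(s, t)\<in>I. \<bar>u (\<phi> t) - u (\<phi> s)\<bar>)"
    proof (rule sum.mono_neutral_left[OF fin(1)])
      show "\<forall>i\<in>I - I'. (case i of (s, t) \<Rightarrow> \<bar>u (\<phi> t) - u (\<phi> s)\<bar>) = 0"
      proof clarify
        fix s t assume "(s, t) \<in> I" "(s, t) \<notin> I'"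
        moreover have "\<phi> s \<le> \<phi> t" using assms(2)[of s t] st[of s t] \<open>(s, t) \<in> I\<close> by auto
        ultimately have "\<phi> s = \<phi> t" unfolding I'_def by auto
        then show "\<bar>u (\<phi> t) - u (\<phi> s)\<bar> = 0" by simp
      qed
    qed (auto simp: I'_def)
    finally show "(\<Sum>(s, t)\<in>I. \<bar>u (\<phi> t) - u (\<phi> s)\<bar>) < e" .
  qed (rule d(1))
qed

lemma AC_on_reflect:
  assumes "AC_on a b u"
  shows "AC_on (- b) (- a) (\<lambda>x. u (- x))"
  unfolding AC_on_packing
proof (intro allI impI)
  fix e :: real assume "e > 0"
  then obtain d where d: "d > 0"
    "\<And>I. packing a b I \<Longrightarrow> (\<Sum>(s, t)\<in>I. t - s) < d \<Longrightarrow> (\<Sum>(s, t)\<in>I. \<bar>u t - u s\<bar>) < e"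
    using AC_onE[OF assms(1)] by blast
  show "\<exists>\<delta>>0. \<forall>I. packing (- b) (- a) I \<longrightarrow> (\<Sum>(s, t)\<in>I. t - s) < \<delta> \<longrightarrow>
      (\<Sum>(s, t)\<in>I. \<bar>u (- t) - u (- s)\<bar>) < e"
  proof (intro exI[of _ d] conjI allI impI)
    fix I assume I: "packing (- b) (- a) I" "(\<Sum>(s, t)\<in>I. t - s) < d"
    define p q where "p = (\<lambda>i :: real \<times> real. - snd i)" and "q = (\<lambda>i :: real \<times> real. - fst i)"
    have fin: "finite I" using I unfolding packing_def by auto
    have pq: "a \<le> p i \<and> p i < q i \<and> q i \<le> b" if "i \<in> I" for i
      using that I unfolding packing_def p_def q_def by force
    have sep: "q i \<le> p j \<or> q j \<le> p i" if "i \<in> I" "j \<in> I" "i \<noteq> j" for i j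
      using that packing_disjointD[OF I(1), of "fst i" "snd i" "fst j" "snd j"]
      unfolding p_def q_def by (auto simp: prod_eq_iff)
    note image = packing_image[of I a p q b, OF fin pq sep, simplified]
    have "(\<Sum>(s, t)\<in>(\<lambda>i. (p i, q i)) ` I. t - s) < d"
      using I(2) by (subst image(2)) (simp add: p_def q_def case_prod_unfold)
    then have "(\<Sum>(s, t)\<in>(\<lambda>i. (p i, q i)) ` I. \<bar>u t - u s\<bar>) < e" using d(2) image(1) by blast
    then show "(\<Sum>(s, t)\<in>I. \<bar>u (- t) - u (- s)\<bar>) < e"
      by (subst (asm) image(2)) (simp add: p_def q_def case_prod_unfold abs_minus_commute)
  qed (rule d(1))
qed

lemma AC_on_concat:
  assumes "AC_on a b u" "AC_on b c v" "u b = v b" "a \<le> b" "b \<le> c"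
  shows "AC_on a c (\<lambda>x. if x \<le> b then u x else v x)"
proof -
  (* The glued function is u (min x b) + v (max x b) - u b. *)
  have "AC_on a c (\<lambda>x. u (min x b))"
    by (rule AC_on_compose_mono[OF assms(1)]) (use assms in auto)
  moreover have "AC_on a c (\<lambda>x. v (max x b))"
    by (rule AC_on_compose_mono[OF assms(2)]) (use assms in auto)
  ultimately have "AC_on a c (\<lambda>x. u (min x b) + v (max x b))" by (rule AC_on_add)
  moreover have "AC_on a c (\<lambda>x. - u b)" by (rule AC_on_lipschitz[where M = 0]) auto
  ultimately have "AC_on a c (\<lambda>x. (u (min x b) + v (max x b)) + - u b)" by (rule AC_on_add)
  then show ?thesis by (rule AC_on_cong) (use assms in auto)
qed

section \<open>Vitali covering arguments\<close>

text \<open>The selection of disjoint intervals whose fivefold enlargements cover \<open>E\<close> turns a bound for disjoint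
families into a bound for the outer measure of \<open>E\<close>. Since \<open>E\<close> will not be known to be measurable, the
conclusion speaks of a measurable superset. The selected intervals are disjoint even as closed
intervals, a fact that \<open>packing_remove\<close> relies on.\<close>

lemma vitali_interval_cover:
  fixes V :: "(real \<times> real) set"
  assumes V: "\<And>s t. (s, t) \<in> V \<Longrightarrow> a \<le> s \<and> s < t \<and> t \<le> b"
    and E: "\<And>x. x \<in> E \<Longrightarrow> \<exists>s t. (s, t) \<in> V \<and> s \<le> x \<and> x \<le> t"
    and le: "\<And>I. I \<subseteq> V \<Longrightarrow> packing a b I \<Longrightarrow>
      (\<And>s t s' t'. (s, t) \<in> I \<Longrightarrow> (s', t') \<in> I \<Longrightarrow> (s, t) \<noteq> (s', t') \<Longrightarrow> t < s' \<or> t' < s) \<Longrightarrow>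
      (\<Sum>(s, t)\<in>I. t - s) \<le> \<eta>"
  shows "\<exists>T. E \<subseteq> T \<and> T \<in> lmeasurable \<and> measure lebesgue T \<le> 5 * \<eta>"
proof -
  define m r where "m = (\<lambda>(s, t). (s + t) / 2 :: real)" and "r = (\<lambda>(s, t). (t - s) / 2 :: real)"
  have cb: "cball (m (s, t)) (r (s, t)) = {s..t}" for s t
    by (simp add: m_def r_def cball_eq_atLeastAtMost field_simps)
  obtain C where C: "countable C" "C \<subseteq> V"
    "pairwise (\<lambda>i j. disjnt (cball (m i) (r i)) (cball (m j) (r j))) C"
    "E \<subseteq> (\<Union>i\<in>C. cball (m i) (5 * r i))"
  proof (rule Vitali_covering_lemma_cballs[where S = E and K = V and a = m and r = r and B = "b - a"])
    show "E \<subseteq> (\<Union>i\<in>V. cball (m i) (r i))"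
    proof
      fix x assume "x \<in> E"
      then obtain s t where "(s, t) \<in> V" "x \<in> {s..t}" using E[of x] by auto
      then show "x \<in> (\<Union>i\<in>V. cball (m i) (r i))" using cb[of s t] by (intro UN_I[of "(s, t)"]) auto
    qed
    show "0 < r i \<and> r i \<le> b - a" if "i \<in> V" for i
      using V[of "fst i" "snd i"] that by (auto simp: r_def case_prod_beta)
  qed (rule that)
  have bound: "measure lebesgue (\<Union>i\<in>I. cball (m i) (5 * r i)) \<le> 5 * \<eta>" if I: "I \<subseteq> C" "finite I" for I
  proof -
    have sep: "t < s' \<or> t' < s" if "(s, t) \<in> I" "(s', t') \<in> I" "(s, t) \<noteq> (s', t')" for s t s' t'
    proof (rule ccontr)
      assume "\<not> ?thesis"
      moreover have "s < t" "s' < t'" using V C(2) I(1) that by blast+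
      ultimately have "max s s' \<in> {s..t} \<inter> {s'..t'}" by auto
      moreover have "disjnt {s..t} {s'..t'}"
        using pairwiseD[OF C(3), of "(s, t)" "(s', t')"] that I(1) unfolding cb by blast
      ultimately show False unfolding disjnt_def by auto
    qed
    have "packing a b I"
    proof (rule packing_disjointI)
      show "finite I" by fact
      show "a \<le> s \<and> s < t \<and> t \<le> b" if "(s, t) \<in> I" for s t using that V I(1) C(2) by blast
    qed (use sep less_imp_le in blast)
    then have len: "(\<Sum>(s, t)\<in>I. t - s) \<le> \<eta>"
      using le[of I] I(1) C(2) sep by blast
    have "measure lebesgue (\<Union>i\<in>I. cball (m i) (5 * r i)) \<le> (\<Sum>i\<in>I. measure lebesgue (cball (m i) (5 * r i)))"
      using I(2) by (intro measure_UNION_le) auto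
    also have "\<dots> = (\<Sum>i\<in>I. 5 * (case i of (s, t) \<Rightarrow> t - s))"
    proof (intro sum.cong refl)
      fix i assume "i \<in> I"
      moreover obtain s t where i: "i = (s, t)" by (cases i)
      ultimately have "s < t" using V[of s t] I(1) C(2) by auto
      moreover have "cball (m i) (5 * r i) = {3 * s - 2 * t..3 * t - 2 * s}"
        unfolding i m_def r_def by (simp add: cball_eq_atLeastAtMost field_simps)
      ultimately show "measure lebesgue (cball (m i) (5 * r i)) = 5 * (case i of (s, t) \<Rightarrow> t - s)"
        unfolding i by simp
    qed
    also have "\<dots> \<le> 5 * \<eta>" using len by (simp flip: sum_distrib_left)
    finally show ?thesis .
  qed
  show ?thesis
  proof (intro exI conjI)
    show "E \<subseteq> (\<Union>i\<in>C. cball (m i) (5 * r i))" by fact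
    show "(\<Union>i\<in>C. cball (m i) (5 * r i)) \<in> lmeasurable"
      by (rule fmeasurable_UN_bound[OF C(1) _ bound]) auto
    show "measure lebesgue (\<Union>i\<in>C. cball (m i) (5 * r i)) \<le> 5 * \<eta>"
      by (rule measure_UN_bound[OF C(1) _ bound]) auto
  qed
qed

lemma negligible_interval_windows:
  fixes E :: "real set"
  assumes "\<delta> > 0" "\<And>x. x \<in> E \<Longrightarrow> negligible (E \<inter> {x - \<delta><..<x + \<delta>})"
  shows "negligible E"
proof (rule iffD2[OF locally_negligible_alt], rule ballI)
  fix x assume "x \<in> E"
  show "\<exists>U. openin (top_of_set E) U \<and> x \<in> U \<and> negligible U"
  proof (intro exI conjI)
    show "openin (top_of_set E) (E \<inter> {x - \<delta><..<x + \<delta>})"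
      by (rule openin_open_Int) simp
    show "x \<in> E \<inter> {x - \<delta><..<x + \<delta>}" using \<open>x \<in> E\<close> assms(1) by simp
    show "negligible (E \<inter> {x - \<delta><..<x + \<delta>})" using assms(2) \<open>x \<in> E\<close> by blast
  qed
qed

text \<open>In a window shorter than the \<open>\<delta>\<close> of absolute continuity for \<open>\<epsilon> = 1\<close>, disjoint intervals on which \<open>u\<close>
changes at rate at least \<open>K\<close> have total length below \<open>1 / K\<close>, so by Vitali covering the part of \<open>E\<close> in the
window has outer measure at most \<open>5 / K\<close> for every \<open>K\<close>.\<close>

lemma AC_on_unbounded_quotients_negligible:
  assumes u: "AC_on a b u"
    and E: "\<And>x K \<eta>. x \<in> E \<Longrightarrow> 0 < K \<Longrightarrow> 0 < \<eta> \<Longrightarrow>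
      \<exists>s t. a \<le> s \<and> s < t \<and> t \<le> b \<and> s \<le> x \<and> x \<le> t \<and> t - s < \<eta> \<and> K * (t - s) \<le> \<bar>u t - u s\<bar>"
  shows "negligible E"
proof -
  obtain \<delta> where \<delta>: "0 < \<delta>" "\<And>I. packing a b I \<Longrightarrow> (\<Sum>(s, t)\<in>I. t - s) < \<delta> \<Longrightarrow>
     (\<Sum>(s, t)\<in>I. \<bar>u t - u s\<bar>) < 1"
    using AC_onE[OF u, of 1] by auto
  show ?thesis
  proof (rule negligible_interval_windows[of "\<delta> / 6"])
    fix x assume "x \<in> E"
    define a' b' where "a' = max a (x - \<delta> / 3)" and "b' = min b (x + \<delta> / 3)"
    show "negligible (E \<inter> {x - \<delta> / 6<..<x + \<delta> / 6})" (is "negligible ?E")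
      unfolding negligible_outer_le
    proof (intro allI impI)
      fix e :: real assume "e > 0"
      (* The rate at which the factor 5 of the covering lemma is just compensated. *)
      define K where "K = 5 / e"
      have K: "K > 0" "5 * (1 / K) = e" using \<open>e > 0\<close> by (auto simp: K_def)
      have "\<exists>T. ?E \<subseteq> T \<and> T \<in> lmeasurable \<and> measure lebesgue T \<le> 5 * (1 / K)"
      proof (rule vitali_interval_cover[where a = a' and b = b' and
            V = "{(s, t). a' \<le> s \<and> s < t \<and> t \<le> b' \<and> K * (t - s) \<le> \<bar>u t - u s\<bar>}"])
        fix y assume y: "y \<in> ?E"
        then obtain s t where "a \<le> s" "s < t" "t \<le> b" "s \<le> y" "y \<le> t" "t - s < \<delta> / 6"
          "K * (t - s) \<le> \<bar>u t - u s\<bar>"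
          using E[of y K "\<delta> / 6"] K(1) \<delta>(1) by auto
        then show "\<exists>s t. (s, t) \<in> {(s, t). a' \<le> s \<and> s < t \<and> t \<le> b' \<and> K * (t - s) \<le> \<bar>u t - u s\<bar>} \<and>
            s \<le> y \<and> y \<le> t"
          using y by (intro exI[of _ s] exI[of _ t]) (auto simp: a'_def b'_def)
      next
        fix I assume I: "I \<subseteq> {(s, t). a' \<le> s \<and> s < t \<and> t \<le> b' \<and> K * (t - s) \<le> \<bar>u t - u s\<bar>}"
          and p: "packing a' b' I"
        have "(\<Sum>(s, t)\<in>I. t - s) < \<delta>"
        proof (cases "a' \<le> b'")
          case True
          then have "(\<Sum>(s, t)\<in>I. t - s) \<le> b' - a'" by (rule packing_length[OF p])
          also have "\<dots> < \<delta>" using \<delta>(1) unfolding a'_def b'_def by (auto simp: min_def max_def)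
          finally show ?thesis .
        next
          case False
          then have "I = {}" using I by fastforce
          then show ?thesis using \<delta> by simp
        qed
        moreover have "packing a b I" using p by (rule packing_mono) (auto simp: a'_def b'_def)
        ultimately have "(\<Sum>(s, t)\<in>I. \<bar>u t - u s\<bar>) < 1" using \<delta>(2) by blast
        moreover have "(\<Sum>(s, t)\<in>I. K * (t - s)) \<le> (\<Sum>(s, t)\<in>I. \<bar>u t - u s\<bar>)"
          using I by (intro sum_mono) auto
        moreover have "(\<Sum>(s, t)\<in>I. K * (t - s)) = K * (\<Sum>(s, t)\<in>I. t - s)"
          by (simp add: sum_distrib_left case_prod_beta)
        ultimately show "(\<Sum>(s, t)\<in>I. t - s) \<le> 1 / K" using K(1) by (simp add: field_simps)
      qed auto
      then show "\<exists>T. ?E \<subseteq> T \<and> T \<in> lmeasurable \<and> measure lebesgue T \<le> e" using K(2) by simp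
    qed
  qed (use \<delta> in auto)
qed

text \<open>Cutting an interval out of the interior of a member of \<open>I\<close> leaves two nondegenerate intervals, and the
sum of increments loses exactly the increment over the removed interval. Strict separation within \<open>J\<close>
ensures that the remaining members of \<open>J\<close> lie strictly inside the pieces.\<close>

lemma packing_remove:
  fixes u :: "real \<Rightarrow> real"
  assumes "finite J" "packing a b J" "packing a b I"
    and "\<And>s t. (s, t) \<in> J \<Longrightarrow> \<exists>\<alpha> \<beta>. (\<alpha>, \<beta>) \<in> I \<and> \<alpha> < s \<and> t < \<beta>"
    and "\<And>s t s' t'. (s, t) \<in> J \<Longrightarrow> (s', t') \<in> J \<Longrightarrow> (s, t) \<noteq> (s', t') \<Longrightarrow> t < s' \<or> t' < s"
  shows "\<exists>I'. packing a b I' \<and>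
    (\<Sum>(s, t)\<in>I'. u t - u s) = (\<Sum>(s, t)\<in>I. u t - u s) - (\<Sum>(s, t)\<in>J. u t - u s)"
  using assms
proof (induction J arbitrary: I rule: finite_induct)
  case empty
  then show ?case by auto
next
  case (insert j J)
  obtain s t where j: "j = (s, t)" by (cases j)
  obtain \<alpha> \<beta> where ab: "(\<alpha>, \<beta>) \<in> I" "\<alpha> < s" "t < \<beta>" using insert.prems(3)[of s t] j by auto
  have st: "s < t" using insert.prems(1) j unfolding packing_def by auto
  have I: "finite I" "\<And>s t. (s, t) \<in> I \<Longrightarrow> a \<le> s \<and> s < t \<and> t \<le> b"
    using insert.prems(2) unfolding packing_def by auto
  define I0 where "I0 = I - {(\<alpha>, \<beta>)}"
  define I1 where "I1 = insert (\<alpha>, s) (insert (t, \<beta>) I0)"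
  have sepI: "y \<le> \<alpha> \<or> \<beta> \<le> x" if "(x, y) \<in> I0" for x y
    using packing_disjointD[OF insert.prems(2), of x y \<alpha> \<beta>] that ab(1) unfolding I0_def by blast
  have notin: "(\<alpha>, s) \<notin> I0" "(t, \<beta>) \<notin> I0" "(\<alpha>, s) \<noteq> (t, \<beta>)"
    using sepI[of \<alpha> s] sepI[of t \<beta>] ab st by auto
  have fin0: "finite I0" using I unfolding I0_def by simp
  have p1: "packing a b I1"
  proof (rule packing_disjointI)
    show "finite I1" unfolding I1_def using fin0 by simp
    show "a \<le> x \<and> x < y \<and> y \<le> b" if "(x, y) \<in> I1" for x y
      using that I(2)[of x y] I(2)[OF ab(1)] ab(2,3) st unfolding I1_def I0_def by auto
    fix x y x' y' assume xy: "(x, y) \<in> I1" "(x', y') \<in> I1" "(x, y) \<noteq> (x', y')"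
    show "y \<le> x' \<or> y' \<le> x"
    proof (cases "(x, y) \<in> I0 \<and> (x', y') \<in> I0")
      case True
      then show ?thesis using packing_disjointD[OF insert.prems(2)] xy(3) unfolding I0_def by blast
    next
      case False
      then show ?thesis using xy sepI[of x y] sepI[of x' y'] ab st unfolding I1_def by auto
    qed
  qed
  have sum1: "(\<Sum>(s, t)\<in>I1. u t - u s) = (\<Sum>(s, t)\<in>I. u t - u s) - (u t - u s)"
  proof -
    have "(\<Sum>(s, t)\<in>I. u t - u s) = (u \<beta> - u \<alpha>) + (\<Sum>(s, t)\<in>I0. u t - u s)"
      unfolding I0_def using I(1) ab(1) by (simp add: sum.remove)
    then show ?thesis unfolding I1_def using fin0 notin by simp
  qed
  have "\<exists>I'. packing a b I' \<and>
    (\<Sum>(s, t)\<in>I'. u t - u s) = (\<Sum>(s, t)\<in>I1. u t - u s) - (\<Sum>(s, t)\<in>J. u t - u s)"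
  proof (rule insert.IH)
    show "packing a b J" using insert.prems(1) by (rule packing_subset) auto
    show "packing a b I1" by (rule p1)
    fix x y assume xy: "(x, y) \<in> J"
    then obtain \<alpha>' \<beta>' where 1: "(\<alpha>', \<beta>') \<in> I" "\<alpha>' < x" "y < \<beta>'" using insert.prems(3)[of x y] by auto
    have 2: "y < s \<or> t < x" using insert.prems(4)[of x y s t] xy insert.hyps(2) j by auto
    show "\<exists>\<alpha> \<beta>. (\<alpha>, \<beta>) \<in> I1 \<and> \<alpha> < x \<and> y < \<beta>"
      using 1 2 unfolding I1_def I0_def by (cases "(\<alpha>', \<beta>') = (\<alpha>, \<beta>)") auto
  qed (use insert.prems(4) in blast)
  then show ?case using sum1 insert.hyps j by auto
qed

text \<open>A Hahn decomposition of the increments of \<open>u\<close>. Let the packing \<open>I\<close> nearly maximize the sum of the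
increments. Disjoint intervals inside the members of \<open>I\<close> on which \<open>u\<close> falls at rate \<open>r\<close> must be short in
total: cutting them out would increase the sum. Disjoint intervals outside \<open>I\<close> on which \<open>u\<close> rises must
be short in total: adding them would increase the sum. As both kinds of intervals occur at every
point of \<open>E\<close>, the falling ones cover the part of \<open>E\<close> inside \<open>I\<close> and the rising ones the part outside.\<close>

lemma oscillating_increments_negligible:
  fixes u :: "real \<Rightarrow> real"
  assumes bdd: "\<And>I. packing a b I \<Longrightarrow> (\<Sum>(s, t)\<in>I. u t - u s) \<le> P" and "0 < r"
    and E: "E \<subseteq> {a<..<b}"
    and up: "\<And>x \<eta>. x \<in> E \<Longrightarrow> 0 < \<eta> \<Longrightarrow>
      \<exists>s t. s < t \<and> s \<le> x \<and> x \<le> t \<and> t - s < \<eta> \<and> r * (t - s) \<le> u t - u s"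
    and down: "\<And>x \<eta>. x \<in> E \<Longrightarrow> 0 < \<eta> \<Longrightarrow>
      \<exists>s t. s < t \<and> s \<le> x \<and> x \<le> t \<and> t - s < \<eta> \<and> r * (t - s) \<le> u s - u t"
  shows "negligible E"
  unfolding negligible_outer_le
proof (intro allI impI)
  fix e :: real assume "e > 0"
  define F where "F = (\<lambda>I. \<Sum>(s, t)\<in>I. u t - u s)"
  define \<eta> where "\<eta> = e * r / 10"
  have \<eta>: "\<eta> > 0" "5 * (\<eta> / r) = e / 2" using \<open>e > 0\<close> \<open>0 < r\<close> by (auto simp: \<eta>_def)
  define \<sigma> where "\<sigma> = Sup (F ` {I. packing a b I})"
  have "packing a b {}" by (auto simp: packing_def disjoint_family_on_def)
  then have ne: "F ` {I. packing a b I} \<noteq> {}" by auto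
  have bd: "bdd_above (F ` {I. packing a b I})" using bdd unfolding F_def by (intro bdd_aboveI) auto
  have le_\<sigma>: "F I \<le> \<sigma>" if "packing a b I" for I
    unfolding \<sigma>_def using that bd by (intro cSup_upper) auto
  obtain I where I: "packing a b I" "\<sigma> - \<eta> < F I"
    using less_cSupD[OF ne, of "\<sigma> - \<eta>"] \<eta>(1) unfolding \<sigma>_def by auto
  have finI: "finite I" and Ist: "\<And>s t. (s, t) \<in> I \<Longrightarrow> a \<le> s \<and> s < t \<and> t \<le> b"
    using I(1) unfolding packing_def by auto
  define In where "In = E \<inter> (\<Union>(s, t)\<in>I. {s<..<t})"
  define Out where "Out = E - (\<Union>(s, t)\<in>I. {s..t})"
  have "\<exists>T. In \<subseteq> T \<and> T \<in> lmeasurable \<and> measure lebesgue T \<le> 5 * (\<eta> / r)"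
  proof (rule vitali_interval_cover[where a = a and b = b and
      V = "{(s, t). s < t \<and> r * (t - s) \<le> u s - u t \<and> (\<exists>\<alpha> \<beta>. (\<alpha>, \<beta>) \<in> I \<and> \<alpha> < s \<and> t < \<beta>)}"])
    fix x assume "x \<in> In"
    then obtain \<alpha> \<beta> where ab: "(\<alpha>, \<beta>) \<in> I" "\<alpha> < x" "x < \<beta>" "x \<in> E" unfolding In_def by auto
    then obtain s t where "s < t" "s \<le> x" "x \<le> t" "t - s < min (x - \<alpha>) (\<beta> - x)"
      "r * (t - s) \<le> u s - u t" using down[of x "min (x - \<alpha>) (\<beta> - x)"] by auto
    then show "\<exists>s t. (s, t) \<in> {(s, t). s < t \<and> r * (t - s) \<le> u s - u t \<and>
        (\<exists>\<alpha> \<beta>. (\<alpha>, \<beta>) \<in> I \<and> \<alpha> < s \<and> t < \<beta>)} \<and> s \<le> x \<and> x \<le> t"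
      using ab by (intro exI[of _ s] exI[of _ t]) force
  next
    fix J assume J: "J \<subseteq> {(s, t). s < t \<and> r * (t - s) \<le> u s - u t \<and> (\<exists>\<alpha> \<beta>. (\<alpha>, \<beta>) \<in> I \<and> \<alpha> < s \<and> t < \<beta>)}"
      and p: "packing a b J"
      and sep: "\<And>s t s' t'. (s, t) \<in> J \<Longrightarrow> (s', t') \<in> J \<Longrightarrow> (s, t) \<noteq> (s', t') \<Longrightarrow> t < s' \<or> t' < s"
    have "finite J" using p unfolding packing_def by auto
    moreover have "\<exists>\<alpha> \<beta>. (\<alpha>, \<beta>) \<in> I \<and> \<alpha> < s \<and> t < \<beta>" if "(s, t) \<in> J" for s t
      using J that by blast
    ultimately obtain I' where "packing a b I'" "F I' = F I - F J"
      using packing_remove[OF _ p I(1), of u] sep unfolding F_def by blast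
    then have "- F J \<le> \<eta>" using le_\<sigma>[of I'] I(2) by linarith
    moreover have "(\<Sum>(s, t)\<in>J. r * (t - s)) \<le> (\<Sum>(s, t)\<in>J. - (u t - u s))"
      using J by (intro sum_mono) auto
    then have "r * (\<Sum>(s, t)\<in>J. t - s) \<le> - F J"
      unfolding F_def by (simp add: sum_distrib_left sum_negf[symmetric] case_prod_beta)
    ultimately show "(\<Sum>(s, t)\<in>J. t - s) \<le> \<eta> / r" using \<open>0 < r\<close> by (simp add: field_simps)
  qed (use Ist in force)
  then obtain T1 where T1: "In \<subseteq> T1" "T1 \<in> lmeasurable" "measure lebesgue T1 \<le> e / 2"
    unfolding \<eta>(2) by blast
  have "\<exists>T. Out \<subseteq> T \<and> T \<in> lmeasurable \<and> measure lebesgue T \<le> 5 * (\<eta> / r)"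
  proof (rule vitali_interval_cover[where a = a and b = b and
      V = "{(s, t). a \<le> s \<and> s < t \<and> t \<le> b \<and> r * (t - s) \<le> u t - u s \<and> (\<forall>(\<alpha>, \<beta>)\<in>I. t < \<alpha> \<or> \<beta> < s)}"])
    fix x assume x: "x \<in> Out"
    have "closed (\<Union>(s, t)\<in>I. {s..t})" using finI by (intro closed_UN) auto
    then have "open (- (\<Union>(s, t)\<in>I. {s..t}))" by (rule open_Compl)
    moreover have "x \<in> - (\<Union>(s, t)\<in>I. {s..t})" using x unfolding Out_def by auto
    ultimately obtain d where d: "d > 0" "ball x d \<subseteq> - (\<Union>(s, t)\<in>I. {s..t})"
      by (meson openE)
    have xab: "a < x" "x < b" "x \<in> E" using x E unfolding Out_def by auto
    then obtain s t where st: "s < t" "s \<le> x" "x \<le> t" "t - s < min d (min (x - a) (b - x))"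
      "r * (t - s) \<le> u t - u s" using up[of x "min d (min (x - a) (b - x))"] d by auto
    have "t < \<alpha> \<or> \<beta> < s" if "(\<alpha>, \<beta>) \<in> I" for \<alpha> \<beta>
    proof (rule ccontr)
      assume "\<not> ?thesis"
      then have "max \<alpha> s \<in> {\<alpha>..\<beta>} \<and> max \<alpha> s \<in> {s..t}" using Ist[OF that] st by auto
      moreover have "max \<alpha> s \<in> ball x d" using calculation st by (auto simp: dist_real_def)
      ultimately show False using d(2) that by blast
    qed
    then show "\<exists>s t. (s, t) \<in> {(s, t). a \<le> s \<and> s < t \<and> t \<le> b \<and> r * (t - s) \<le> u t - u s \<and>
        (\<forall>(\<alpha>, \<beta>)\<in>I. t < \<alpha> \<or> \<beta> < s)} \<and> s \<le> x \<and> x \<le> t"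
      using st xab by (intro exI[of _ s] exI[of _ t]) auto
  next
    fix J assume J: "J \<subseteq> {(s, t). a \<le> s \<and> s < t \<and> t \<le> b \<and> r * (t - s) \<le> u t - u s \<and>
        (\<forall>(\<alpha>, \<beta>)\<in>I. t < \<alpha> \<or> \<beta> < s)}"
      and p: "packing a b J"
    have fin: "finite J" using p unfolding packing_def by auto
    have sep: "t < \<alpha> \<or> \<beta> < s" "s < t" if "(s, t) \<in> J" "(\<alpha>, \<beta>) \<in> I" for s t \<alpha> \<beta>
      using J that by fastforce+
    have "packing a b (I \<union> J)"
    proof (rule packing_disjointI)
      show "finite (I \<union> J)" using fin finI by simp
      show "a \<le> s \<and> s < t \<and> t \<le> b" if "(s, t) \<in> I \<union> J" for s t
        using that Ist J by auto
      fix s t s' t' assume *: "(s, t) \<in> I \<union> J" "(s', t') \<in> I \<union> J" "(s, t) \<noteq> (s', t')"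
      show "t \<le> s' \<or> t' \<le> s"
      proof (cases "(s, t) \<in> I")
        case True
        show ?thesis
        proof (cases "(s', t') \<in> I")
          case False
          then show ?thesis using True *(2) sep(1)[of s' t' s t] by auto
        qed (use packing_disjointD[OF I(1)] True *(3) in blast)
      next
        case False
        then have "(s, t) \<in> J" using * by auto
        show ?thesis
        proof (cases "(s', t') \<in> J")
          case False
          then show ?thesis using \<open>(s, t) \<in> J\<close> *(2) sep(1)[of s t s' t'] by auto
        qed (use packing_disjointD[OF p] \<open>(s, t) \<in> J\<close> *(3) in blast)
      qed
    qed
    then have "F (I \<union> J) \<le> \<sigma>" by (rule le_\<sigma>)
    moreover have "I \<inter> J = {}" using sep(1) Ist by fastforce
    then have "F (I \<union> J) = F I + F J" unfolding F_def using fin finI by (simp add: sum.union_disjoint)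
    ultimately have "F J \<le> \<eta>" using I(2) by linarith
    moreover have "(\<Sum>(s, t)\<in>J. r * (t - s)) \<le> (\<Sum>(s, t)\<in>J. u t - u s)"
      using J by (intro sum_mono) auto
    then have "r * (\<Sum>(s, t)\<in>J. t - s) \<le> F J"
      unfolding F_def by (simp add: sum_distrib_left case_prod_beta)
    ultimately show "(\<Sum>(s, t)\<in>J. t - s) \<le> \<eta> / r" using \<open>0 < r\<close> by (simp add: field_simps)
  qed auto
  then obtain T2 where T2: "Out \<subseteq> T2" "T2 \<in> lmeasurable" "measure lebesgue T2 \<le> e / 2"
    unfolding \<eta>(2) by blast
  define T3 where "T3 = fst ` I \<union> snd ` I"
  have T3: "T3 \<in> lmeasurable" "measure lebesgue T3 = 0"
    using finI negligible_finite[of T3] unfolding T3_def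
    by (auto simp: negligible_iff_measure)
  show "\<exists>T. E \<subseteq> T \<and> T \<in> lmeasurable \<and> measure lebesgue T \<le> e"
  proof (intro exI conjI)
    show "E \<subseteq> T1 \<union> T2 \<union> T3"
    proof
      fix x assume x: "x \<in> E"
      show "x \<in> T1 \<union> T2 \<union> T3"
      proof (cases "x \<in> Out")
        case False
        then obtain s t where st: "(s, t) \<in> I" "s \<le> x" "x \<le> t" using x unfolding Out_def by auto
        show ?thesis
        proof (cases "s < x \<and> x < t")
          case True
          then have "x \<in> In" using st x unfolding In_def by (intro IntI UN_I[of "(s, t)"]) auto
          then show ?thesis using T1 by auto
        next
          case False
          then have "x = fst (s, t) \<or> x = snd (s, t)" using st by auto
          then show ?thesis using st(1) unfolding T3_def by blast
        qed
      qed (use T2 in auto)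
    qed
    show "T1 \<union> T2 \<union> T3 \<in> lmeasurable" using T1 T2 T3 by auto
    have "measure lebesgue (T1 \<union> T2 \<union> T3) \<le> measure lebesgue (T1 \<union> T2) + measure lebesgue T3"
      using T1 T2 T3 by (intro measure_Un_le) auto
    also have "measure lebesgue (T1 \<union> T2) \<le> measure lebesgue T1 + measure lebesgue T2"
      using T1 T2 by (intro measure_Un_le) auto
    finally show "measure lebesgue (T1 \<union> T2 \<union> T3) \<le> e" using T1 T2 T3 by linarith
  qed
qed

text \<open>Absolute continuity bounds the sums of increments in short windows, so the decomposition above
applies there.\<close>

lemma AC_on_oscillating_negligible:
  assumes u: "AC_on a b u" and r: "0 < r"
    and E: "E \<subseteq> {a<..<b}"
    and up: "\<And>x \<eta>. x \<in> E \<Longrightarrow> 0 < \<eta> \<Longrightarrow>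
      \<exists>s t. s < t \<and> s \<le> x \<and> x \<le> t \<and> t - s < \<eta> \<and> r * (t - s) \<le> u t - u s"
    and down: "\<And>x \<eta>. x \<in> E \<Longrightarrow> 0 < \<eta> \<Longrightarrow>
      \<exists>s t. s < t \<and> s \<le> x \<and> x \<le> t \<and> t - s < \<eta> \<and> r * (t - s) \<le> u s - u t"
  shows "negligible E"
proof -
  obtain \<delta> where \<delta>: "0 < \<delta>" "\<And>I. packing a b I \<Longrightarrow> (\<Sum>(s, t)\<in>I. t - s) < \<delta> \<Longrightarrow>
     (\<Sum>(s, t)\<in>I. \<bar>u t - u s\<bar>) < 1"
    using AC_onE[OF u, of 1] by auto
  show ?thesis
  proof (rule negligible_interval_windows[of "\<delta> / 3"])
    fix x assume x: "x \<in> E"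
    define a' b' where "a' = max a (x - \<delta> / 3)" and "b' = min b (x + \<delta> / 3)"
    have ab': "a' < b'" "b' - a' < \<delta>" using x E \<delta>(1) unfolding a'_def b'_def by auto
    show "negligible (E \<inter> {x - \<delta> / 3<..<x + \<delta> / 3})"
    proof (rule oscillating_increments_negligible[where a = a' and b = b' and u = u and P = 1 and r = r])
      fix I assume I: "packing a' b' I"
      then have "(\<Sum>(s, t)\<in>I. t - s) < \<delta>" using packing_length[OF I] ab' by linarith
      moreover have "packing a b I" using I by (rule packing_mono) (auto simp: a'_def b'_def)
      ultimately have "(\<Sum>(s, t)\<in>I. \<bar>u t - u s\<bar>) < 1" using \<delta>(2) by blast
      moreover have "(\<Sum>(s, t)\<in>I. u t - u s) \<le> (\<Sum>(s, t)\<in>I. \<bar>u t - u s\<bar>)"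
        by (intro sum_mono) auto
      ultimately show "(\<Sum>(s, t)\<in>I. u t - u s) \<le> 1" by linarith
    next
      show "E \<inter> {x - \<delta> / 3<..<x + \<delta> / 3} \<subseteq> {a'<..<b'}"
        using E by (auto simp: a'_def b'_def)
    qed (use r up down in blast)+
  qed (use \<delta> in auto)
qed

lemma bounded_nonoscillating_convergent:
  fixes Q :: "real \<Rightarrow> real"
  assumes bdd: "eventually (\<lambda>y. \<bar>Q y\<bar> \<le> K) (at x)"
    and osc: "\<And>p q. p \<in> \<rat> \<Longrightarrow> q \<in> \<rat> \<Longrightarrow> p < q \<Longrightarrow>
      eventually (\<lambda>y. p \<le> Q y) (at x) \<or> eventually (\<lambda>y. Q y \<le> q) (at x)"
  shows "\<exists>l. (Q \<longlongrightarrow> l) (at x)"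
proof -
  define l L where "l = Liminf (at x) (\<lambda>y. ereal (Q y))" and "L = Limsup (at x) (\<lambda>y. ereal (Q y))"
  have le: "l \<le> L" unfolding l_def L_def by (rule Liminf_le_Limsup) simp
  have "\<not> l < L"
  proof
    assume "l < L"
    then obtain c where c: "l < ereal c" "ereal c < L" using ereal_dense2 by blast
    then obtain d where d: "ereal c < ereal d" "ereal d < L" using ereal_dense2 by blast
    then have "c < d" by simp
    then obtain p where p: "p \<in> \<rat>" "c < p" "p < d" using Rats_dense_in_real by blast
    then obtain q where q: "q \<in> \<rat>" "p < q" "q < d" using Rats_dense_in_real by blast
    from osc[OF p(1) q(1,2)] show False
    proof
      assume "eventually (\<lambda>y. p \<le> Q y) (at x)"
      then have "ereal p \<le> l" unfolding l_def by (intro Liminf_bounded) simp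
      also have "l < ereal c" by fact
      finally show False using p(2) by simp
    next
      assume "eventually (\<lambda>y. Q y \<le> q) (at x)"
      then have "L \<le> ereal q" unfolding L_def by (intro Limsup_bounded) simp
      with d(2) have "ereal d < ereal q" by (rule less_le_trans)
      then show False using q(3) by simp
    qed
  qed
  then have eq: "l = L" using le by simp
  have "ereal (- K) \<le> l" unfolding l_def
    using bdd by (intro Liminf_bounded) (auto elim!: eventually_mono)
  moreover have "L \<le> ereal K" unfolding L_def
    using bdd by (intro Limsup_bounded) (auto elim!: eventually_mono)
  ultimately obtain l' where l': "l = ereal l'" using eq by (cases l) auto
  have "((\<lambda>y. ereal (Q y)) \<longlongrightarrow> ereal l') (at x)"
    using eq l' unfolding l_def L_def by (subst tendsto_iff_Liminf_eq_Limsup) auto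
  then show ?thesis by auto
qed

section \<open>Differentiation of absolutely continuous functions\<close>

lemma increment_eq_quotient:
  fixes u :: "real \<Rightarrow> real"
  assumes "y \<noteq> x"
  shows "u (max x y) - u (min x y) = (u y - u x) / (y - x) * (max x y - min x y)"
  using assms by (cases "x < y") (auto simp: max_def min_def field_simps)

text \<open>Where \<open>u\<close> is not differentiable, its difference quotients are unbounded or oscillate across an
interval with rational endpoints \<open>p < q\<close>. Both sets are null; for the second, subtract a linear
function of slope \<open>(p + q) / 2\<close> to make the oscillation symmetric about \<open>0\<close>.\<close>

proposition AC_on_differentiable_ae:
  assumes u: "AC_on a b u"
  shows "negligible {x \<in> {a<..<b}. \<not> u differentiable (at x)}"
proof -
  define Q where "Q = (\<lambda>x y. (u y - u x) / (y - x))"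
  define N0 where "N0 = {x \<in> {a<..<b}. \<forall>K>0. \<forall>\<eta>>0. \<exists>y\<in>{a<..<b}. y \<noteq> x \<and> \<bar>y - x\<bar> < \<eta> \<and> K \<le> \<bar>Q x y\<bar>}"
  define N where "N = (\<lambda>(p, q). {x \<in> {a<..<b}. \<forall>\<eta>>0.
     (\<exists>y\<in>{a<..<b}. y \<noteq> x \<and> \<bar>y - x\<bar> < \<eta> \<and> Q x y \<le> p) \<and>
     (\<exists>y\<in>{a<..<b}. y \<noteq> x \<and> \<bar>y - x\<bar> < \<eta> \<and> q \<le> Q x y)})"
  have inc: "u (max x y) - u (min x y) = Q x y * (max x y - min x y)" if "y \<noteq> x" for x y
    unfolding Q_def using that by (rule increment_eq_quotient)
  have "negligible N0"
  proof (rule AC_on_unbounded_quotients_negligible[OF u])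
    fix x K \<eta> :: real assume "x \<in> N0" "0 < K" "0 < \<eta>"
    then obtain y where y: "x \<in> {a<..<b}" "y \<in> {a<..<b}" "y \<noteq> x" "\<bar>y - x\<bar> < \<eta>" "K \<le> \<bar>Q x y\<bar>"
      unfolding N0_def by blast
    have pos: "0 < max x y - min x y" "max x y - min x y = \<bar>y - x\<bar>" using y(3) by auto
    have "K * (max x y - min x y) \<le> \<bar>u (max x y) - u (min x y)\<bar>"
      unfolding inc[OF y(3)] abs_mult using y(5) pos by (intro mult_mono) auto
    then show "\<exists>s t. a \<le> s \<and> s < t \<and> t \<le> b \<and> s \<le> x \<and> x \<le> t \<and> t - s < \<eta> \<and> K * (t - s) \<le> \<bar>u t - u s\<bar>"
      using y pos(1) unfolding pos(2)[symmetric]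
      by (intro exI[of _ "min x y"] exI[of _ "max x y"]) simp
  qed
  moreover have "negligible (N (p, q))" if "p < q" for p q
  proof (rule AC_on_oscillating_negligible[where r = "(q - p) / 2" and u = "\<lambda>x. u x + - ((p + q) / 2 * x)"])
    have "\<bar>- (m * x) - - (m * y)\<bar> \<le> \<bar>m\<bar> * \<bar>x - y\<bar>" for m x y :: real
    proof -
      have "- (m * x) - - (m * y) = - (m * (x - y))" by (simp add: algebra_simps)
      then show ?thesis by (simp add: abs_mult)
    qed
    then have "AC_on a b (\<lambda>x. - ((p + q) / 2 * x))" by (rule AC_on_lipschitz)
    then show "AC_on a b (\<lambda>x. u x + - ((p + q) / 2 * x))" using u by (intro AC_on_add)
    show "N (p, q) \<subseteq> {a<..<b}" unfolding N_def by auto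
    fix x \<eta> :: real assume x: "x \<in> N (p, q)" and "0 < \<eta>"
    then obtain y where y: "y \<noteq> x" "\<bar>y - x\<bar> < \<eta>" "q \<le> Q x y"
      unfolding N_def by auto
    have pos: "0 < max x y - min x y" "max x y - min x y = \<bar>y - x\<bar>" using y(1) by auto
    have "q * (max x y - min x y) \<le> u (max x y) - u (min x y)"
      unfolding inc[OF y(1)] using y(3) pos by (intro mult_right_mono) auto
    then show "\<exists>s t. s < t \<and> s \<le> x \<and> x \<le> t \<and> t - s < \<eta> \<and>
        (q - p) / 2 * (t - s) \<le> u t + - ((p + q) / 2 * t) - (u s + - ((p + q) / 2 * s))"
      using y pos(1) unfolding pos(2)[symmetric]
      by (intro exI[of _ "min x y"] exI[of _ "max x y"]) (simp add: field_simps)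
    obtain y where y: "y \<noteq> x" "\<bar>y - x\<bar> < \<eta>" "Q x y \<le> p"
      using x \<open>0 < \<eta>\<close> unfolding N_def by auto
    have pos: "0 < max x y - min x y" "max x y - min x y = \<bar>y - x\<bar>" using y(1) by auto
    have "u (max x y) - u (min x y) \<le> p * (max x y - min x y)"
      unfolding inc[OF y(1)] using y(3) pos by (intro mult_right_mono) auto
    then show "\<exists>s t. s < t \<and> s \<le> x \<and> x \<le> t \<and> t - s < \<eta> \<and>
        (q - p) / 2 * (t - s) \<le> u s + - ((p + q) / 2 * s) - (u t + - ((p + q) / 2 * t))"
      using y pos(1) unfolding pos(2)[symmetric]
      by (intro exI[of _ "min x y"] exI[of _ "max x y"]) (simp add: field_simps)
  qed (use that in auto)
  then have "negligible (\<Union>pq\<in>{(p, q). p \<in> \<rat> \<and> q \<in> \<rat> \<and> p < q}. N pq)"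
    by (intro negligible_countable_Union[OF countable_image])
       (auto intro: countable_subset[OF _ countable_SIGMA[OF countable_rat countable_rat]])
  ultimately have "negligible (N0 \<union> (\<Union>pq\<in>{(p, q). p \<in> \<rat> \<and> q \<in> \<rat> \<and> p < q}. N pq))"
    by (rule negligible_Un)
  then show ?thesis
  proof (rule negligible_subset, intro subsetI)
    fix x assume "x \<in> {x \<in> {a<..<b}. \<not> u differentiable (at x)}"
    then have x: "a < x" "x < b" and nd: "\<not> u differentiable (at x)" by auto
    show "x \<in> N0 \<union> (\<Union>pq\<in>{(p, q). p \<in> \<rat> \<and> q \<in> \<rat> \<and> p < q}. N pq)"
    proof (rule ccontr)
      assume notin: "\<not> ?thesis"
      have ev: "eventually P (at x)" if "\<eta> > 0" "\<And>y. y \<in> {a<..<b} \<Longrightarrow> y \<noteq> x \<Longrightarrow> \<bar>y - x\<bar> < \<eta> \<Longrightarrow> P y" for P \<eta>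
        unfolding eventually_at dist_real_def
        by (rule exI[of _ "min \<eta> (min (x - a) (b - x))"]) (use that x in \<open>auto simp: abs_less_iff\<close>)
      have "x \<notin> N0" "x \<in> {a<..<b}" using notin x by auto
      then obtain K \<eta> where K': "\<eta> > 0" "\<not> (\<exists>y\<in>{a<..<b}. y \<noteq> x \<and> \<bar>y - x\<bar> < \<eta> \<and> K \<le> \<bar>Q x y\<bar>)"
        unfolding N0_def by blast
      then have K: "\<eta> > 0" "\<And>y. y \<in> {a<..<b} \<Longrightarrow> y \<noteq> x \<Longrightarrow> \<bar>y - x\<bar> < \<eta> \<Longrightarrow> \<bar>Q x y\<bar> < K"
        by (blast, meson not_le)
      have "\<exists>l. (Q x \<longlongrightarrow> l) (at x)"
      proof (rule bounded_nonoscillating_convergent)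
        show "eventually (\<lambda>y. \<bar>Q x y\<bar> \<le> K) (at x)"
          by (rule ev[OF K(1)]) (use K(2) less_imp_le in blast)
        fix p q :: real assume "p \<in> \<rat>" "q \<in> \<rat>" "p < q"
        then have "x \<notin> N (p, q)" using notin by blast
        then obtain \<eta> where "\<eta> > 0"
          "(\<forall>y\<in>{a<..<b}. y \<noteq> x \<and> \<bar>y - x\<bar> < \<eta> \<longrightarrow> p < Q x y) \<or>
           (\<forall>y\<in>{a<..<b}. y \<noteq> x \<and> \<bar>y - x\<bar> < \<eta> \<longrightarrow> Q x y < q)"
          using x unfolding N_def by (auto simp: not_le)
        then show "eventually (\<lambda>y. p \<le> Q x y) (at x) \<or> eventually (\<lambda>y. Q x y \<le> q) (at x)"
          by (elim disjE; intro disjI1 disjI2 ev[of \<eta>]) (auto intro: less_imp_le ev[of \<eta>])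
      qed
      then obtain l where "(u has_field_derivative l) (at x)"
        unfolding has_field_derivative_iff Q_def by blast
      then show False using nd real_differentiable_def by blast
    qed
  qed
qed

lemma negligible_open_superset:
  fixes N :: "real set"
  assumes N: "negligible N" and "0 < \<delta>"
  obtains U where "open U" "N \<subseteq> U" "U \<in> lmeasurable" "measure lebesgue U < \<delta>"
proof -
  obtain U where U: "open U" "N \<subseteq> U" "(U - N) \<in> lmeasurable" "emeasure lebesgue (U - N) < ennreal \<delta>"
    using sets_lebesgue_outer_open[OF negligible_imp_sets[OF N] \<open>0 < \<delta>\<close>] by metis
  have Nl: "N \<in> lmeasurable" "measure lebesgue N = 0"
    using N negligible_iff_measure by auto
  have eq: "(U - N) \<union> N = U" using U(2) by auto
  have "(U - N) \<union> N \<in> lmeasurable" using U(3) Nl(1) by (rule fmeasurable.Un)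
  moreover have "measure lebesgue ((U - N) \<union> N) \<le> measure lebesgue (U - N) + measure lebesgue N"
    by (rule measure_Un_le) (use U(3) Nl(1) in \<open>auto dest: fmeasurableD\<close>)
  moreover have "measure lebesgue (U - N) < \<delta>"
    using U(3,4) \<open>0 < \<delta>\<close> by (simp add: emeasure_eq_measure2 ennreal_less_iff)
  ultimately show thesis using that U(1,2) Nl(2) unfolding eq by simp
qed

text \<open>In a Riemann sum with a fine tagged division, intervals with a tag where \<open>u\<close> is differentiable
contribute their increment up to a small multiple of their length, by the choice of the gauge. Those
with a tag in the exceptional null set lie in an open set of small measure, so absolute continuity
makes their increments small in total.\<close>

proposition AC_on_deriv_has_integral:
  assumes u: "AC_on a b u" and "a \<le> b"
  shows "(deriv u has_integral (u b - u a)) {a..b}"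
proof -
  define N where "N = {a, b} \<union> {x \<in> {a<..<b}. \<not> u differentiable (at x)}"
  have N: "negligible N" unfolding N_def
    by (intro negligible_Un AC_on_differentiable_ae[OF u]) auto
  define g where "g = (\<lambda>x. if x \<in> N then 0 else deriv u x)"
  have g: "(u has_field_derivative g x) (at x)" if "x \<in> {a..b}" "x \<notin> N" for x
    using that unfolding g_def N_def by (auto simp: DERIV_deriv_iff_real_differentiable)
  have "(g has_integral (u b - u a)) (cbox a b)"
    unfolding has_integral
  proof (intro allI impI)
    fix e :: real assume e: "e > 0"
    define \<epsilon> where "\<epsilon> = e / (2 * (b - a + 1))"
    have \<epsilon>: "\<epsilon> > 0" using e \<open>a \<le> b\<close> unfolding \<epsilon>_def by simp
    have \<epsilon>ba: "\<epsilon> * (b - a) < e / 2" using e \<open>a \<le> b\<close> unfolding \<epsilon>_def by (simp add: field_simps)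
    obtain \<delta> where \<delta>: "0 < \<delta>" "\<And>I. packing a b I \<Longrightarrow> (\<Sum>(s, t)\<in>I. t - s) < \<delta> \<Longrightarrow>
       (\<Sum>(s, t)\<in>I. \<bar>u t - u s\<bar>) < e / 2"
      using AC_onE[OF u, of "e / 2"] e by auto
    obtain U where U: "open U" "N \<subseteq> U" and Um: "U \<in> lmeasurable" "measure lebesgue U < \<delta>"
      using negligible_open_superset[OF N \<delta>(1)] by blast
    have "\<exists>d>0. \<forall>y. \<bar>y - x\<bar> < d \<longrightarrow> \<bar>u y - u x - g x * (y - x)\<bar> \<le> \<epsilon> * \<bar>y - x\<bar>"
      if "x \<in> {a..b}" "x \<notin> N" for x
      using g[OF that] \<epsilon> unfolding has_field_derivative_def has_derivative_at_alt real_norm_def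
      by (auto simp: mult.commute)
    then obtain d where d: "\<And>x. x \<in> {a..b} \<Longrightarrow> x \<notin> N \<Longrightarrow> d x > 0"
      "\<And>x y. x \<in> {a..b} \<Longrightarrow> x \<notin> N \<Longrightarrow> \<bar>y - x\<bar> < d x \<Longrightarrow> \<bar>u y - u x - g x * (y - x)\<bar> \<le> \<epsilon> * \<bar>y - x\<bar>"
      by metis
    (* Outside {a..b} the gauge is irrelevant, but it has to contain its centre. *)
    define \<gamma> where "\<gamma> = (\<lambda>x. if x \<in> N then U else if x \<in> {a..b} then ball x (d x) else ball x 1)"
    have gauge: "gauge \<gamma>" unfolding gauge_def \<gamma>_def using U(1,2) d(1) by auto
    have main: "norm ((\<Sum>(x, K)\<in>\<D>. measure lborel K *\<^sub>R g x) - (u b - u a)) < e"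
      if D: "\<D> tagged_division_of cbox a b" and fine: "\<gamma> fine \<D>" for \<D>
    proof -
      have fin: "finite \<D>" using D by (rule tagged_division_of_finite)
      have tag: "x \<in> K \<and> a \<le> Inf K \<and> Inf K \<le> x \<and> x \<le> Sup K \<and> Sup K \<le> b \<and> K = {Inf K..Sup K} \<and> K \<subseteq> \<gamma> x"
        if xK: "(x, K) \<in> \<D>" for x K
      proof -
        obtain s t where K: "K = {s..t}"
          using tagged_division_ofD(4)[OF D xK] by auto
        have x: "x \<in> K" "K \<subseteq> {a..b}" using tagged_division_ofD(2,3)[OF D xK] by auto
        then have st: "s \<le> t" using K by auto
        then have "Inf K = s" "Sup K = t" using K by auto
        then show ?thesis using x K st fine xK unfolding fine_def by auto
      qed
      (* A tagged division may contain degenerate intervals, which a packing excludes. *)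
      define D1 where "D1 = {(x, K) \<in> \<D>. x \<in> N \<and> Inf K < Sup K}"
      have fin1: "finite D1" unfolding D1_def using fin by (auto intro: finite_subset[of _ \<D>])
      have sep: "Sup K \<le> Inf K' \<or> Sup K' \<le> Inf K"
        if "(x, K) \<in> D1" "(x', K') \<in> D1" "(x, K) \<noteq> (x', K')" for x K x' K'
      proof (rule ccontr)
        assume H: "\<not> ?thesis"
        have "interior K \<inter> interior K' = {}"
          using tagged_division_ofD(5)[OF D] that unfolding D1_def by blast
        moreover have "interior K = {Inf K<..<Sup K}" "interior K' = {Inf K'<..<Sup K'}"
          using tag[of x K] tag[of x' K'] that interior_atLeastAtMost_real[of "Inf K" "Sup K"]
            interior_atLeastAtMost_real[of "Inf K'" "Sup K'"] unfolding D1_def by auto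
        moreover have "max (Inf K) (Inf K') < min (Sup K) (Sup K')"
          using H that unfolding D1_def by auto
        then obtain z where "max (Inf K) (Inf K') < z" "z < min (Sup K) (Sup K')" using dense by blast
        ultimately show False by auto
      qed
      define p q where "p = (\<lambda>i :: real \<times> real set. Inf (snd i))" and "q = (\<lambda>i :: real \<times> real set. Sup (snd i))"
      have pq: "a \<le> p i \<and> p i < q i \<and> q i \<le> b" if "i \<in> D1" for i
        using that tag[of "fst i" "snd i"] unfolding D1_def p_def q_def by (auto simp: case_prod_beta)
      have sep': "q i \<le> p j \<or> q j \<le> p i" if "i \<in> D1" "j \<in> D1" "i \<noteq> j" for i j
        using that sep[of "fst i" "snd i" "fst j" "snd j"] unfolding p_def q_def by auto
      note image = packing_image[of D1 a p q b, OF fin1 pq sep', simplified]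
      have "(\<Sum>(s, t)\<in>(\<lambda>i. (p i, q i)) ` D1. t - s) \<le> measure lebesgue U"
      proof (rule packing_measure[OF image(1) Um(1)])
        fix s t assume "(s, t) \<in> (\<lambda>i. (p i, q i)) ` D1"
        then obtain x K where "(x, K) \<in> D1" "s = Inf K" "t = Sup K" unfolding p_def q_def by auto
        then show "{s<..<t} \<subseteq> U"
          using tag[of x K] unfolding D1_def \<gamma>_def by fastforce
      qed
      then have "(\<Sum>(s, t)\<in>(\<lambda>i. (p i, q i)) ` D1. \<bar>u t - u s\<bar>) < e / 2"
        using \<delta>(2)[OF image(1)] Um(2) by linarith
      then have sum1: "(\<Sum>(x, K)\<in>D1. \<bar>u (Sup K) - u (Inf K)\<bar>) < e / 2"
        by (subst (asm) image(2)) (simp add: p_def q_def case_prod_unfold)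
      have bound: "\<bar>measure lborel K * g x - (u (Sup K) - u (Inf K))\<bar> \<le>
          \<epsilon> * measure lborel K + (if (x, K) \<in> D1 then \<bar>u (Sup K) - u (Inf K)\<bar> else 0)" if xK: "(x, K) \<in> \<D>" for x K
      proof -
        note T = tag[OF xK]
        have cont: "measure lborel K = Sup K - Inf K" using T by (metis measure_lborel_Icc order_trans)
        show ?thesis
        proof (cases "x \<in> N")
          case True
          then have "g x = 0" unfolding g_def by simp
          moreover have "Sup K = Inf K" if "(x, K) \<notin> D1"
            using that True xK T unfolding D1_def by auto
          moreover have "0 \<le> \<epsilon> * measure lborel K" using \<epsilon> by simp
          ultimately show ?thesis by (simp add: abs_minus_commute)
        next
          case False
          have xab: "x \<in> {a..b}" using T by auto
          have "Inf K \<in> K" "Sup K \<in> K" using T by auto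
          then have "Inf K \<in> ball x (d x)" "Sup K \<in> ball x (d x)"
            using T False xab unfolding \<gamma>_def by auto
          then have *: "\<bar>u (Inf K) - u x - g x * (Inf K - x)\<bar> \<le> \<epsilon> * \<bar>Inf K - x\<bar>"
            "\<bar>u (Sup K) - u x - g x * (Sup K - x)\<bar> \<le> \<epsilon> * \<bar>Sup K - x\<bar>"
            using d(2)[OF xab False, of "Inf K"] d(2)[OF xab False, of "Sup K"]
            by (simp_all add: dist_real_def abs_minus_commute[of x])
          have eqs: "\<bar>Inf K - x\<bar> = x - Inf K" "\<bar>Sup K - x\<bar> = Sup K - x" using T by auto
          have "measure lborel K * g x - (u (Sup K) - u (Inf K)) =
             (u (Inf K) - u x - g x * (Inf K - x)) - (u (Sup K) - u x - g x * (Sup K - x))"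
            unfolding cont by (simp add: algebra_simps)
          also have "\<bar>\<dots>\<bar> \<le> \<epsilon> * (x - Inf K) + \<epsilon> * (Sup K - x)"
            using *[unfolded eqs] by linarith
          also have "\<dots> = \<epsilon> * measure lborel K" unfolding cont by (simp add: algebra_simps)
          finally show ?thesis by auto
        qed
      qed
      have "(\<Sum>(x, K)\<in>\<D>. measure lborel K *\<^sub>R g x) - (u b - u a) =
         (\<Sum>(x, K)\<in>\<D>. measure lborel K * g x - (u (Sup K) - u (Inf K)))"
        using additive_tagged_division_1[OF \<open>a \<le> b\<close>, of \<D> u] D
        by (simp add: sum_subtractf case_prod_beta)
      also have "\<bar>\<dots>\<bar> \<le> (\<Sum>(x, K)\<in>\<D>. \<bar>measure lborel K * g x - (u (Sup K) - u (Inf K))\<bar>)"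
        by (rule order_trans[OF sum_abs]) (simp add: case_prod_beta)
      also have "\<dots> \<le> (\<Sum>(x, K)\<in>\<D>. \<epsilon> * measure lborel K + (if (x, K) \<in> D1 then \<bar>u (Sup K) - u (Inf K)\<bar> else 0))"
        using bound by (intro sum_mono) auto
      also have "\<dots> = \<epsilon> * (\<Sum>(x, K)\<in>\<D>. measure lborel K) +
          (\<Sum>i\<in>\<D>. if i \<in> D1 then (case i of (x, K) \<Rightarrow> \<bar>u (Sup K) - u (Inf K)\<bar>) else 0)"
        unfolding sum_distrib_left sum.distrib[symmetric] by (intro sum.cong) auto
      also have "(\<Sum>i\<in>\<D>. if i \<in> D1 then (case i of (x, K) \<Rightarrow> \<bar>u (Sup K) - u (Inf K)\<bar>) else 0)
          = (\<Sum>(x, K)\<in>D1. \<bar>u (Sup K) - u (Inf K)\<bar>)"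
        using fin by (subst sum.inter_restrict[symmetric]) (auto intro!: sum.cong simp: D1_def)
      also have "(\<Sum>(x, K)\<in>\<D>. measure lborel K) = b - a"
        using additive_content_tagged_division[OF D] \<open>a \<le> b\<close> by simp
      finally show ?thesis using \<epsilon>ba sum1 by simp
    qed
    show "\<exists>\<gamma>. gauge \<gamma> \<and> (\<forall>\<D>. \<D> tagged_division_of cbox a b \<and> \<gamma> fine \<D> \<longrightarrow>
        norm ((\<Sum>(x, K)\<in>\<D>. measure lborel K *\<^sub>R g x) - (u b - u a)) < e)"
      by (intro exI[of _ \<gamma>] conjI allI impI gauge) (elim conjE, rule main)
  qed
  then have "(deriv u has_integral (u b - u a)) (cbox a b)"
    by (rule has_integral_spike[OF N, rotated]) (auto simp: g_def)
  then show ?thesis by simp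
qed

lemma ae_lborel_of_negligible:
  assumes "negligible N" "\<And>x. x \<notin> N \<Longrightarrow> P x"
  shows "AE x in lborel. P (x :: real)"
proof -
  have "AE x in lebesgue. x \<notin> N" using assms(1) by (intro AE_not_in) (simp add: negligible_iff_null_sets)
  then have "AE x in lborel. x \<notin> N" by (simp add: AE_completion_iff)
  then show ?thesis by (rule eventually_mono) (rule assms(2))
qed

lemma AC_on_clamp_measurable:
  assumes u: "AC_on a b u"
  shows "(\<lambda>x. u (max a (min b x))) \<in> borel_measurable borel"
proof (cases "a \<le> b")
  case True
  then have "continuous_on UNIV (\<lambda>x. u (max a (min b x)))"
    by (intro continuous_on_compose2[OF AC_on_imp_continuous_on[OF u]]) (auto intro!: continuous_intros)
  then show ?thesis by (rule borel_measurable_continuous_onI)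
next
  case False
  then have "max a (min b x) = a" for x by auto
  then show ?thesis by simp
qed

text \<open>The function \<open>deriv u\<close> itself may fail to be measurable: it has no meaning where \<open>u\<close> is not
differentiable, and at \<open>a\<close> and \<open>b\<close> it depends on the values of \<open>u\<close> outside the interval. A limit of
difference quotients of a continuous extension of \<open>u\<close> agrees with it almost everywhere.\<close>

lemma AC_on_deriv_measurable:
  assumes u: "AC_on a b u"
  obtains g where "g \<in> borel_measurable borel"
    "AE x in lborel. x \<in> {a..b} \<longrightarrow> a < x \<and> x < b \<and> u differentiable (at x) \<and> deriv u x = g x"
proof -
  define v where "v = (\<lambda>x. u (max a (min b x)))"
  define g where "g = (\<lambda>x. lim (\<lambda>n. (v (x + inverse (real (Suc n))) - v x) / inverse (real (Suc n))))"
  have [measurable]: "v \<in> borel_measurable borel" unfolding v_def by (rule AC_on_clamp_measurable[OF u])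
  have gm: "g \<in> borel_measurable borel" unfolding g_def by measurable
  have lim: "deriv u x = g x" if x: "a < x" "x < b" and d: "u differentiable (at x)" for x
  proof -
    have D: "((\<lambda>h. (u (x + h) - u x) / h) \<longlongrightarrow> deriv u x) (at 0)"
      using d by (simp add: DERIV_deriv_iff_real_differentiable[symmetric] DERIV_def)
    have seq: "filterlim (\<lambda>n. inverse (real (Suc n))) (at 0) sequentially"
      using LIMSEQ_inverse_real_of_nat by (intro filterlim_atI) auto
    have "(\<lambda>n. (u (x + inverse (real (Suc n))) - u x) / inverse (real (Suc n))) \<longlonglongrightarrow> deriv u x"
      using filterlim_compose[OF D seq] .
    moreover have "eventually (\<lambda>n. inverse (real (Suc n)) < b - x) sequentially"
      using LIMSEQ_inverse_real_of_nat x by (intro order_tendstoD(2)) auto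
    then have "eventually (\<lambda>n. (u (x + inverse (real (Suc n))) - u x) / inverse (real (Suc n)) =
       (v (x + inverse (real (Suc n))) - v x) / inverse (real (Suc n))) sequentially"
    proof (rule eventually_mono)
      fix n assume "inverse (real (Suc n)) < b - x"
      moreover have "0 < inverse (real (Suc n))" by simp
      ultimately have "v (x + inverse (real (Suc n))) = u (x + inverse (real (Suc n)))" "v x = u x"
        using x unfolding v_def by (auto simp del: inverse_positive_iff_positive)
      then show "(u (x + inverse (real (Suc n))) - u x) / inverse (real (Suc n)) =
       (v (x + inverse (real (Suc n))) - v x) / inverse (real (Suc n))" by simp
    qed
    ultimately have "(\<lambda>n. (v (x + inverse (real (Suc n))) - v x) / inverse (real (Suc n))) \<longlonglongrightarrow> deriv u x"
      by (rule Lim_transform_eventually)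
    then show ?thesis unfolding g_def by (rule limI[symmetric])
  qed
  have "negligible ({a, b} \<union> {x \<in> {a<..<b}. \<not> u differentiable (at x)})"
    by (intro negligible_Un AC_on_differentiable_ae[OF u]) auto
  then have "AE x in lborel. x \<in> {a..b} \<longrightarrow> a < x \<and> x < b \<and> u differentiable (at x) \<and> deriv u x = g x"
    by (rule ae_lborel_of_negligible) (use lim in auto)
  with gm show thesis by (rule that)
qed

text \<open>If the right-hand side is finite, then the derivative is Lebesgue integrable and the integral of the
fundamental theorem of calculus above is a Lebesgue integral.\<close>

proposition AC_on_increment_le_nn_integral:
  assumes u: "AC_on a b u" and "a \<le> b"
  shows "ennreal \<bar>u b - u a\<bar> \<le> (\<integral>\<^sup>+x\<in>{a..b}. ennreal \<bar>deriv u x\<bar> \<partial>lborel)"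
proof (cases "(\<integral>\<^sup>+x\<in>{a..b}. ennreal \<bar>deriv u x\<bar> \<partial>lborel) = \<infinity>")
  case False
  obtain g where [measurable]: "g \<in> borel_measurable borel" and
    g: "AE x in lborel. x \<in> {a..b} \<longrightarrow> a < x \<and> x < b \<and> u differentiable (at x) \<and> deriv u x = g x"
    by (rule AC_on_deriv_measurable[OF u])
  define h where "h = (\<lambda>x. indicator {a..b} x * g x)"
  have hm: "h \<in> borel_measurable borel" unfolding h_def by measurable
  have nn: "(\<integral>\<^sup>+x. ennreal (norm (h x)) \<partial>lborel) = (\<integral>\<^sup>+x\<in>{a..b}. ennreal \<bar>deriv u x\<bar> \<partial>lborel)"
    by (rule nn_integral_cong_AE) (use g in \<open>auto simp: h_def elim!: eventually_mono split: split_indicator\<close>)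
  have int: "integrable lborel h"
    using False hm unfolding nn[symmetric] by (intro integrableI_bounded) (auto simp: less_top)
  have "AE x in lebesgue. x \<in> {a..b} \<longrightarrow> a < x \<and> x < b \<and> u differentiable (at x) \<and> deriv u x = g x"
    using g by (simp add: AE_completion)
  then obtain N where N: "negligible N" "\<And>x. x \<notin> N \<Longrightarrow> x \<in> {a..b} \<Longrightarrow> deriv u x = g x"
    unfolding eventually_ae_filter negligible_iff_null_sets by auto
  have "(g has_integral (u b - u a)) {a..b}"
    by (rule has_integral_spike[OF N(1) _ AC_on_deriv_has_integral[OF u \<open>a \<le> b\<close>]]) (use N(2) in auto)
  then have "((\<lambda>x. if x \<in> {a..b} then g x else 0) has_integral (u b - u a)) UNIV"
    by (simp only: has_integral_restrict_UNIV)
  moreover have "(\<lambda>x. if x \<in> {a..b} then g x else 0) = h" unfolding h_def by (auto simp: fun_eq_iff)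
  ultimately have "u b - u a = integral\<^sup>L lborel h"
    using has_integral_unique[OF _ has_integral_integral_lborel[OF int]] by simp
  then have "ennreal \<bar>u b - u a\<bar> = ennreal (norm (integral\<^sup>L lborel h))" by simp
  also have "\<dots> \<le> (\<integral>\<^sup>+x. ennreal (norm (h x)) \<partial>lborel)"
    by (rule integral_norm_bound_ennreal[OF int])
  finally show ?thesis unfolding nn .
qed simp

section \<open>Sets of linear measure zero and infinite one-sided derivatives\<close>

text \<open>In dimension one a cover with small total diameter automatically has small mesh, so for null sets
the bound on the single diameters can be forgotten.\<close>

lemma hausdorff1_eq_0I:
  fixes A :: "'a::metric_space set"
  assumes "\<And>\<epsilon>. 0 < \<epsilon> \<Longrightarrow> \<exists>C :: nat \<Rightarrow> 'a set. A \<subseteq> (\<Union>i. C i) \<and> (\<forall>i. bounded (C i)) \<and>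
    (\<Sum>i. ennreal (diameter (C i))) \<le> ennreal \<epsilon>"
  shows "hausdorff1 A = 0"
proof -
  have "hausdorff1_pre \<delta> A \<le> 0" if "0 < \<delta>" for \<delta>
  proof (rule ennreal_le_epsilon)
    fix e :: real assume "0 < e"
    have pos: "0 < min e \<delta>" using \<open>0 < e\<close> that by simp
    obtain C :: "nat \<Rightarrow> 'a set" where C: "A \<subseteq> (\<Union>i. C i)" "\<And>i. bounded (C i)"
      "(\<Sum>i. ennreal (diameter (C i))) \<le> ennreal (min e \<delta>)"
      using assms[OF pos] by blast
    have "diameter (C i) \<le> \<delta>" for i
    proof -
      have "ennreal (diameter (C i)) = (\<Sum>j\<in>{i}. ennreal (diameter (C j)))" by simp
      also have "\<dots> \<le> (\<Sum>i. ennreal (diameter (C i)))" by (rule sum_le_suminf) auto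
      also have "\<dots> \<le> ennreal (min e \<delta>)" by (rule C(3))
      finally have "diameter (C i) \<le> min e \<delta>" using pos by (subst (asm) ennreal_le_iff) auto
      then show ?thesis by simp
    qed
    then have "hausdorff1_pre \<delta> A \<le> (\<Sum>i. ennreal (diameter (C i)))"
      unfolding hausdorff1_pre_def using C by (intro INF_lower) auto
    also have "\<dots> \<le> 0 + ennreal e" using C(3) by (rule order_trans) (auto intro!: ennreal_leI)
    finally show "hausdorff1_pre \<delta> A \<le> 0 + ennreal e" .
  qed
  then show ?thesis unfolding hausdorff1_def by (intro antisym SUP_least) auto
qed

lemma hausdorff1_eq_0D:
  fixes A :: "'a::metric_space set"
  assumes "hausdorff1 A = 0" "0 < \<epsilon>"
  shows "\<exists>C :: nat \<Rightarrow> 'a set. A \<subseteq> (\<Union>i. C i) \<and> (\<forall>i. bounded (C i)) \<and>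
    (\<Sum>i. ennreal (diameter (C i))) \<le> ennreal \<epsilon>"
proof -
  have "hausdorff1_pre 1 A \<le> hausdorff1 A" unfolding hausdorff1_def by (rule SUP_upper) auto
  then have "hausdorff1_pre 1 A < ennreal \<epsilon>" using assms by simp
  then show ?thesis unfolding hausdorff1_pre_def INF_less_iff by (auto intro: less_imp_le)
qed

lemma hausdorff1_null_subset:
  assumes "hausdorff1 B = 0" "A \<subseteq> B"
  shows "hausdorff1 A = 0"
proof (rule hausdorff1_eq_0I)
  fix \<epsilon> :: real assume "0 < \<epsilon>"
  from hausdorff1_eq_0D[OF assms(1) this]
  show "\<exists>C :: nat \<Rightarrow> 'a set. A \<subseteq> (\<Union>i. C i) \<and> (\<forall>i. bounded (C i)) \<and>
    (\<Sum>i. ennreal (diameter (C i))) \<le> ennreal \<epsilon>"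
    using assms(2) by (elim ex_forward) auto
qed

lemma hausdorff1_null_UN:
  fixes A :: "nat \<Rightarrow> 'a::metric_space set"
  assumes "\<And>n. hausdorff1 (A n) = 0"
  shows "hausdorff1 (\<Union>n. A n) = 0"
proof (rule hausdorff1_eq_0I)
  fix \<epsilon> :: real assume "0 < \<epsilon>"
  then have "\<exists>C :: nat \<Rightarrow> 'a set. A n \<subseteq> (\<Union>i. C i) \<and> (\<forall>i. bounded (C i)) \<and>
    (\<Sum>i. ennreal (diameter (C i))) \<le> ennreal (\<epsilon> * (1/2) ^ Suc n)" for n
    by (intro hausdorff1_eq_0D assms) simp
  then obtain C :: "nat \<Rightarrow> nat \<Rightarrow> 'a set" where C: "\<And>n. A n \<subseteq> (\<Union>i. C n i)" "\<And>n i. bounded (C n i)"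
    "\<And>n. (\<Sum>i. ennreal (diameter (C n i))) \<le> ennreal (\<epsilon> * (1/2) ^ Suc n)"
    by metis
  define D where "D = (\<lambda>k. C (fst (prod_decode k)) (snd (prod_decode k)))"
  have "(\<Sum>k. ennreal (diameter (D k))) = (\<Sum>n. \<Sum>i. ennreal (diameter (C n i)))"
    using suminf_ennreal_2dimen[of "\<lambda>n. \<Sum>i. ennreal (diameter (C n i))" "\<lambda>(n, i). ennreal (diameter (C n i))"]
    unfolding D_def by (simp add: case_prod_beta)
  also have "\<dots> \<le> (\<Sum>n. ennreal (\<epsilon> * (1/2) ^ Suc n))" by (intro suminf_le C(3)) auto
  also have "\<dots> = ennreal \<epsilon>"
  proof (rule suminf_ennreal_eq)
    show "(\<lambda>n. \<epsilon> * (1/2) ^ Suc n) sums \<epsilon>"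
      using sums_mult[OF power_half_series, of \<epsilon>] by simp
  qed (use \<open>0 < \<epsilon>\<close> in auto)
  finally have le: "(\<Sum>k. ennreal (diameter (D k))) \<le> ennreal \<epsilon>" .
  have "(\<Union>n. A n) \<subseteq> (\<Union>k. D k)"
  proof
    fix x assume "x \<in> (\<Union>n. A n)"
    then obtain n i where "x \<in> C n i" using C(1) by blast
    then have "x \<in> D (prod_encode (n, i))" unfolding D_def by simp
    then show "x \<in> (\<Union>k. D k)" by blast
  qed
  then show "\<exists>D :: nat \<Rightarrow> 'a set. (\<Union>n. A n) \<subseteq> (\<Union>i. D i) \<and> (\<forall>i. bounded (D i)) \<and>
    (\<Sum>i. ennreal (diameter (D i))) \<le> ennreal \<epsilon>"
    using le C(2) unfolding D_def by blast
qed

text \<open>Cover \<open>N\<close> by nonoverlapping intervals of small total length. The diameter of the image of such an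
interval is attained at two of its points, and these pairs form a packing, to which absolute
continuity applies. With values in a metric space the lemma covers both graphs and vertical lines.\<close>

lemma hausdorff1_AC_image_null:
  fixes h :: "real \<Rightarrow> 'a::metric_space"
  assumes N: "negligible N" "N \<subseteq> {a..b}" and "a < b"
    and AC: "\<And>\<epsilon>. 0 < \<epsilon> \<Longrightarrow> \<exists>\<delta>>0. \<forall>I. packing a b I \<longrightarrow> (\<Sum>(s, t)\<in>I. t - s) < \<delta> \<longrightarrow>
      (\<Sum>(s, t)\<in>I. dist (h s) (h t)) < \<epsilon>"
  shows "hausdorff1 (h ` N) = 0"
proof (rule hausdorff1_eq_0I)
  fix \<epsilon> :: real assume "0 < \<epsilon>"
  have cont: "continuous_on {a..b} h"
    unfolding continuous_on_iff
  proof (intro ballI allI impI)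
    fix x e :: real assume x: "x \<in> {a..b}" and "0 < e"
    then obtain d where d: "d > 0" "\<And>I. packing a b I \<Longrightarrow> (\<Sum>(s, t)\<in>I. t - s) < d \<Longrightarrow>
      (\<Sum>(s, t)\<in>I. dist (h s) (h t)) < e" using AC by blast
    have "dist (h y) (h x) < e" if "y \<in> {a..b}" "dist y x < d" for y
    proof (cases y x rule: linorder_cases)
      case less
      then show ?thesis using d(2)[OF packing_single, of y x] that x by (auto simp: dist_real_def)
    next
      case greater
      then show ?thesis using d(2)[OF packing_single, of x y] that x by (auto simp: dist_real_def dist_commute)
    qed (use \<open>0 < e\<close> in auto)
    then show "\<exists>d>0. \<forall>y\<in>{a..b}. dist y x < d \<longrightarrow> dist (h y) (h x) < e" using d(1) by blast
  qed
  obtain \<delta> where \<delta>: "\<delta> > 0" "\<And>I. packing a b I \<Longrightarrow> (\<Sum>(s, t)\<in>I. t - s) < \<delta> \<Longrightarrow>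
      (\<Sum>(s, t)\<in>I. dist (h s) (h t)) < \<epsilon>" using AC[OF \<open>0 < \<epsilon>\<close>] by blast
  obtain U where U: "open U" "N \<subseteq> U" "U \<in> lmeasurable" "measure lebesgue U < \<delta>"
    using negligible_open_superset[OF N(1) \<delta>(1)] by blast
  define \<gamma> where "\<gamma> = (\<lambda>x. if x \<in> U then U else UNIV)"
  have "gauge \<gamma>" unfolding gauge_def \<gamma>_def using U(1) by auto
  moreover have "N \<subseteq> cbox a b" "box a b \<noteq> {}" using N(2) \<open>a < b\<close> by auto
  ultimately obtain \<D> where D: "countable \<D>" "\<Union>\<D> \<subseteq> cbox a b"
    "\<And>K. K \<in> \<D> \<Longrightarrow> interior K \<noteq> {} \<and> (\<exists>c d. K = cbox c d)"
    "pairwise (\<lambda>A B. interior A \<inter> interior B = {}) \<D>"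
    "\<And>K. K \<in> \<D> \<Longrightarrow> \<exists>x \<in> N \<inter> K. K \<subseteq> \<gamma> x" "N \<subseteq> \<Union>\<D>"
    using covering_lemma[of N a b \<gamma>] by metis
  have Dab: "K \<subseteq> {a..b}" if "K \<in> \<D>" for K using D(2) that by auto
  have DU: "K \<subseteq> U" if K: "K \<in> \<D>" for K
  proof -
    obtain x where "x \<in> N" "K \<subseteq> \<gamma> x" using D(5)[OF K] by auto
    moreover have "x \<in> U" using \<open>x \<in> N\<close> U(2) by auto
    ultimately show ?thesis unfolding \<gamma>_def by simp
  qed
  have "\<exists>p q. p \<le> q \<and> {p..q} \<subseteq> K \<and> diameter (h ` K) = dist (h p) (h q)" if K: "K \<in> \<D>" for K
  proof -
    obtain c d where cd: "K = {c..d}" using D(3)[OF K] by auto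
    have "compact K" using cd by simp
    then have "compact (h ` K)"
      by (intro compact_continuous_image continuous_on_subset[OF cont] Dab K)
    moreover have "h ` K \<noteq> {}" using D(5)[OF K] by auto
    ultimately obtain x y where xy: "x \<in> K" "y \<in> K" "diameter (h ` K) = dist (h x) (h y)"
      using diameter_compact_attained by fastforce
    show ?thesis
      using xy cd by (intro exI[of _ "min x y"] exI[of _ "max x y"]) (auto simp: min_def max_def dist_commute)
  qed
  then obtain p q where pq: "\<And>K. K \<in> \<D> \<Longrightarrow> p K \<le> q K" "\<And>K. K \<in> \<D> \<Longrightarrow> {p K..q K} \<subseteq> K"
    "\<And>K. K \<in> \<D> \<Longrightarrow> diameter (h ` K) = dist (h (p K)) (h (q K))" by metis
  have fin_sum: "(\<Sum>K\<in>F. diameter (h ` K)) \<le> \<epsilon>" if F: "finite F" "F \<subseteq> \<D>" for F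
  proof -
    define F' where "F' = {K \<in> F. p K < q K}"
    have F': "finite F'" "F' \<subseteq> \<D>" using F unfolding F'_def by auto
    have sep: "q K \<le> p K' \<or> q K' \<le> p K" if "K \<in> F'" "K' \<in> F'" "K \<noteq> K'" for K K'
    proof (rule ccontr)
      assume "\<not> ?thesis"
      then have "max (p K) (p K') < min (q K) (q K')" using that unfolding F'_def by auto
      then obtain z where z: "max (p K) (p K') < z" "z < min (q K) (q K')" using dense by blast
      have int: "{p L<..<q L} \<subseteq> interior L" if "L \<in> F'" for L
      proof (rule interior_maximal)
        have "{p L..q L} \<subseteq> L" using pq(2) that F'(2) by blast
        then show "{p L<..<q L} \<subseteq> L" by force
      qed simp
      have "z \<in> interior K \<inter> interior K'"
        using z int[OF that(1)] int[OF that(2)] by auto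
      then show False using pairwiseD[OF D(4), of K K'] that F'(2) by blast
    qed
    have ab: "a \<le> p K \<and> p K < q K \<and> q K \<le> b" if "K \<in> F'" for K
    proof -
      have "p K < q K" "{p K..q K} \<subseteq> K" "K \<subseteq> {a..b}"
        using that pq(2)[of K] Dab[of K] F'(2) unfolding F'_def by auto
      moreover have "p K \<in> {p K..q K}" "q K \<in> {p K..q K}" using \<open>p K < q K\<close> by auto
      ultimately have "p K \<in> {a..b}" "q K \<in> {a..b}" by blast+
      then show ?thesis using \<open>p K < q K\<close> by simp
    qed
    note image = packing_image[of F' a p q b, OF F'(1) ab sep, simplified]
    have "(\<Sum>(s, t)\<in>(\<lambda>K. (p K, q K)) ` F'. t - s) \<le> measure lebesgue U"
    proof (rule packing_measure[OF image(1) U(3)])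
      fix s t assume "(s, t) \<in> (\<lambda>K. (p K, q K)) ` F'"
      then obtain K where K: "K \<in> F'" "s = p K" "t = q K" by auto
      then have "{s..t} \<subseteq> U" using pq(2)[of K] DU[of K] F'(2) by blast
      then show "{s<..<t} \<subseteq> U" by auto
    qed
    then have "(\<Sum>(s, t)\<in>(\<lambda>K. (p K, q K)) ` F'. dist (h s) (h t)) < \<epsilon>"
      using \<delta>(2)[OF image(1)] U(4) by linarith
    then have "(\<Sum>K\<in>F'. dist (h (p K)) (h (q K))) < \<epsilon>" by (subst (asm) image(2))
    moreover have "(\<Sum>K\<in>F. diameter (h ` K)) = (\<Sum>K\<in>F. dist (h (p K)) (h (q K)))"
      using F pq(3) by (intro sum.cong) auto
    moreover have "(\<Sum>K\<in>F'. dist (h (p K)) (h (q K))) = (\<Sum>K\<in>F. dist (h (p K)) (h (q K)))"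
    proof (rule sum.mono_neutral_left[OF F(1)])
      show "\<forall>K\<in>F - F'. dist (h (p K)) (h (q K)) = 0"
      proof
        fix K assume "K \<in> F - F'"
        then have "p K = q K" using pq(1)[of K] F(2) unfolding F'_def by fastforce
        then show "dist (h (p K)) (h (q K)) = 0" by simp
      qed
    qed (auto simp: F'_def)
    ultimately show ?thesis by linarith
  qed
  (* The cover has to be indexed by all natural numbers; superfluous indices get the empty set. *)
  define J where "J = to_nat_on \<D> ` \<D>"
  define \<kappa> where "\<kappa> = inv_into \<D> (to_nat_on \<D>)"
  have \<kappa>: "inj_on \<kappa> J" "\<And>i. i \<in> J \<Longrightarrow> \<kappa> i \<in> \<D>" "\<And>K. K \<in> \<D> \<Longrightarrow> \<kappa> (to_nat_on \<D> K) = K"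
    unfolding \<kappa>_def J_def using inj_on_to_nat_on[OF D(1)]
    by (auto intro: inj_on_inv_into inv_into_into)
  define C where "C = (\<lambda>i. if i \<in> J then h ` \<kappa> i else {})"
  have "bounded (C i)" for i
  proof (cases "i \<in> J")
    case True
    then obtain c d where "\<kappa> i = {c..d}" using D(3)[OF \<kappa>(2)] by fastforce
    then have "compact (\<kappa> i)" by simp
    then have "compact (h ` \<kappa> i)"
      by (intro compact_continuous_image continuous_on_subset[OF cont] Dab \<kappa>(2) True)
    then show ?thesis using True compact_imp_bounded unfolding C_def by auto
  qed (simp add: C_def)
  moreover have "h ` N \<subseteq> (\<Union>i. C i)"
  proof
    fix y assume "y \<in> h ` N"
    then obtain x K where "y = h x" "x \<in> K" "K \<in> \<D>" using D(6) by auto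
    then have "y \<in> C (to_nat_on \<D> K)" using \<kappa>(3) unfolding C_def J_def by auto
    then show "y \<in> (\<Union>i. C i)" by blast
  qed
  moreover have "(\<Sum>i. ennreal (diameter (C i))) \<le> ennreal \<epsilon>"
  proof (rule suminf_le_const)
    fix n
    have dge: "0 \<le> diameter (C i)" for i using calculation(1) by (rule diameter_ge_0)
    have "(\<Sum>i<n. ennreal (diameter (C i))) = ennreal (\<Sum>i<n. diameter (C i))"
      using dge by (simp add: sum_ennreal)
    also have "(\<Sum>i<n. diameter (C i)) = (\<Sum>i\<in>{..<n} \<inter> J. diameter (h ` \<kappa> i))"
      by (subst sum.inter_restrict) (auto simp: C_def intro!: sum.cong)
    also have "\<dots> = (\<Sum>K\<in>\<kappa> ` ({..<n} \<inter> J). diameter (h ` K))"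
      by (subst sum.reindex) (auto intro: inj_on_subset[OF \<kappa>(1)])
    also have "ennreal \<dots> \<le> ennreal \<epsilon>" using \<kappa>(2) by (intro ennreal_leI fin_sum) auto
    finally show "(\<Sum>i<n. ennreal (diameter (C i))) \<le> ennreal \<epsilon>" .
  qed auto
  ultimately show "\<exists>C :: nat \<Rightarrow> 'a set. h ` N \<subseteq> (\<Union>i. C i) \<and> (\<forall>i. bounded (C i)) \<and>
    (\<Sum>i. ennreal (diameter (C i))) \<le> ennreal \<epsilon>" by blast
qed

lemma negligible_uminus_image:
  fixes S :: "real set"
  assumes "negligible S"
  shows "negligible (uminus ` S)"
  by (rule negligible_differentiable_image_negligible[OF order_refl assms])
    (auto intro!: differentiable_at_imp_differentiable_on derivative_intros)

text \<open>Choose a rational number in the gap to the left of each such point; different points get different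
numbers.\<close>

lemma countable_left_isolated:
  fixes A :: "real set"
  shows "countable {t \<in> A. \<exists>\<rho>>0. A \<inter> {t - \<rho><..<t} = {}}" 
proof -
  define Is where "Is = {t \<in> A. \<exists>\<rho>>0. A \<inter> {t - \<rho><..<t} = {}}"
  have "\<exists>r\<in>\<rat>. r < t \<and> A \<inter> {r..<t} = {}" if "t \<in> Is" for t
  proof -
    obtain \<rho> where \<rho>: "\<rho> > 0" "A \<inter> {t - \<rho><..<t} = {}" using \<open>t \<in> Is\<close> unfolding Is_def by auto
    obtain r where "r \<in> \<rat>" "t - \<rho> < r" "r < t" using Rats_dense_in_real[of "t - \<rho>" t] \<rho> by auto
    then show ?thesis using \<rho>(2) by (intro bexI[of _ r]) auto
  qed
  then obtain r where r: "\<And>t. t \<in> Is \<Longrightarrow> r t \<in> \<rat> \<and> r t < t \<and> A \<inter> {r t..<t} = {}" by metis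
  have neq: "r t \<noteq> r t'" if "t \<in> Is" "t' \<in> Is" "t < t'" for t t'
  proof
    assume "r t = r t'"
    then have "t \<in> A \<inter> {r t'..<t'}" using r[OF that(1)] that unfolding Is_def by auto
    then show False using r[OF that(2)] by blast
  qed
  have "inj_on r Is"
  proof (rule inj_onI, rule ccontr)
    fix t t' assume "t \<in> Is" "t' \<in> Is" "r t = r t'" "t \<noteq> t'"
    then show False using neq[of t t'] neq[of t' t] by (cases "t < t'") auto
  qed
  moreover have "countable (r ` Is)" using r by (intro countable_subset[OF _ countable_rat]) auto
  ultimately show ?thesis unfolding Is_def[symmetric] by (rule countable_image_inj_on[rotated])
qed

text \<open>Split \<open>E\<close> into countably many pieces on each of which \<open>g\<close> is bounded and, as the points of the piece are
close to each other, strictly increasing. On such a piece, disjoint intervals with endpoints in the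
piece have disjoint images under \<open>g\<close>, so if \<open>g\<close> grows at rate \<open>K\<close> on them, their total length is at most
the oscillation of \<open>g\<close> divided by \<open>K\<close>. The points of the piece that are not limits from the left of
other points of the piece start no such interval, but there are only countably many of them.\<close>

lemma infinite_left_derivative_negligible:
  fixes g :: "real \<Rightarrow> real"
  assumes E: "\<And>t K. t \<in> E \<Longrightarrow> 0 < K \<Longrightarrow>
    \<exists>\<rho>>0. \<forall>s\<in>E. t - \<rho> < s \<longrightarrow> s < t \<longrightarrow> g s + K * (t - s) \<le> g t"
  shows "negligible E"
proof -
  define F where "F = (\<lambda>(n, i). {t \<in> E. \<bar>g t\<bar> \<le> real (Suc n) \<and> \<lfloor>t * real (Suc n)\<rfloor> = i \<and>
     (\<forall>s\<in>E. t - 1 / real (Suc n) < s \<longrightarrow> s < t \<longrightarrow> g s + (t - s) \<le> g t)})"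
  have "negligible (F (n, i))" for n :: nat and i :: int
  proof -
    define A where "A = F (n, i)"
    define k where "k = real (Suc n)"
    have k: "k > 0" unfolding k_def by simp
    define a b where "a = real_of_int i / k" and "b = (real_of_int i + 1) / k"
    have bound: "\<bar>g t\<bar> \<le> k \<and> a \<le> t \<and> t < b" if "t \<in> A" for t
    proof -
      have "\<bar>g t\<bar> \<le> k" "\<lfloor>t * k\<rfloor> = i" using that unfolding A_def F_def k_def by auto
      then have "real_of_int i \<le> t * k" "t * k < real_of_int i + 1" by linarith+
      then show ?thesis using k \<open>\<bar>g t\<bar> \<le> k\<close> unfolding a_def b_def by (auto simp: field_simps)
    qed
    have mono: "g s < g t" if "s \<in> A" "t \<in> A" "s < t" for s t
    proof -
      have "t - s < b - a" using bound[OF that(1)] bound[OF that(2)] by linarith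
      also have "b - a = 1 / k" unfolding a_def b_def by (simp add: add_divide_distrib)
      finally have "t - 1 / real (Suc n) < s" unfolding k_def by simp
      moreover have "s \<in> E" using that(1) unfolding A_def F_def by auto
      ultimately have "g s + (t - s) \<le> g t"
        using that(2,3) unfolding A_def F_def by auto
      then show ?thesis using that by linarith
    qed
    define L where "L = {t \<in> A. \<exists>\<rho>>0. A \<inter> {t - \<rho><..<t} = {}}"
    have "negligible L" unfolding L_def negligible_iff_null_sets
      by (intro null_sets_completionI countable_imp_null_set_lborel countable_left_isolated)
    moreover have "negligible (A - L)"
      unfolding negligible_outer_le
    proof (intro allI impI)
      fix e :: real assume "e > 0"
      define K where "K = 10 * k / e"
      have K: "K > 0" "5 * (2 * k / K) = e" using \<open>e > 0\<close> k by (auto simp: K_def)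
      have "\<exists>T. A - L \<subseteq> T \<and> T \<in> lmeasurable \<and> measure lebesgue T \<le> 5 * (2 * k / K)"
      proof (rule vitali_interval_cover[where a = a and b = b and
            V = "{(s, t). s \<in> A \<and> t \<in> A \<and> s < t \<and> K * (t - s) \<le> g t - g s}"])
        fix s t assume "(s, t) \<in> {(s, t). s \<in> A \<and> t \<in> A \<and> s < t \<and> K * (t - s) \<le> g t - g s}"
        then show "a \<le> s \<and> s < t \<and> t \<le> b" using bound[of s] bound[of t] by auto
      next
        fix t assume t: "t \<in> A - L"
        then have "t \<in> E" unfolding A_def F_def by auto
        then obtain \<rho> where \<rho>: "\<rho> > 0" "\<And>s. s \<in> E \<Longrightarrow> t - \<rho> < s \<Longrightarrow> s < t \<Longrightarrow> g s + K * (t - s) \<le> g t"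
          using E[of t K] K(1) by blast
        obtain s where s: "s \<in> A" "t - \<rho> < s" "s < t"
          using t \<rho>(1) unfolding L_def by fastforce
        moreover have "s \<in> E" using s unfolding A_def F_def by auto
        ultimately have "K * (t - s) \<le> g t - g s" using \<rho>(2)[of s] by linarith
        then show "\<exists>s u. (s, u) \<in> {(s, t). s \<in> A \<and> t \<in> A \<and> s < t \<and> K * (t - s) \<le> g t - g s} \<and> s \<le> t \<and> t \<le> u"
          using s t by (intro exI[of _ s] exI[of _ t]) auto
      next
        fix I assume I: "I \<subseteq> {(s, t). s \<in> A \<and> t \<in> A \<and> s < t \<and> K * (t - s) \<le> g t - g s}"
          and pk: "packing a b I"
        have st: "s \<in> A \<and> t \<in> A \<and> s < t" if "(s, t) \<in> I" for s t using I that by auto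
        have le: "g t \<le> g s'" if "t \<in> A" "s' \<in> A" "t \<le> s'" for t s'
          using mono[of t s'] that by (cases "t = s'") auto
        define p q where "p = (\<lambda>i :: real \<times> real. g (fst i))" and "q = (\<lambda>i :: real \<times> real. g (snd i))"
        have fin: "finite I" using pk unfolding packing_def by auto
        have pq: "- k \<le> p i \<and> p i < q i \<and> q i \<le> k" if "i \<in> I" for i
          using st[of "fst i" "snd i"] bound[of "fst i"] bound[of "snd i"] mono[of "fst i" "snd i"] that
          unfolding p_def q_def by auto
        have sep: "q i \<le> p j \<or> q j \<le> p i" if ij: "i \<in> I" "j \<in> I" "i \<noteq> j" for i j
        proof -
          have "snd i \<le> fst j \<or> snd j \<le> fst i"
            using packing_disjointD[OF pk, of "fst i" "snd i" "fst j" "snd j"] ij by (simp add: prod_eq_iff)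
          then show ?thesis
            using le st[of "fst i" "snd i"] st[of "fst j" "snd j"] ij unfolding p_def q_def by auto
        qed
        note image = packing_image[of I "- k" p q k, OF fin pq sep, simplified]
        have "(\<Sum>(x, y)\<in>(\<lambda>i. (p i, q i)) ` I. y - x) \<le> k - - k" using k by (intro packing_length image(1)) auto
        then have "(\<Sum>(s, t)\<in>I. g t - g s) \<le> 2 * k"
          by (subst (asm) image(2)) (simp add: p_def q_def case_prod_unfold)
        moreover have "(\<Sum>(s, t)\<in>I. K * (t - s)) \<le> (\<Sum>(s, t)\<in>I. g t - g s)"
          using I by (intro sum_mono) auto
        moreover have "(\<Sum>(s, t)\<in>I. K * (t - s)) = K * (\<Sum>(s, t)\<in>I. t - s)"
          by (simp add: sum_distrib_left case_prod_beta)
        ultimately show "(\<Sum>(s, t)\<in>I. t - s) \<le> 2 * k / K" using K(1) by (simp add: field_simps)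
      qed
      then show "\<exists>T. A - L \<subseteq> T \<and> T \<in> lmeasurable \<and> measure lebesgue T \<le> e" using K(2) by simp
    qed
    ultimately have "negligible (L \<union> (A - L))" by (rule negligible_Un)
    then show ?thesis by (rule negligible_subset) (auto simp: A_def)
  qed
  then have "negligible (\<Union>p. F p)"
    by (intro negligible_countable_Union) auto
  then show ?thesis
  proof (rule negligible_subset, intro subsetI)
    fix t assume t: "t \<in> E"
    then obtain \<rho> where \<rho>: "\<rho> > 0" "\<And>s. s \<in> E \<Longrightarrow> t - \<rho> < s \<Longrightarrow> s < t \<Longrightarrow> g s + 1 * (t - s) \<le> g t"
      using E[of t 1] by (metis zero_less_one)
    obtain n where n: "max \<bar>g t\<bar> (1 / \<rho>) < real n" using reals_Archimedean2 by blast
    then have "1 / \<rho> < real (Suc n)" by simp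
    then have "1 / real (Suc n) < \<rho>" using \<rho>(1) by (simp add: field_simps)
    then have "t \<in> F (n, \<lfloor>t * real (Suc n)\<rfloor>)" using t \<rho>(2) n unfolding F_def by auto
    then show "t \<in> (\<Union>p. F p)" by blast
  qed
qed

section \<open>Curve costs and the descent of the approach value\<close>

text \<open>The features of the action that the argument depends on. Its values are nonnegative, which for a
Lagrangian means that a constant has been added. The last two axioms say that climbing is
superlinearly expensive and that slow curves in a bounded region have bounded cost per unit of time.\<close>

locale curve_cost =
  fixes J :: "(real \<Rightarrow> real) \<Rightarrow> real \<Rightarrow> real \<Rightarrow> ennreal"
  assumes cost_cong: "(\<And>x. x \<in> {s..t} \<Longrightarrow> u x = v x) \<Longrightarrow> J u s t = J v s t"
    and cost_add: "r \<le> s \<Longrightarrow> s \<le> t \<Longrightarrow> AC_on r t u \<Longrightarrow> J u r t = J u r s + J u s t"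
    and cost_climb: "0 \<le> K \<Longrightarrow> \<exists>C\<ge>0. \<forall>u s t. s \<le> t \<longrightarrow> AC_on s t u \<longrightarrow>
      ennreal (K * \<bar>u t - u s\<bar>) \<le> J u s t + ennreal (C * (t - s))"
    and cost_slow: "\<exists>C\<ge>0. \<forall>v s t. s \<le> t \<longrightarrow> - R \<le> s \<longrightarrow> t \<le> R \<longrightarrow> (\<forall>x\<in>{s..t}. \<bar>v x\<bar> \<le> R) \<longrightarrow>
      (\<forall>x\<in>{s..t}. \<forall>y\<in>{s..t}. \<bar>v x - v y\<bar> \<le> M * \<bar>x - y\<bar>) \<longrightarrow> J v s t \<le> ennreal (C * (t - s))"

text \<open>A curve of finite cost and of excess at most \<open>\<epsilon>\<close>, expressed without subtraction.\<close>

definition near_minimizer ::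
  "((real \<Rightarrow> real) \<Rightarrow> real \<Rightarrow> real \<Rightarrow> ennreal) \<Rightarrow> real \<Rightarrow> (real \<Rightarrow> real) \<Rightarrow> real \<Rightarrow> real \<Rightarrow> bool" where
  "near_minimizer J \<epsilon> u a b \<longleftrightarrow> AC_on a b u \<and> J u a b < \<infinity> \<and>
     (\<forall>v. AC_on a b v \<longrightarrow> v a = u a \<longrightarrow> v b = u b \<longrightarrow> J u a b \<le> J v a b + ennreal \<epsilon>)"

text \<open>What is needed of generalized minimizers: the approximating almost minimizers can be cut down to any
fixed compact subinterval of the open interval, and then the sequence and the varying domains
disappear.\<close>

definition approx_minimizer ::
  "((real \<Rightarrow> real) \<Rightarrow> real \<Rightarrow> real \<Rightarrow> ennreal) \<Rightarrow> real \<Rightarrow> real \<Rightarrow> (real \<Rightarrow> real) \<Rightarrow> bool" where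
  "approx_minimizer J a b u \<longleftrightarrow> continuous_on {a..b} u \<and>
     (\<forall>s t \<epsilon>. a < s \<longrightarrow> s < t \<longrightarrow> t < b \<longrightarrow> 0 < \<epsilon> \<longrightarrow>
       (\<exists>w. near_minimizer J \<epsilon> w s t \<and> (\<forall>x\<in>{s..t}. \<bar>w x - u x\<bar> < \<epsilon>)))"

definition steep_through ::
  "((real \<Rightarrow> real) \<Rightarrow> real \<Rightarrow> real \<Rightarrow> ennreal) \<Rightarrow> real \<Rightarrow> real \<Rightarrow> (real \<Rightarrow> real) \<Rightarrow> bool" where
  "steep_through J x0 b u \<longleftrightarrow> x0 < b \<and> approx_minimizer J x0 b u \<and>
     filterlim (\<lambda>x. (u x - u x0) / (x - x0)) at_top (at x0 within {x0..b})"

text \<open>The singular points with right derivative \<open>+\<infinity>\<close>. The other kinds of singular points are mirror images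
of these.\<close>

definition steep_points ::
  "((real \<Rightarrow> real) \<Rightarrow> real \<Rightarrow> real \<Rightarrow> ennreal) \<Rightarrow> (real \<times> real) set" where
  "steep_points J = {(x0, y0). \<exists>b u. steep_through J x0 b u \<and> u x0 = y0}"

text \<open>The least cost of reaching \<open>(q, B)\<close> from \<open>(x, y)\<close> along curves that stay at height \<open>y\<close> for some time. This
initial rest makes the curves accessible from points close to \<open>(x, y)\<close>: a curve that starts in \<open>(x, y)\<close>
with infinite slope could not be joined cheaply.\<close>

definition approach_value ::
  "((real \<Rightarrow> real) \<Rightarrow> real \<Rightarrow> real \<Rightarrow> ennreal) \<Rightarrow> real \<Rightarrow> real \<Rightarrow> real \<Rightarrow> real \<Rightarrow> ennreal" where
  "approach_value J q B x y =
     (INF w \<in> {w. AC_on x q w \<and> w q = B \<and> (\<exists>m. x < m \<and> m < q \<and> (\<forall>z\<in>{x..m}. w z = y))}. J w x q)"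

context curve_cost begin

lemma cost_concat:
  assumes "AC_on r s u" "AC_on s t v" "u s = v s" "r \<le> s" "s \<le> t"
  shows "J (\<lambda>x. if x \<le> s then u x else v x) r t = J u r s + J v s t"
proof -
  let ?c = "\<lambda>x. if x \<le> s then u x else v x"
  have "J ?c r t = J ?c r s + J ?c s t"
    by (rule cost_add[OF assms(4,5) AC_on_concat[OF assms]])
  also have "J ?c r s = J u r s" by (rule cost_cong) auto
  also have "J ?c s t = J v s t" by (rule cost_cong) (use assms(3) in auto)
  finally show ?thesis .
qed

text \<open>A better curve on a subinterval can be completed by \<open>u\<close> to a better curve on the whole interval.\<close>

lemma near_minimizer_restrict:
  assumes u: "near_minimizer J \<epsilon> u a b" and "a \<le> s" "s \<le> t" "t \<le> b"
  shows "near_minimizer J \<epsilon> u s t"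
proof -
  have ac: "AC_on a b u" and fin: "J u a b < \<infinity>" using u unfolding near_minimizer_def by auto
  have acs: "AC_on a s u" "AC_on s t u" "AC_on t b u" "AC_on s b u"
    using ac assms(2-4) by (auto intro: AC_on_subset)
  have split: "J u a b = J u a s + (J u s t + J u t b)"
    using cost_add[of a s b u] cost_add[of s t b u] ac acs assms(2-4) by simp
  have "J u s t \<le> J v s t + ennreal \<epsilon>" if v: "AC_on s t v" "v s = u s" "v t = u t" for v
  proof -
    let ?c = "\<lambda>x. if x \<le> s then u x else v x"
    let ?w = "\<lambda>x. if x \<le> t then ?c x else u x"
    have c: "AC_on a t ?c" by (rule AC_on_concat) (use acs v assms in auto)
    have ct: "?c t = u t" using v by auto
    have "AC_on a b ?w" by (rule AC_on_concat) (use c acs ct assms in auto)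
    moreover have "?w a = u a" "?w b = u b" using assms v by auto
    ultimately have "J u a b \<le> J ?w a b + ennreal \<epsilon>" using u unfolding near_minimizer_def by blast
    also have "J ?w a b = J ?c a t + J u t b"
      by (rule cost_concat) (use c acs ct assms in auto)
    also have "J ?c a t = J u a s + J v s t"
      by (rule cost_concat) (use acs v assms in auto)
    finally have "(J u a s + J u t b) + J u s t \<le> (J u a s + J u t b) + (J v s t + ennreal \<epsilon>)"
      unfolding split by (simp add: ac_simps)
    moreover have "J u a s + J u t b \<noteq> \<infinity>" using fin unfolding split by (auto simp: less_top)
    ultimately show ?thesis by (simp add: ennreal_add_left_cancel_le)
  qed
  moreover have "J u s t < \<infinity>" using fin unfolding split by (auto simp: less_top)
  ultimately show ?thesis using acs(2) unfolding near_minimizer_def by blast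
qed

lemma approach_value_finite:
  assumes "x < q"
  shows "approach_value J q B x y < \<infinity>"
proof -
  define m where "m = (x + q) / 2"
  have m: "x < m" "m < q" using assms by (auto simp: m_def)
  define M where "M = \<bar>B - y\<bar> / (q - m)"
  define w where "w = (\<lambda>z. y + (B - y) / (q - m) * max 0 (z - m))"
  have lip: "\<bar>w z - w z'\<bar> \<le> M * \<bar>z - z'\<bar>" for z z'
  proof -
    have "w z - w z' = (B - y) / (q - m) * (max 0 (z - m) - max 0 (z' - m))"
      unfolding w_def by (simp only: right_diff_distrib)
    then have "\<bar>w z - w z'\<bar> = M * \<bar>max 0 (z - m) - max 0 (z' - m)\<bar>"
      unfolding M_def using m by (simp add: abs_mult)
    also have "\<dots> \<le> M * \<bar>z - z'\<bar>" unfolding M_def using m by (intro mult_left_mono) auto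
    finally show ?thesis .
  qed
  have ac: "AC_on x q w" by (rule AC_on_lipschitz) (rule lip)
  then have "compact (w ` {x..q})" by (intro compact_continuous_image AC_on_imp_continuous_on) auto
  then have "bounded (w ` {x..q})" by (rule compact_imp_bounded)
  then obtain R0 where R0: "\<And>z. z \<in> {x..q} \<Longrightarrow> \<bar>w z\<bar> \<le> R0"
    unfolding bounded_iff real_norm_def by blast
  define R where "R = max R0 (max \<bar>x\<bar> \<bar>q\<bar>)"
  obtain C where "C \<ge> 0" and slow: "\<And>v s t. s \<le> t \<Longrightarrow> - R \<le> s \<Longrightarrow> t \<le> R \<Longrightarrow> (\<forall>x\<in>{s..t}. \<bar>v x\<bar> \<le> R) \<Longrightarrow>
      (\<forall>x\<in>{s..t}. \<forall>y\<in>{s..t}. \<bar>v x - v y\<bar> \<le> M * \<bar>x - y\<bar>) \<Longrightarrow> J v s t \<le> ennreal (C * (t - s))"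
    using cost_slow[of R M] by blast
  have "J w x q \<le> ennreal (C * (q - x))"
  proof (rule slow)
    show "\<forall>z\<in>{x..q}. \<bar>w z\<bar> \<le> R" using R0 unfolding R_def by (simp add: le_max_iff_disj)
    show "- R \<le> x" "q \<le> R" unfolding R_def by linarith+
  qed (use assms lip in auto)
  also have "\<dots> < \<infinity>" by simp
  finally have "J w x q < \<infinity>" .
  moreover have "w q = B" unfolding w_def using m by simp
  moreover have "\<forall>z\<in>{x..m}. w z = y" unfolding w_def by auto
  ultimately show ?thesis
    unfolding approach_value_def INF_less_iff using ac m by blast
qed

end

lemma ennreal_le_plusD: "ennreal a \<le> ennreal x + ennreal y \<Longrightarrow> 0 \<le> x \<Longrightarrow> 0 \<le> y \<Longrightarrow> a \<le> x + y"
  by (metis add_nonneg_nonneg ennreal_le_iff ennreal_plus)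

context curve_cost begin

text \<open>Let \<open>y0 = u x0\<close>. The number \<open>d\<close> is the height above \<open>y0\<close> at which a curve from \<open>(x', y')\<close> passes over \<open>x0\<close>
if it rests during the first half of the time and has slope \<open>M\<close> during the second half. The case
\<open>x' = x0\<close> is included. This curve \<open>\<l>\<close>, continued horizontally, meets the almost minimizer \<open>v\<close> near \<open>u\<close> at a
time \<open>c\<close> very soon after \<open>x0\<close>. Any admissible curve \<open>w\<close> from \<open>(x0, y0)\<close> to \<open>(q, B)\<close> crosses the combination
of \<open>\<l>\<close> and \<open>v\<close> at some time \<open>e\<close>. If \<open>e \<le> c\<close>, then \<open>w\<close> itself has climbed the height \<open>d\<close> in a very short time,
and following \<open>\<l>\<close> to \<open>e\<close> and \<open>w\<close> from there is cheaper than \<open>w\<close>. If \<open>e > c\<close>, then following \<open>\<l>\<close>, then \<open>v\<close>, then \<open>w\<close>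
is cheaper than \<open>w\<close>, because the part of \<open>v\<close> up to \<open>e\<close> costs hardly more than the part of \<open>w\<close> up to \<open>e\<close> and
contains an expensive ascent before \<open>c\<close>.\<close>

lemma approach_value_descent:
  assumes u: "steep_through J x0 b u" and q: "x0 < q" "q < b" and uq: "u q < B"
    and K: "0 \<le> K" and M: "0 \<le> M"
  shows "\<exists>\<rho>>0. \<forall>x' y' d. x0 - \<rho> < x' \<longrightarrow> x' \<le> x0 \<longrightarrow> \<bar>y' - u x0\<bar> < \<rho> \<longrightarrow>
    d = y' + M * (x0 - x') / 2 - u x0 \<longrightarrow> 0 < d \<longrightarrow> x0 - x' \<le> d \<longrightarrow>
    approach_value J q B x' y' + ennreal (K * d) \<le> approach_value J q B x0 (u x0)"
proof -
  define y0 where "y0 = u x0"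
  define R where "R = \<bar>x0\<bar> + \<bar>q\<bar> + \<bar>y0\<bar> + M + 3"
  obtain C1 where C1: "C1 \<ge> 0" and slow: "\<And>v s t. s \<le> t \<Longrightarrow> - R \<le> s \<Longrightarrow> t \<le> R \<Longrightarrow>
      (\<forall>x\<in>{s..t}. \<bar>v x\<bar> \<le> R) \<Longrightarrow>
      (\<forall>x\<in>{s..t}. \<forall>y\<in>{s..t}. \<bar>v x - v y\<bar> \<le> (M + 1) * \<bar>x - y\<bar>) \<Longrightarrow>
      J v s t \<le> ennreal (C1 * (t - s))"
    using cost_slow[of R "M + 1"] by blast
  (* Following the curve \<l> costs at most 2 * C1 * d. The remaining 2 * d pay for the errors: d
     for the elapsed time in the climbing estimate, d for \<eta> and \<epsilon>. *)
  define K2 where "K2 = K + 2 * C1 + 2"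
  have K2: "0 \<le> K2" using K C1 by (simp add: K2_def)
  obtain C2 where C2: "C2 \<ge> 0" and climb: "\<And>v s t. s \<le> t \<Longrightarrow> AC_on s t v \<Longrightarrow>
      ennreal (K2 * \<bar>v t - v s\<bar>) \<le> J v s t + ennreal (C2 * (t - s))"
    using cost_climb[OF K2] by blast
  (* If u climbs at a rate above \<kappa>, then the climb of height d takes time at most d / \<kappa>, so that
     the error term of the climbing estimate is at most d. *)
  define \<kappa> where "\<kappa> = C2 + 1"
  have \<kappa>: "1 \<le> \<kappa>" using C2 by (simp add: \<kappa>_def)
  have am: "approx_minimizer J x0 b u" and "x0 < b"
    and lim: "filterlim (\<lambda>x. (u x - u x0) / (x - x0)) at_top (at x0 within {x0..b})"
    using u unfolding steep_through_def by auto
  have ucont: "continuous_on {x0..b} u" using am unfolding approx_minimizer_def by auto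
  obtain \<rho>1 where \<rho>1: "\<rho>1 > 0" "\<And>x. x0 < x \<Longrightarrow> x \<le> b \<Longrightarrow> x < x0 + \<rho>1 \<Longrightarrow> (\<kappa> + 1) * (x - x0) \<le> u x - y0"
  proof -
    have "eventually (\<lambda>x. \<kappa> + 1 \<le> (u x - u x0) / (x - x0)) (at x0 within {x0..b})"
      using lim unfolding filterlim_at_top by blast
    then obtain d where d: "d > 0" "\<And>x. x \<in> {x0..b} \<Longrightarrow> x \<noteq> x0 \<Longrightarrow> dist x x0 < d \<Longrightarrow>
        \<kappa> + 1 \<le> (u x - u x0) / (x - x0)"
      unfolding eventually_at by blast
    show thesis
    proof (rule that[OF d(1)])
      fix x assume "x0 < x" "x \<le> b" "x < x0 + d"
      then show "(\<kappa> + 1) * (x - x0) \<le> u x - y0"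
        using d(2)[of x] by (simp add: dist_real_def y0_def pos_le_divide_eq)
    qed
  qed
  define \<rho> where "\<rho> = min 1 (min \<rho>1 (q - x0)) / (1 + M)"
  have \<rho>: "\<rho> > 0" "\<rho> \<le> 1" "\<rho> * (1 + M) \<le> 1" "\<rho> * (1 + M) \<le> \<rho>1" "\<rho> * (1 + M) \<le> q - x0"
  proof -
    show "\<rho> > 0" using \<rho>1(1) q M unfolding \<rho>_def by (intro divide_pos_pos) auto
    have eq: "\<rho> * (1 + M) = min 1 (min \<rho>1 (q - x0))" using M unfolding \<rho>_def by simp
    then show "\<rho> * (1 + M) \<le> 1" "\<rho> * (1 + M) \<le> \<rho>1" "\<rho> * (1 + M) \<le> q - x0" by auto
    have "\<rho> * 1 \<le> \<rho> * (1 + M)" using \<open>\<rho> > 0\<close> M by (intro mult_left_mono) auto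
    then show "\<rho> \<le> 1" using \<open>\<rho> * (1 + M) \<le> 1\<close> by simp
  qed
  have "approach_value J q B x' y' + ennreal (K * d) \<le> approach_value J q B x0 y0"
    if x': "x0 - \<rho> < x'" "x' \<le> x0" and y': "\<bar>y' - y0\<bar> < \<rho>"
      and d_def: "d = y' + M * (x0 - x') / 2 - y0" and d: "0 < d" "x0 - x' \<le> d" for x' y' d
  proof -
    have "M * (x0 - x') \<le> M * \<rho>" using M x' by (intro mult_left_mono) auto
    moreover have "0 \<le> M * (x0 - x')" using M x' by simp
    moreover have "M * \<rho> \<le> M" using \<rho>(2) M mult_left_mono[of \<rho> 1 M] by simp
    ultimately have Mx: "M * (x0 - x') / 2 \<le> M" and "d < \<rho> + M * \<rho>"
      using y' unfolding d_def by linarith+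
    then have "d < \<rho> * (1 + M)" by (simp add: algebra_simps)
    then have d_small: "d < 1" "d < \<rho>1" "d < q - x0" using \<rho> by linarith+
    define x1 where "x1 = x0 + d / \<kappa>"
    have d\<kappa>: "0 < d / \<kappa>" "d / \<kappa> \<le> d" "C2 * (d / \<kappa>) \<le> d"
      using d(1) \<kappa> C2 by (auto simp: field_simps \<kappa>_def)
    have x1: "x0 < x1" "x1 < q" "x1 < x0 + \<rho>1" using d\<kappa> d_small unfolding x1_def by linarith+
    define m where "m = (x' + x0) / 2"
    have m: "x' \<le> m" "m \<le> x0" using x' unfolding m_def by auto
    define \<l> where "\<l> = (\<lambda>x. y' + M * max 0 (min x x0 - m))"
    have \<l>_top: "\<l> x = y0 + d" if "x0 \<le> x" for x
      using that m unfolding \<l>_def d_def m_def by (auto simp: field_simps)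
    have \<l>_flat: "\<l> x = y'" if "x \<le> m" for x using that unfolding \<l>_def by auto
    have \<l>_lip: "\<bar>\<l> x - \<l> y\<bar> \<le> (M + 1) * \<bar>x - y\<bar>" for x y
    proof -
      have "\<bar>\<l> x - \<l> y\<bar> = M * \<bar>max 0 (min x x0 - m) - max 0 (min y x0 - m)\<bar>"
        unfolding \<l>_def using M by (simp add: abs_mult flip: right_diff_distrib)
      also have "\<dots> \<le> (M + 1) * \<bar>x - y\<bar>" using M by (intro mult_mono) auto
      finally show ?thesis .
    qed
    have \<l>_bd: "\<bar>\<l> x\<bar> \<le> R" for x
    proof -
      have "0 \<le> max 0 (min x x0 - m)" "max 0 (min x x0 - m) \<le> (x0 - x') / 2"
      proof -
        have "min x x0 - m \<le> x0 - m" by simp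
        also have "x0 - m = (x0 - x') / 2" unfolding m_def by (simp add: field_simps)
        finally have "min x x0 - m \<le> (x0 - x') / 2" .
        moreover have "0 \<le> (x0 - x') / 2" using x'(2) by simp
        ultimately show "max 0 (min x x0 - m) \<le> (x0 - x') / 2" by (intro max.boundedI)
      qed simp
      then have "0 \<le> M * max 0 (min x x0 - m)"
        "M * max 0 (min x x0 - m) \<le> M * ((x0 - x') / 2)"
        using mult_nonneg_nonneg[OF M] mult_left_mono[OF _ M] by blast+
      moreover have "M * ((x0 - x') / 2) \<le> M" using Mx by simp
      ultimately have "0 \<le> M * max 0 (min x x0 - m)" "M * max 0 (min x x0 - m) \<le> M"
        by linarith+
      then show ?thesis using y' \<rho>(2) unfolding \<l>_def R_def by linarith
    qed
    have \<l>_ac: "AC_on s t \<l>" for s t by (rule AC_on_lipschitz) (rule \<l>_lip)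
    have Rx: "- R \<le> x0 - 1" "q \<le> R" unfolding R_def using M by linarith+
    have \<l>_cost: "J \<l> x' e \<le> ennreal (2 * C1 * d)" if e: "x0 \<le> e" "e \<le> x1" for e
    proof -
      have "J \<l> x' e \<le> ennreal (C1 * (e - x'))"
        by (rule slow) (use e x' x1 \<rho>(2) \<l>_bd \<l>_lip Rx in auto)
      also have "\<dots> \<le> ennreal (2 * C1 * d)"
      proof (rule ennreal_leI)
        have "e - x' \<le> 2 * d" using e d\<kappa> d unfolding x1_def by linarith
        then show "C1 * (e - x') \<le> 2 * C1 * d" using C1 mult_left_mono[of "e - x'" "2 * d" C1] by simp
      qed
      finally show ?thesis .
    qed
    have value_le: "approach_value J q B x' y' \<le> J P x' q"
      if P: "AC_on x' q P" "P q = B" and e: "x0 < e" "e < q" "\<And>x. x \<in> {x'..e} \<Longrightarrow> P x = \<l> x" for P e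
    proof -
      (* For x' = x0 the line \<l> is constant, so the rest may be taken to last until e. *)
      define m' where "m' = (if x' < x0 then m else e)"
      have "x' < m'" "m' < q" "m' \<le> e" using e q unfolding m'_def m_def by (auto intro: order.strict_trans1 x'(2))
      moreover have "P z = y'" if "z \<in> {x'..m'}" for z
      proof -
        have "P z = \<l> z" using e(3) that \<open>m' \<le> e\<close> by auto
        also have "\<l> z = y'"
        proof (cases "x' < x0")
          case True
          then show ?thesis using that unfolding m'_def by (intro \<l>_flat) auto
        next
          case False
          then have "m = x0" using x' unfolding m_def by auto
          then show ?thesis unfolding \<l>_def by auto
        qed
        finally show ?thesis .
      qed
      ultimately show ?thesis unfolding approach_value_def using P by (intro INF_lower) auto
    qed
    show ?thesis
      unfolding approach_value_def[of J q B x0]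
    proof (rule INF_greatest)
      fix w assume "w \<in> {w. AC_on x0 q w \<and> w q = B \<and> (\<exists>m. x0 < m \<and> m < q \<and> (\<forall>z\<in>{x0..m}. w z = y0))}"
      then obtain mw where w: "AC_on x0 q w" "w q = B" "x0 < mw" "mw < q" "\<And>z. z \<in> {x0..mw} \<Longrightarrow> w z = y0"
        by auto
      show "approach_value J q B x' y' + ennreal (K * d) \<le> J w x0 q"
      proof (cases "J w x0 q = \<infinity>")
        case False
        have w_ac: "AC_on s t w" if "x0 \<le> s" "t \<le> q" for s t using AC_on_subset[OF w(1) that] .
        obtain r where r: "r > 0" "\<And>x. x \<in> {x0..b} \<Longrightarrow> x < x0 + r \<Longrightarrow> \<bar>u x - y0\<bar> < d / 2"
        proof -
          obtain r where "r > 0" "\<And>x. x \<in> {x0..b} \<Longrightarrow> dist x x0 < r \<Longrightarrow> dist (u x) (u x0) < d / 2"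
            using ucont \<open>x0 < b\<close> d(1) unfolding continuous_on_iff
            by (metis atLeastAtMost_iff half_gt_zero less_imp_le order_refl)
          then show thesis by (intro that[of r]) (auto simp: dist_real_def y0_def)
        qed
        (* Up to x0 + r0 the curve w is still at rest and u is still well below the height y0 +
           d. *)
        define r0 where "r0 = min r (min (mw - x0) (d / \<kappa>))"
        have r0: "r0 > 0" "r0 \<le> r" "x0 + r0 \<le> mw" "r0 \<le> d / \<kappa>"
          using r(1) w(3) d\<kappa> unfolding r0_def by auto
        define \<eta> where "\<eta> = min (r0 / 2) (d / (2 * (K2 + C1 + 1)))"
        have \<eta>: "\<eta> > 0" "\<eta> \<le> r0 / 2" "(K2 + C1) * \<eta> \<le> d / 2" "\<eta> \<le> d / 2"
        proof -
          have pos: "K2 + C1 + 1 > 0" using K2 C1 by linarith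
          show "\<eta> > 0" unfolding \<eta>_def using r0 d pos by simp
          show "\<eta> \<le> r0 / 2" unfolding \<eta>_def by (rule min.cobounded1)
          have "\<eta> \<le> d / (2 * (K2 + C1 + 1))" unfolding \<eta>_def by (rule min.cobounded2)
          then have "(K2 + C1 + 1) * \<eta> \<le> d / 2" using pos by (simp add: field_simps)
          then have "(K2 + C1) * \<eta> + \<eta> \<le> d / 2" by (simp add: algebra_simps)
          moreover have "(K2 + C1) * \<eta> \<ge> 0" using K2 C1 \<open>\<eta> > 0\<close> by simp
          ultimately show "(K2 + C1) * \<eta> \<le> d / 2" "\<eta> \<le> d / 2" using \<open>\<eta> > 0\<close> by linarith+
        qed
        obtain s where s: "x0 < s" "s < x0 + \<eta> / 2" "\<bar>u s - y0\<bar> < \<eta> / 2"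
        proof -
          obtain r2 where r2: "r2 > 0" "\<And>x. x \<in> {x0..b} \<Longrightarrow> dist x x0 < r2 \<Longrightarrow> dist (u x) (u x0) < \<eta> / 2"
            using ucont \<open>x0 < b\<close> \<eta>(1) unfolding continuous_on_iff
            by (metis atLeastAtMost_iff half_gt_zero less_imp_le order_refl)
          define \<mu> where "\<mu> = min r2 (min (\<eta> / 2) (b - x0))"
          define s where "s = x0 + \<mu> / 2"
          have "0 < \<mu>" "\<mu> \<le> r2" "\<mu> \<le> \<eta> / 2" "\<mu> \<le> b - x0"
            using r2(1) \<eta>(1) \<open>x0 < b\<close> unfolding \<mu>_def by linarith+
          then have "x0 < s" "s < x0 + r2" "s < x0 + \<eta> / 2" "s < b" unfolding s_def by linarith+
          then show thesis using r2(2)[of s] by (intro that[of s]) (auto simp: dist_real_def y0_def)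
        qed
        have s_lt: "s < x0 + r0" "s < x1" "s < q" "s < b"
          using s \<eta> r0 d\<kappa> x1 q unfolding x1_def by linarith+
        have us: "y0 < u s"
        proof -
          have "(\<kappa> + 1) * (s - x0) \<le> u s - y0" using s s_lt x1 by (intro \<rho>1(2)) auto
          moreover have "(\<kappa> + 1) * (s - x0) > 0" using s \<kappa> by simp
          ultimately show ?thesis by linarith
        qed
        (* The tolerance keeps v s above y0, v x1 above y0 + d, and v q below B. *)
        define \<epsilon> where "\<epsilon> = min (min (d / 2) (\<eta> / 2)) (min (u s - y0) (min (d / \<kappa>) (B - u q)))"
        have \<epsilon>: "\<epsilon> > 0" "\<epsilon> \<le> d / 2" "\<epsilon> \<le> \<eta> / 2" "\<epsilon> \<le> u s - y0" "\<epsilon> \<le> d / \<kappa>" "\<epsilon> \<le> B - u q"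
        proof -
          show "\<epsilon> > 0" using d(1) \<eta>(1) us d\<kappa>(1) uq unfolding \<epsilon>_def by auto
          show "\<epsilon> \<le> d / 2" "\<epsilon> \<le> \<eta> / 2" "\<epsilon> \<le> u s - y0" "\<epsilon> \<le> d / \<kappa>" "\<epsilon> \<le> B - u q"
            unfolding \<epsilon>_def by (meson min.cobounded1 min.cobounded2 order_trans)+
        qed
        obtain v where v: "near_minimizer J \<epsilon> v s q" "\<And>x. x \<in> {s..q} \<Longrightarrow> \<bar>v x - u x\<bar> < \<epsilon>"
          using am s(1) s_lt(3) q(2) \<epsilon>(1) unfolding approx_minimizer_def by blast
        have v_ac: "AC_on s' t' v" if "s \<le> s'" "t' \<le> q" for s' t'
          using AC_on_subset[OF _ that] v(1) unfolding near_minimizer_def by blast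
        have vs: "y0 < v s" "v s < y0 + \<eta>" using v(2)[of s] s s_lt \<epsilon> by auto
        have vx1: "y0 + d < v x1"
        proof -
          have "(\<kappa> + 1) * (x1 - x0) \<le> u x1 - y0" using x1 q by (intro \<rho>1(2)) auto
          moreover have "(\<kappa> + 1) * (x1 - x0) = d + d / \<kappa>" using \<kappa> unfolding x1_def by (simp add: field_simps)
          ultimately show ?thesis using v(2)[of x1] s_lt x1 \<epsilon> by auto
        qed
        obtain c where c: "s \<le> c" "c \<le> x1" "v c = y0 + d"
          using IVT'[of v s "y0 + d" x1] AC_on_imp_continuous_on[OF v_ac[of s x1]] vs vx1 \<eta>(4) d(1) s_lt(2) x1
          by auto
        have c_r0: "x0 + r0 \<le> c"
        proof (rule ccontr)
          assume "\<not> ?thesis"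
          then have "\<bar>u c - y0\<bar> < d / 2" using c s s_lt r0 x1 q by (intro r(2)) auto
          then show False using v(2)[of c] c x1 \<epsilon>(2) by auto
        qed
        define p where "p = (\<lambda>x. if x \<le> c then y0 + d else v x)"
        have p_ac: "AC_on x0 q p" unfolding p_def
          by (rule AC_on_concat) (use c c_r0 r0 x1 v_ac[of c q] in \<open>auto intro: AC_on_lipschitz[where M = 0]\<close>)
        have "continuous_on {x0..q} (\<lambda>x. w x - p x)"
          by (intro continuous_on_diff AC_on_imp_continuous_on w(1) p_ac)
        moreover have "w x0 - p x0 \<le> 0" using w(3) w(5)[of x0] c_r0 r0 d unfolding p_def by auto
        moreover have "0 \<le> w q - p q" using w(2) v(2)[of q] s_lt c x1 \<epsilon>(6) unfolding p_def by auto
        ultimately obtain e where e: "x0 \<le> e" "e \<le> q" "w e = p e"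
          using IVT'[of "\<lambda>x. w x - p x" x0 0 q] q by auto
        have e0: "x0 < e" using e w(5)[of x0] w(3) c_r0 r0 d unfolding p_def by (cases "e = x0") auto
        have eq: "e < q" using e w(2) v(2)[of q] s_lt c x1 \<epsilon>(6) unfolding p_def by (cases "e = q") auto
        have split_w: "J w x0 q = J w x0 e + J w e q" by (rule cost_add) (use e w in auto)
        have fin_w: "J w x0 e < \<infinity>" "J w e q < \<infinity>" using False unfolding split_w by (auto simp: less_top)
        obtain T where T: "J w e q = ennreal T" "0 \<le> T" using fin_w(2) by (cases "J w e q") auto
        show ?thesis
        proof (cases "e \<le> c")
          case True
          have we: "w e = y0 + d" using e(3) True unfolding p_def by simp
          let ?P = "\<lambda>x. if x \<le> e then \<l> x else w x"
          have P: "AC_on x' q ?P"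
            by (rule AC_on_concat) (use \<l>_ac w_ac we \<l>_top e x' in auto)
          have "approach_value J q B x' y' \<le> J ?P x' q"
            by (rule value_le[OF P _ e0 eq]) (use eq w in auto)
          also have "J ?P x' q = J \<l> x' e + J w e q"
            by (rule cost_concat) (use \<l>_ac w_ac we \<l>_top e x' in auto)
          also have "\<dots> \<le> ennreal (2 * C1 * d) + ennreal T"
            unfolding T(1) using True c e by (intro add_right_mono \<l>_cost) auto
          finally have val: "approach_value J q B x' y' \<le> ennreal (2 * C1 * d) + ennreal T" .
          obtain A where A: "J w x0 e = ennreal A" "0 \<le> A" using fin_w(1) by (cases "J w x0 e") auto
          have "ennreal (K2 * \<bar>w e - w x0\<bar>) \<le> J w x0 e + ennreal (C2 * (e - x0))"
            by (rule climb) (use e w_ac in auto)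
          moreover have "w e - w x0 = d" using we w(5)[of x0] w(3) by simp
          ultimately have "K2 * d \<le> A + C2 * (e - x0)"
            using A d(1) C2 e by (intro ennreal_le_plusD) auto
          moreover have "C2 * (e - x0) \<le> d"
            using mult_left_mono[of "e - x0" "d / \<kappa>" C2] C2 True c d\<kappa>(3) unfolding x1_def by linarith
          ultimately have main: "2 * C1 * d + T + K * d \<le> A + T" using d(1) unfolding K2_def by (simp add: algebra_simps)
          have "approach_value J q B x' y' + ennreal (K * d) \<le> ennreal (2 * C1 * d) + ennreal T + ennreal (K * d)"
            using val by (rule add_right_mono)
          also have "\<dots> = ennreal (2 * C1 * d + T + K * d)"
            using C1 d K T by (simp add: ennreal_plus)
          also have "\<dots> \<le> ennreal (A + T)" using main by (rule ennreal_leI)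
          also have "\<dots> = J w x0 q" unfolding split_w A(1) T(1) using A T by simp
          finally show ?thesis .
        next
          case False
          then have ce: "c < e" by simp
          have we: "w e = v e" using e(3) False unfolding p_def by simp
          let ?Q = "\<lambda>x. if x \<le> c then \<l> x else v x"
          let ?P = "\<lambda>x. if x \<le> e then ?Q x else w x"
          have cx: "x0 < c" using c_r0 r0 by linarith
          have lc: "\<l> c = v c" using \<l>_top cx c by auto
          have Q: "AC_on x' e ?Q"
            by (rule AC_on_concat) (use \<l>_ac v_ac[of c e] lc c ce e x' cx in auto)
          have Qe: "?Q e = w e" using we ce by simp
          have P: "AC_on x' q ?P"
            by (rule AC_on_concat[OF Q w_ac Qe]) (use e x' in auto)
          have "approach_value J q B x' y' \<le> J ?P x' q"
            by (rule value_le[OF P _ cx]) (use eq w ce c x1 in auto)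
          also have "J ?P x' q = J ?Q x' e + J w e q"
            by (rule cost_concat[OF Q w_ac Qe]) (use e x' in auto)
          also have "J ?Q x' e = J \<l> x' c + J v c e"
            by (rule cost_concat) (use \<l>_ac v_ac[of c e] lc c ce e x' cx in auto)
          also have "J \<l> x' c + J v c e + J w e q \<le> ennreal (2 * C1 * d) + J v c e + ennreal T"
            unfolding T(1) using cx c by (intro add_right_mono \<l>_cost) auto
          finally have val: "approach_value J q B x' y' \<le> ennreal (2 * C1 * d) + J v c e + ennreal T" .
          (* Compare v on {s..e} with the line of slope -1 from (s, v s) down to height y0,
             continued by w, which is still at rest when the line arrives. *)
          define s' where "s' = s + (v s - y0)"
          have s': "s < s'" "s' < s + \<eta>" "s' < x0 + r0" "s' < c" "s' < mw"
            using vs s \<eta> c_r0 r0 unfolding s'_def by linarith+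
          let ?g = "\<lambda>x. v s - (x - s)"
          let ?z = "\<lambda>x. if x \<le> s' then ?g x else w x"
          have gw: "?g s' = w s'" using w(5)[of s'] s s' unfolding s'_def by auto
          have g_ac: "AC_on s s' ?g" by (rule AC_on_lipschitz[where M = 1]) auto
          have z: "AC_on s e ?z"
            by (rule AC_on_concat[OF g_ac w_ac gw]) (use s s' ce e in auto)
          have nm: "near_minimizer J \<epsilon> v s e"
            by (rule near_minimizer_restrict[OF v(1)]) (use c ce e in auto)
          have "J v s e \<le> J ?z s e + ennreal \<epsilon>"
            using nm z s' ce we unfolding near_minimizer_def by auto
          also have "J ?z s e = J ?g s s' + J w s' e"
            by (rule cost_concat[OF g_ac w_ac gw]) (use s s' ce e in auto)
          also have "J ?g s s' \<le> ennreal (C1 * (s' - s))"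
          proof (rule slow)
            show "\<forall>x\<in>{s..s'}. \<bar>?g x\<bar> \<le> R"
            proof
              fix x assume "x \<in> {s..s'}"
              then have "y0 \<le> ?g x" "?g x \<le> y0 + 1"
                using vs \<eta>(4) d_small(1) unfolding s'_def by auto
              then show "\<bar>?g x\<bar> \<le> R" using M unfolding R_def by linarith
            qed
            show "\<forall>x\<in>{s..s'}. \<forall>y\<in>{s..s'}. \<bar>?g x - ?g y\<bar> \<le> (M + 1) * \<bar>x - y\<bar>"
            proof (intro ballI)
              fix x y
              have "?g x - ?g y = - (x - y)" by simp
              then have "\<bar>?g x - ?g y\<bar> = 1 * \<bar>x - y\<bar>" by simp
              also have "\<dots> \<le> (M + 1) * \<bar>x - y\<bar>" using M by (intro mult_right_mono) auto
              finally show "\<bar>?g x - ?g y\<bar> \<le> (M + 1) * \<bar>x - y\<bar>" .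
            qed
          qed (use s s' w Rx in auto)
          finally have cmp: "J v s e \<le> ennreal (C1 * (s' - s)) + J w s' e + ennreal \<epsilon>"
            by (simp add: add_right_mono)
          have split_v: "J v s e = J v s c + J v c e" by (rule cost_add) (use c ce v_ac e in auto)
          have fin_v: "J v s c < \<infinity>" "J v c e < \<infinity>"
            using nm unfolding near_minimizer_def split_v by (auto simp: less_top)
          have split_w2: "J w x0 e = J w x0 s' + J w s' e"
            by (rule cost_add) (use s s' ce e w_ac in auto)
          obtain X where X: "J v s c = ennreal X" "0 \<le> X" using fin_v(1) by (cases "J v s c") auto
          obtain Y where Y: "J v c e = ennreal Y" "0 \<le> Y" using fin_v(2) by (cases "J v c e") auto
          have "J w s' e < \<infinity>" using fin_w(1) unfolding split_w2 by (auto simp: less_top)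
          then obtain W where W: "J w s' e = ennreal W" "0 \<le> W" by (cases "J w s' e") auto
          have "ennreal (X + Y) \<le> ennreal (C1 * (s' - s) + W) + ennreal \<epsilon>"
            using cmp C1 s' W X Y unfolding split_v X(1) Y(1) W(1) by simp
          then have le1: "X + Y \<le> C1 * (s' - s) + W + \<epsilon>"
            using C1 s' W \<epsilon> by (intro ennreal_le_plusD) auto
          have "ennreal (K2 * \<bar>v c - v s\<bar>) \<le> J v s c + ennreal (C2 * (c - s))"
            by (rule climb) (use c v_ac x1 in auto)
          then have "K2 * \<bar>v c - v s\<bar> \<le> X + C2 * (c - s)"
            unfolding X(1) using X C2 c by (intro ennreal_le_plusD) auto
          moreover have "K2 * (d - \<eta>) \<le> K2 * \<bar>v c - v s\<bar>"
            using K2 vs c(3) by (intro mult_left_mono) auto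
          moreover have "C2 * (c - s) \<le> d"
            using mult_left_mono[of "c - s" "d / \<kappa>" C2] C2 c s d\<kappa>(3) unfolding x1_def by linarith
          ultimately have le2: "K2 * d - K2 * \<eta> \<le> X + d" by (simp add: algebra_simps)
          have le3: "C1 * (s' - s) \<le> C1 * \<eta>" using C1 s' by (intro mult_left_mono) auto
          have "K2 * d = K * d + 2 * C1 * d + 2 * d" unfolding K2_def by (simp add: algebra_simps)
          moreover have "K2 * \<eta> + C1 * \<eta> \<le> d / 2" using \<eta>(3) by (simp add: algebra_simps)
          ultimately have main: "2 * C1 * d + Y + T + K * d \<le> W + T" using le1 le2 le3 \<epsilon>(2) by linarith
          have "approach_value J q B x' y' + ennreal (K * d) \<le> ennreal (2 * C1 * d) + J v c e + ennreal T + ennreal (K * d)"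
            using val by (rule add_right_mono)
          also have "\<dots> = ennreal (2 * C1 * d + Y + T + K * d)"
            unfolding Y(1) using C1 d K T Y by (simp add: ennreal_plus)
          also have "\<dots> \<le> ennreal (W + T)" using main by (rule ennreal_leI)
          also have "\<dots> = J w s' e + J w e q" unfolding W(1) T(1) using W T by simp
          also have "\<dots> \<le> J w x0 q" unfolding split_w split_w2 by (intro add_right_mono) simp
          finally show ?thesis .
        qed
      qed simp
    qed
  qed
  then show ?thesis unfolding y0_def using \<rho>(1) by blast
qed

end

section \<open>Steep points form null sets; reflections\<close>

context curve_cost begin

text \<open>On each of these sets the approach value of a single target serves all minimizers, and countably
many of them exhaust the steep points.\<close>

definition steep_towards :: "real \<Rightarrow> real \<Rightarrow> (real \<times> real) set" where
  "steep_towards q B = {(x0, y0). \<exists>b u. steep_through J x0 b u \<and> u x0 = y0 \<and> x0 < q \<and> q < b \<and> u q < B}"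

lemma steep_points_eq_UN:
  "steep_points J = (\<Union>(q, B)\<in>\<rat> \<times> \<int>. steep_towards q B)"
proof (intro equalityI subsetI)
  fix p assume "p \<in> steep_points J"
  then obtain x0 b u where p: "steep_through J x0 b u" "p = (x0, u x0)"
    unfolding steep_points_def by auto
  then have "x0 < b" unfolding steep_through_def by simp
  then obtain q where q: "q \<in> \<rat>" "x0 < q" "q < b" using Rats_dense_in_real by blast
  define B where "B = real_of_int (\<lfloor>u q\<rfloor> + 1)"
  have "u q < B" "B \<in> \<int>" unfolding B_def by linarith+ auto
  then have "p \<in> steep_towards q B" using p q unfolding steep_towards_def by blast
  then show "p \<in> (\<Union>(q, B)\<in>\<rat> \<times> \<int>. steep_towards q B)" using q \<open>B \<in> \<int>\<close> by blast
qed (auto simp: steep_points_def steep_towards_def)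

lemma negligible_steep_pointsI:
  assumes "\<And>q B. negligible {t \<in> E. \<gamma> t \<in> steep_towards q B}"
  shows "negligible {t \<in> E. \<gamma> t \<in> steep_points J}"
proof -
  have "countable (\<rat> \<times> \<int> :: (real \<times> real) set)"
    by (intro countable_SIGMA countable_rat countable_int)
  then have "negligible (\<Union>p\<in>\<rat> \<times> \<int>. {t \<in> E. \<gamma> t \<in> (case p of (q, B) \<Rightarrow> steep_towards q B)})"
    using assms by (intro negligible_countable_Union) auto
  then show ?thesis
    by (rule negligible_subset) (auto simp: steep_points_eq_UN)
qed

text \<open>To the left of \<open>q\<close> the approach values are finite, so the descent estimate can be read in the reals.\<close>

lemma descentE:
  assumes "(x0, y0) \<in> steep_towards q B" "0 \<le> K" "0 \<le> M"
  obtains \<rho> where "\<rho> > 0" "\<And>x' y' d. x0 - \<rho> < x' \<Longrightarrow> x' \<le> x0 \<Longrightarrow> \<bar>y' - y0\<bar> < \<rho> \<Longrightarrow>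
    d = y' + M * (x0 - x') / 2 - y0 \<Longrightarrow> 0 < d \<Longrightarrow> x0 - x' \<le> d \<Longrightarrow>
    enn2real (approach_value J q B x' y') + K * d \<le> enn2real (approach_value J q B x0 y0)"
proof -
  obtain b u where u: "steep_through J x0 b u" "u x0 = y0" "x0 < q" "q < b" "u q < B"
    using assms(1) unfolding steep_towards_def by auto
  obtain \<rho> where \<rho>: "\<rho> > 0" "\<And>x' y' d. x0 - \<rho> < x' \<Longrightarrow> x' \<le> x0 \<Longrightarrow> \<bar>y' - u x0\<bar> < \<rho> \<Longrightarrow>
    d = y' + M * (x0 - x') / 2 - u x0 \<Longrightarrow> 0 < d \<Longrightarrow> x0 - x' \<le> d \<Longrightarrow>
    approach_value J q B x' y' + ennreal (K * d) \<le> approach_value J q B x0 (u x0)"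
    using approach_value_descent[OF u(1,3,4,5) assms(2,3)] by blast
  show thesis
  proof (rule that[OF \<rho>(1)])
    fix x' y' d assume *: "x0 - \<rho> < x'" "x' \<le> x0" "\<bar>y' - y0\<bar> < \<rho>"
      "d = y' + M * (x0 - x') / 2 - y0" "0 < d" "x0 - x' \<le> d"
    obtain X where X: "approach_value J q B x' y' = ennreal X" "0 \<le> X"
      using approach_value_finite[of x' q B y'] u(3) *(2) by (cases "approach_value J q B x' y'") auto
    obtain Y where Y: "approach_value J q B x0 y0 = ennreal Y" "0 \<le> Y"
      using approach_value_finite[of x0 q B y0] u(3) by (cases "approach_value J q B x0 y0") auto
    have "ennreal (X + K * d) \<le> ennreal Y"
      using \<rho>(2)[of x' y' d] * u(2) X Y assms(2) by simp
    then show "enn2real (approach_value J q B x' y') + K * d \<le> enn2real (approach_value J q B x0 y0)"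
      using X Y by (simp add: ennreal_le_iff)
  qed
qed

text \<open>Away from a null set, \<open>f\<close> has bounded left difference quotients at \<open>t\<close>, say by \<open>M\<close>. Then curves of slope
\<open>2 * (M + 1)\<close> from \<open>(s, f s)\<close> pass over \<open>(t, f t)\<close> at a height of at least \<open>t - s\<close>, and the approach value
along the graph has infinite left derivative at \<open>t\<close>.\<close>

proposition steep_points_on_AC_graph_negligible:
  assumes f: "AC_on a b f"
  shows "negligible {t \<in> {a..b}. (t, f t) \<in> steep_points J}"
proof -
  define N where "N = {t \<in> {a..b}. \<forall>M>0. \<forall>\<eta>>0. \<exists>s\<in>{a..b}. s < t \<and> t - s < \<eta> \<and> M * (t - s) \<le> \<bar>f t - f s\<bar>}"
  have N: "negligible N"
  proof (rule AC_on_unbounded_quotients_negligible[OF f])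
    fix x K \<eta> :: real assume "x \<in> N" "0 < K" "0 < \<eta>"
    then obtain s where "x \<in> {a..b}" "s \<in> {a..b}" "s < x" "x - s < \<eta>" "K * (x - s) \<le> \<bar>f x - f s\<bar>"
      unfolding N_def by blast
    then show "\<exists>s t. a \<le> s \<and> s < t \<and> t \<le> b \<and> s \<le> x \<and> x \<le> t \<and> t - s < \<eta> \<and> K * (t - s) \<le> \<bar>f t - f s\<bar>"
      by (intro exI[of _ s] exI[of _ x]) auto
  qed
  have "negligible {t \<in> {a..b}. (t, f t) \<in> steep_towards q B}" for q B
  proof -
    define E where "E = {t \<in> {a..b}. (t, f t) \<in> steep_towards q B} - N"
    have "negligible E"
    proof (rule infinite_left_derivative_negligible[where g = "\<lambda>t. enn2real (approach_value J q B t (f t))"])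
      fix t K :: real assume t: "t \<in> E" and "0 < K"
      then obtain M \<eta> where M: "M > 0" "\<eta> > 0" "\<And>s. s \<in> {a..b} \<Longrightarrow> s < t \<Longrightarrow> t - s < \<eta> \<Longrightarrow> \<bar>f t - f s\<bar> < M * (t - s)"
        unfolding E_def N_def by (auto simp: not_le)
      obtain \<rho> where \<rho>: "\<rho> > 0" "\<And>x' y' d. t - \<rho> < x' \<Longrightarrow> x' \<le> t \<Longrightarrow> \<bar>y' - f t\<bar> < \<rho> \<Longrightarrow>
          d = y' + 2 * (M + 1) * (t - x') / 2 - f t \<Longrightarrow> 0 < d \<Longrightarrow> t - x' \<le> d \<Longrightarrow>
          enn2real (approach_value J q B x' y') + K * d \<le> enn2real (approach_value J q B t (f t))"
        using descentE[of t "f t" q B K "2 * (M + 1)"] t \<open>0 < K\<close> M(1) unfolding E_def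
        by (metis (no_types, lifting) DiffD1 mem_Collect_eq less_imp_le add_pos_pos zero_less_one mult_pos_pos zero_less_numeral)
      show "\<exists>\<rho>>0. \<forall>s\<in>E. t - \<rho> < s \<longrightarrow> s < t \<longrightarrow>
          enn2real (approach_value J q B s (f s)) + K * (t - s) \<le> enn2real (approach_value J q B t (f t))"
      proof (intro exI[of _ "min \<eta> (min \<rho> (\<rho> / M))"] conjI ballI impI)
        show "0 < min \<eta> (min \<rho> (\<rho> / M))" using M \<rho> by auto
        fix s assume s: "s \<in> E" "t - min \<eta> (min \<rho> (\<rho> / M)) < s" "s < t"
        then have st: "t - s < \<eta>" "t - s < \<rho>" "t - s < \<rho> / M" by auto
        have f_st: "\<bar>f t - f s\<bar> < M * (t - s)" using s st M(3)[of s] unfolding E_def by auto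
        define d where "d = f s + 2 * (M + 1) * (t - s) / 2 - f t"
        have "d = (f s - f t) + M * (t - s) + (t - s)" unfolding d_def by (simp add: field_simps)
        then have d: "t - s \<le> d" "0 < d" using f_st s(3) by linarith+
        have "M * (t - s) < \<rho>" using st(3) M(1) by (simp add: field_simps)
        then have "enn2real (approach_value J q B s (f s)) + K * d \<le> enn2real (approach_value J q B t (f t))"
          using st s d f_st by (intro \<rho>(2)) (auto simp: d_def)
        moreover have "K * (t - s) \<le> K * d" using d \<open>0 < K\<close> by (intro mult_left_mono) auto
        ultimately show "enn2real (approach_value J q B s (f s)) + K * (t - s) \<le>
            enn2real (approach_value J q B t (f t))" by linarith
      qed
    qed
    then have "negligible (E \<union> N)" using N by (rule negligible_Un)
    then show ?thesis by (rule negligible_subset) (auto simp: E_def)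
  qed
  then show ?thesis by (rule negligible_steep_pointsI)
qed

text \<open>Here the approach value decreases infinitely fast upwards. The substitution \<open>y = - z\<close> turns this into
an infinite left derivative in \<open>z\<close>.\<close>

proposition steep_points_on_vertical_line_negligible:
  "negligible {y. (x0, y) \<in> steep_points J}"
proof -
  have "negligible {z. (x0, - z) \<in> steep_towards q B}" for q B
  proof (rule infinite_left_derivative_negligible[where g = "\<lambda>z. enn2real (approach_value J q B x0 (- z))"])
    fix z K :: real assume z: "z \<in> {z. (x0, - z) \<in> steep_towards q B}" and "0 < K"
    then obtain \<rho> where \<rho>: "\<rho> > 0" "\<And>x' y' d. x0 - \<rho> < x' \<Longrightarrow> x' \<le> x0 \<Longrightarrow> \<bar>y' - - z\<bar> < \<rho> \<Longrightarrow>
        d = y' + 0 * (x0 - x') / 2 - - z \<Longrightarrow> 0 < d \<Longrightarrow> x0 - x' \<le> d \<Longrightarrow>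
        enn2real (approach_value J q B x' y') + K * d \<le> enn2real (approach_value J q B x0 (- z))"
      using descentE[of x0 "- z" q B K 0] by (metis mem_Collect_eq less_imp_le order_refl)
    show "\<exists>\<rho>>0. \<forall>s\<in>{z. (x0, - z) \<in> steep_towards q B}. z - \<rho> < s \<longrightarrow> s < z \<longrightarrow>
        enn2real (approach_value J q B x0 (- s)) + K * (z - s) \<le> enn2real (approach_value J q B x0 (- z))"
      using \<rho>(1) by (intro exI[of _ \<rho>] conjI ballI impI \<rho>(2)) auto
  qed
  then have "negligible {z \<in> UNIV. (x0, - z) \<in> steep_points J}"
    by (intro negligible_steep_pointsI) auto
  then have "negligible (uminus ` {z \<in> UNIV. (x0, - z) \<in> steep_points J})"
    by (rule negligible_uminus_image)
  then show ?thesis by (rule negligible_subset) (auto intro: image_eqI[of _ _ "- _"])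
qed

end

text \<open>The axioms do not distinguish up from down, nor (next lemma) left from right.\<close>

lemma curve_cost_flip:
  assumes "curve_cost J"
  shows "curve_cost (\<lambda>u s t. J (\<lambda>x. - u x) s t)"
proof
  interpret curve_cost J by fact
  show "J (\<lambda>x. - u x) s t = J (\<lambda>x. - v x) s t" if "\<And>x. x \<in> {s..t} \<Longrightarrow> u x = v x" for s t u v
    by (rule cost_cong) (use that in auto)
  show "J (\<lambda>x. - u x) r t = J (\<lambda>x. - u x) r s + J (\<lambda>x. - u x) s t"
    if "r \<le> s" "s \<le> t" "AC_on r t u" for r s t u
    by (rule cost_add) (use that AC_on_uminus in auto)
  show "\<exists>C\<ge>0. \<forall>u s t. s \<le> t \<longrightarrow> AC_on s t u \<longrightarrow>
      ennreal (K * \<bar>u t - u s\<bar>) \<le> J (\<lambda>x. - u x) s t + ennreal (C * (t - s))" if K0: "0 \<le> K" for K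
  proof -
    obtain C where C: "C \<ge> 0" "\<And>u s t. s \<le> t \<Longrightarrow> AC_on s t u \<Longrightarrow>
      ennreal (K * \<bar>u t - u s\<bar>) \<le> J u s t + ennreal (C * (t - s))" using cost_climb[OF K0] by blast
    have "ennreal (K * \<bar>u t - u s\<bar>) \<le> J (\<lambda>x. - u x) s t + ennreal (C * (t - s))"
      if "s \<le> t" "AC_on s t u" for u s t
      using C(2)[OF that(1) AC_on_uminus[OF that(2)]] by (simp add: abs_minus_commute)
    then show ?thesis using C(1) by blast
  qed
  show "\<exists>C\<ge>0. \<forall>v s t. s \<le> t \<longrightarrow> - R \<le> s \<longrightarrow> t \<le> R \<longrightarrow> (\<forall>x\<in>{s..t}. \<bar>v x\<bar> \<le> R) \<longrightarrow>
      (\<forall>x\<in>{s..t}. \<forall>y\<in>{s..t}. \<bar>v x - v y\<bar> \<le> M * \<bar>x - y\<bar>) \<longrightarrow>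
      J (\<lambda>x. - v x) s t \<le> ennreal (C * (t - s))" for R M
  proof -
    obtain C where C: "C \<ge> 0" "\<And>v s t. s \<le> t \<Longrightarrow> - R \<le> s \<Longrightarrow> t \<le> R \<Longrightarrow> (\<forall>x\<in>{s..t}. \<bar>v x\<bar> \<le> R) \<Longrightarrow>
      (\<forall>x\<in>{s..t}. \<forall>y\<in>{s..t}. \<bar>v x - v y\<bar> \<le> M * \<bar>x - y\<bar>) \<Longrightarrow> J v s t \<le> ennreal (C * (t - s))"
      using cost_slow[of R M] by blast
    show ?thesis
    proof (intro exI[of _ C] conjI C(1) allI impI)
      fix v s t assume *: "s \<le> t" "- R \<le> s" "t \<le> R" "\<forall>x\<in>{s..t}. \<bar>v x\<bar> \<le> R"
        "\<forall>x\<in>{s..t}. \<forall>y\<in>{s..t}. \<bar>v x - v y\<bar> \<le> M * \<bar>x - y\<bar>"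
      have "\<bar>- v x - - v y\<bar> = \<bar>v x - v y\<bar>" for x y by linarith
      then show "J (\<lambda>x. - v x) s t \<le> ennreal (C * (t - s))" using * by (intro C(2)) auto
    qed
  qed
qed

lemma curve_cost_reverse:
  assumes "curve_cost J"
  shows "curve_cost (\<lambda>u s t. J (\<lambda>x. u (- x)) (- t) (- s))"
proof
  interpret curve_cost J by fact
  show "J (\<lambda>x. u (- x)) (- t) (- s) = J (\<lambda>x. v (- x)) (- t) (- s)"
    if "\<And>x. x \<in> {s..t} \<Longrightarrow> u x = v x" for s t u v
    by (rule cost_cong) (use that in auto)
  show "J (\<lambda>x. u (- x)) (- t) (- r) = J (\<lambda>x. u (- x)) (- s) (- r) + J (\<lambda>x. u (- x)) (- t) (- s)"
    if "r \<le> s" "s \<le> t" "AC_on r t u" for r s t u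
    using cost_add[of "- t" "- s" "- r" "\<lambda>x. u (- x)"] that AC_on_reflect[of r t u] by (simp add: add.commute)
  show "\<exists>C\<ge>0. \<forall>u s t. s \<le> t \<longrightarrow> AC_on s t u \<longrightarrow>
      ennreal (K * \<bar>u t - u s\<bar>) \<le> J (\<lambda>x. u (- x)) (- t) (- s) + ennreal (C * (t - s))" if K0: "0 \<le> K" for K
  proof -
    obtain C where C: "C \<ge> 0" "\<And>u s t. s \<le> t \<Longrightarrow> AC_on s t u \<Longrightarrow>
      ennreal (K * \<bar>u t - u s\<bar>) \<le> J u s t + ennreal (C * (t - s))" using cost_climb[OF K0] by blast
    have "ennreal (K * \<bar>u t - u s\<bar>) \<le> J (\<lambda>x. u (- x)) (- t) (- s) + ennreal (C * (t - s))"
      if "s \<le> t" "AC_on s t u" for u s t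
      using C(2)[OF _ AC_on_reflect[OF that(2)]] that(1) by (simp add: abs_minus_commute)
    then show ?thesis using C(1) by blast
  qed
  show "\<exists>C\<ge>0. \<forall>v s t. s \<le> t \<longrightarrow> - R \<le> s \<longrightarrow> t \<le> R \<longrightarrow> (\<forall>x\<in>{s..t}. \<bar>v x\<bar> \<le> R) \<longrightarrow>
      (\<forall>x\<in>{s..t}. \<forall>y\<in>{s..t}. \<bar>v x - v y\<bar> \<le> M * \<bar>x - y\<bar>) \<longrightarrow>
      J (\<lambda>x. v (- x)) (- t) (- s) \<le> ennreal (C * (t - s))" for R M
  proof -
    obtain C where C: "C \<ge> 0" "\<And>v s t. s \<le> t \<Longrightarrow> - R \<le> s \<Longrightarrow> t \<le> R \<Longrightarrow> (\<forall>x\<in>{s..t}. \<bar>v x\<bar> \<le> R) \<Longrightarrow>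
      (\<forall>x\<in>{s..t}. \<forall>y\<in>{s..t}. \<bar>v x - v y\<bar> \<le> M * \<bar>x - y\<bar>) \<Longrightarrow> J v s t \<le> ennreal (C * (t - s))"
      using cost_slow[of R M] by blast
    show ?thesis
    proof (intro exI[of _ C] conjI C(1) allI impI)
      fix v s t assume *: "s \<le> t" "- R \<le> s" "t \<le> R" "\<forall>x\<in>{s..t}. \<bar>v x\<bar> \<le> R"
        "\<forall>x\<in>{s..t}. \<forall>y\<in>{s..t}. \<bar>v x - v y\<bar> \<le> M * \<bar>x - y\<bar>"
      have "J (\<lambda>x. v (- x)) (- t) (- s) \<le> ennreal (C * (- s - - t))"
      proof (rule C(2))
        show "\<forall>x\<in>{- t..- s}. \<forall>y\<in>{- t..- s}. \<bar>v (- x) - v (- y)\<bar> \<le> M * \<bar>x - y\<bar>"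
        proof (intro ballI)
          fix x y assume "x \<in> {- t..- s}" "y \<in> {- t..- s}"
          then have "- x \<in> {s..t}" "- y \<in> {s..t}" by auto
          then have "\<bar>v (- x) - v (- y)\<bar> \<le> M * \<bar>- x - - y\<bar>" using *(5) by blast
          also have "\<bar>- x - - y\<bar> = \<bar>x - y\<bar>" by linarith
          finally show "\<bar>v (- x) - v (- y)\<bar> \<le> M * \<bar>x - y\<bar>" .
        qed
      qed (use * in auto)
      then show "J (\<lambda>x. v (- x)) (- t) (- s) \<le> ennreal (C * (t - s))" by simp
    qed
  qed
qed

lemma approx_minimizer_flip:
  assumes "approx_minimizer J a b u"
  shows "approx_minimizer (\<lambda>u s t. J (\<lambda>x. - u x) s t) a b (\<lambda>x. - u x)"
  unfolding approx_minimizer_def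
proof (intro conjI allI impI)
  show "continuous_on {a..b} (\<lambda>x. - u x)"
    using assms unfolding approx_minimizer_def by (auto intro: continuous_on_minus)
  fix s t \<epsilon> :: real assume "a < s" "s < t" "t < b" "0 < \<epsilon>"
  then obtain w where w: "near_minimizer J \<epsilon> w s t" "\<And>x. x \<in> {s..t} \<Longrightarrow> \<bar>w x - u x\<bar> < \<epsilon>"
    using assms unfolding approx_minimizer_def by blast
  have "near_minimizer (\<lambda>u s t. J (\<lambda>x. - u x) s t) \<epsilon> (\<lambda>x. - w x) s t"
    unfolding near_minimizer_def
  proof (intro conjI allI impI)
    show "AC_on s t (\<lambda>x. - w x)" using w(1) unfolding near_minimizer_def by (auto intro: AC_on_uminus)
    show "J (\<lambda>x. - (- w x)) s t < \<infinity>" using w(1) unfolding near_minimizer_def by simp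
    fix v assume "AC_on s t v" "v s = - w s" "v t = - w t"
    then have "AC_on s t (\<lambda>x. - v x)" "- v s = w s" "- v t = w t" using AC_on_uminus by auto
    then have "J w s t \<le> J (\<lambda>x. - v x) s t + ennreal \<epsilon>"
      using w(1) unfolding near_minimizer_def by blast
    then show "J (\<lambda>x. - (- w x)) s t \<le> J (\<lambda>x. - v x) s t + ennreal \<epsilon>" by simp
  qed
  moreover have "\<bar>- w x - - u x\<bar> < \<epsilon>" if "x \<in> {s..t}" for x using w(2)[OF that] by linarith
  ultimately show "\<exists>w. near_minimizer (\<lambda>u s t. J (\<lambda>x. - u x) s t) \<epsilon> w s t \<and> (\<forall>x\<in>{s..t}. \<bar>w x - - u x\<bar> < \<epsilon>)"
    by blast
qed

lemma approx_minimizer_reverse: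
  assumes "approx_minimizer J a b u"
  shows "approx_minimizer (\<lambda>u s t. J (\<lambda>x. u (- x)) (- t) (- s)) (- b) (- a) (\<lambda>x. u (- x))"
  unfolding approx_minimizer_def
proof (intro conjI allI impI)
  have "continuous_on {a..b} u" using assms unfolding approx_minimizer_def by auto
  then show "continuous_on {- b..- a} (\<lambda>x. u (- x))"
    by (rule continuous_on_compose2) (auto intro!: continuous_intros)
  fix s t \<epsilon> :: real assume "- b < s" "s < t" "t < - a" "0 < \<epsilon>"
  then have "a < - t" "- t < - s" "- s < b" by auto
  then obtain w where w: "near_minimizer J \<epsilon> w (- t) (- s)" "\<And>x. x \<in> {- t..- s} \<Longrightarrow> \<bar>w x - u x\<bar> < \<epsilon>"
    using assms \<open>0 < \<epsilon>\<close> unfolding approx_minimizer_def by blast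
  have "near_minimizer (\<lambda>u s t. J (\<lambda>x. u (- x)) (- t) (- s)) \<epsilon> (\<lambda>x. w (- x)) s t"
    unfolding near_minimizer_def
  proof (intro conjI allI impI)
    show "AC_on s t (\<lambda>x. w (- x))"
      using AC_on_reflect[of "- t" "- s" w] w(1) unfolding near_minimizer_def by simp
    show "J (\<lambda>x. w (- (- x))) (- t) (- s) < \<infinity>" using w(1) unfolding near_minimizer_def by simp
    fix v assume v: "AC_on s t v" "v s = w (- s)" "v t = w (- t)"
    then have "AC_on (- t) (- s) (\<lambda>x. v (- x))" using AC_on_reflect by blast
    then have "J w (- t) (- s) \<le> J (\<lambda>x. v (- x)) (- t) (- s) + ennreal \<epsilon>"
      using w(1) v unfolding near_minimizer_def by auto
    then show "J (\<lambda>x. w (- (- x))) (- t) (- s) \<le> J (\<lambda>x. v (- x)) (- t) (- s) + ennreal \<epsilon>" by simp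
  qed
  moreover have "\<bar>w (- x) - u (- x)\<bar> < \<epsilon>" if "x \<in> {s..t}" for x using w(2)[of "- x"] that by auto
  ultimately show "\<exists>w. near_minimizer (\<lambda>u s t. J (\<lambda>x. u (- x)) (- t) (- s)) \<epsilon> w s t \<and>
      (\<forall>x\<in>{s..t}. \<bar>w x - u (- x)\<bar> < \<epsilon>)" by blast
qed

section \<open>The cost of a Lagrangian\<close>

text \<open>With \<open>- c\<close> a lower bound of \<open>L\<close>, the integrand is nonnegative and additivity and comparison need no care
about infinite values. The action differs from this cost by \<open>c * (b - a)\<close>.\<close>

definition lagrangian_cost ::
  "real \<Rightarrow> (real \<times> real \<times> real \<Rightarrow> real) \<Rightarrow> (real \<Rightarrow> real) \<Rightarrow> real \<Rightarrow> real \<Rightarrow> ennreal" where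
  "lagrangian_cost c L u a b = (\<integral>\<^sup>+x\<in>{a..b}. ennreal (L (x, u x, deriv u x) + c) \<partial>lborel)"

lemma AC_on_integrand_measurable:
  assumes L: "L \<in> borel_measurable borel" and u: "AC_on a b u"
  obtains F where "F \<in> borel_measurable borel"
    "AE x in lborel. x \<in> {a..b} \<longrightarrow> L (x, u x, deriv u x) = (F x :: real)"
proof -
  obtain g where g: "g \<in> borel_measurable borel"
    "AE x in lborel. x \<in> {a..b} \<longrightarrow> a < x \<and> x < b \<and> u differentiable (at x) \<and> deriv u x = g x"
    by (rule AC_on_deriv_measurable[OF u])
  define v where "v = (\<lambda>x. u (max a (min b x)))"
  have v: "v \<in> borel_measurable borel" unfolding v_def by (rule AC_on_clamp_measurable[OF u])
  have "(\<lambda>x. (x, v x, g x)) \<in> borel_measurable borel"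
    by (intro borel_measurable_Pair v g(1)) simp
  then have "(\<lambda>x. L (x, v x, g x)) \<in> borel_measurable borel"
    using L by (rule measurable_compose)
  moreover have "AE x in lborel. x \<in> {a..b} \<longrightarrow> L (x, u x, deriv u x) = L (x, v x, g x)"
    using g(2) by (rule eventually_mono) (auto simp: v_def)
  ultimately show thesis by (rule that)
qed

text \<open>Compactness turns local boundedness into boundedness on bounded sets.\<close>

lemma lagrangian_locally_bounded:
  assumes "lagrangian L"
  shows "\<exists>C\<ge>0. \<forall>x y p. \<bar>x\<bar> \<le> R \<longrightarrow> \<bar>y\<bar> \<le> R \<longrightarrow> \<bar>p\<bar> \<le> M \<longrightarrow> L (x, y, p) \<le> C"
proof -
  have "\<forall>z. \<exists>r>0. bdd_above (L ` ball z r)" using assms unfolding lagrangian_def by blast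
  then obtain r where r: "\<And>z. r z > 0" "\<And>z. bdd_above (L ` ball z (r z))" by metis
  then obtain B where B: "\<And>z w. w \<in> ball z (r z) \<Longrightarrow> L w \<le> B z"
    unfolding bdd_above_def by (metis imageI)
  let ?S = "{-R..R} \<times> {-R..R} \<times> {-M..M}"
  have cpt: "compact ?S" by (intro compact_Times compact_Icc)
  have "?S \<subseteq> (\<Union>z\<in>?S. ball z (r z))"
  proof
    fix z assume "z \<in> ?S"
    then show "z \<in> (\<Union>z\<in>?S. ball z (r z))" using r(1)[of z] by (intro UN_I[of z]) simp_all
  qed
  then obtain D where D: "D \<subseteq> ?S" "finite D" "?S \<subseteq> (\<Union>z\<in>D. ball z (r z))"
    by (rule compactE_image[OF cpt open_ball])
  show ?thesis
  proof (intro exI[of _ "\<Sum>z\<in>D. \<bar>B z\<bar>"] conjI allI impI)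
    fix x y p assume "\<bar>x\<bar> \<le> R" "\<bar>y\<bar> \<le> R" "\<bar>p\<bar> \<le> M"
    then have "(x, y, p) \<in> ?S" by auto
    then obtain z where z: "z \<in> D" "(x, y, p) \<in> ball z (r z)" using D(3) by blast
    have "L (x, y, p) \<le> \<bar>B z\<bar>" using B[OF z(2)] by linarith
    also have "\<dots> \<le> (\<Sum>z\<in>D. \<bar>B z\<bar>)" using D(2) z(1) by (intro member_le_sum) auto
    finally show "L (x, y, p) \<le> (\<Sum>z\<in>D. \<bar>B z\<bar>)" .
  qed (simp add: sum_nonneg)
qed

lemma lagrangian_superlinear_bound:
  assumes "lagrangian L" "0 \<le> K"
  shows "\<exists>C\<ge>0. \<forall>x y p. C < \<bar>p\<bar> \<longrightarrow> K * \<bar>p\<bar> \<le> L (x, y, p)"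
proof -
  obtain \<omega> where \<omega>: "superlinear \<omega>" "\<And>x y p. L (x, y, p) \<ge> \<omega> p"
    using assms unfolding lagrangian_def by blast
  have "eventually (\<lambda>p. K \<le> \<omega> p / \<bar>p\<bar>) at_infinity"
    using \<omega>(1) unfolding superlinear_def filterlim_at_top by blast
  then obtain P where P: "\<And>p. P \<le> \<bar>p\<bar> \<Longrightarrow> K \<le> \<omega> p / \<bar>p\<bar>"
    unfolding eventually_at_infinity by auto
  show ?thesis
  proof (intro exI[of _ "max 0 P"] conjI allI impI)
    fix x y p assume p: "max 0 P < \<bar>p\<bar>"
    then have "K \<le> \<omega> p / \<bar>p\<bar>" using P[of p] by auto
    then have "K * \<bar>p\<bar> \<le> \<omega> p" using p by (simp add: pos_le_divide_eq)
    then show "K * \<bar>p\<bar> \<le> L (x, y, p)" using \<omega>(2)[of p x y] by linarith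
  qed simp
qed

lemma lipschitz_deriv_bound:
  fixes v :: "real \<Rightarrow> real"
  assumes v: "(v has_field_derivative D) (at x)" and x: "s < x" "x < t"
    and lip: "\<And>y. y \<in> {s..t} \<Longrightarrow> \<bar>v y - v x\<bar> \<le> M * \<bar>y - x\<bar>"
  shows "\<bar>D\<bar> \<le> M"
proof (rule tendsto_upperbound)
  show "((\<lambda>y. \<bar>(v y - v x) / (y - x)\<bar>) \<longlongrightarrow> \<bar>D\<bar>) (at x)"
    using v unfolding has_field_derivative_iff by (rule tendsto_rabs)
  have "eventually (\<lambda>y. y \<in> {s<..<t}) (at x)"
    using x by (intro eventually_at_in_open') auto
  then have "eventually (\<lambda>y. y \<in> {s<..<t} \<and> y \<noteq> x) (at x)"
    by (intro eventually_conj) (auto simp: eventually_at_filter)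
  then show "eventually (\<lambda>y. \<bar>(v y - v x) / (y - x)\<bar> \<le> M) (at x)"
  proof (rule eventually_mono)
    fix y assume y: "y \<in> {s<..<t} \<and> y \<noteq> x"
    then show "\<bar>(v y - v x) / (y - x)\<bar> \<le> M"
      using lip[of y] by (simp add: abs_divide pos_divide_le_eq)
  qed
qed simp

lemma lagrangian_cost_eq:
  assumes F: "AE x in lborel. x \<in> {a..b} \<longrightarrow> L (x, u x, deriv u x) = F x" and "a \<le> s" "t \<le> b"
  shows "lagrangian_cost c L u s t = (\<integral>\<^sup>+x. ennreal (F x + c) * indicator {s..t} x \<partial>lborel)"
  unfolding lagrangian_cost_def
  by (rule nn_integral_cong_AE)
    (use F in eventually_elim, use assms(2,3) in \<open>auto split: split_indicator\<close>)

locale bounded_below_lagrangian =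
  fixes L :: "real \<times> real \<times> real \<Rightarrow> real" and c :: real
  assumes lag: "lagrangian L" and c: "0 \<le> c" and Lc: "0 \<le> L z + c"
begin

abbreviation "cost \<equiv> lagrangian_cost c L"

lemma Lm: "L \<in> borel_measurable borel"
  using lag unfolding lagrangian_def by blast

text \<open>Superlinearity enters in the form \<open>K * \<bar>p\<bar> \<le> L (x, y, p) + c + K * P\<close>, where \<open>P\<close> is such that \<open>L\<close> is at
least \<open>K * \<bar>p\<bar>\<close> for \<open>\<bar>p\<bar> > P\<close>. Integrating it along a curve gives the cost of climbing.\<close>

lemma curve_cost_lagrangian: "curve_cost cost"
proof
  fix s t and u v :: "real \<Rightarrow> real" assume eq: "\<And>x. x \<in> {s..t} \<Longrightarrow> u x = v x"
  have "L (x, u x, deriv u x) = L (x, v x, deriv v x)" if "x \<in> {s..t}" "x \<notin> {s, t}" for x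
  proof -
    have "eventually (\<lambda>y. y \<in> {s<..<t}) (nhds x)" using that by (intro eventually_nhds_in_open) auto
    then have "eventually (\<lambda>y. u y = v y) (nhds x)" by (rule eventually_mono) (use eq in auto)
    then have "deriv u x = deriv v x" by (intro deriv_cong_ev) auto
    then show ?thesis using eq[OF that(1)] by simp
  qed
  then have "AE x in lborel. x \<in> {s..t} \<longrightarrow> L (x, u x, deriv u x) = L (x, v x, deriv v x)"
    by (intro ae_lborel_of_negligible[of "{s, t}"]) auto
  from lagrangian_cost_eq[OF this order_refl order_refl]
  show "cost u s t = cost v s t" by (simp add: lagrangian_cost_def)
next
  fix r s t u assume rst: "r \<le> s" "s \<le> t" and u: "AC_on r t u"
  obtain F where [measurable]: "F \<in> borel_measurable borel"
    and F: "AE x in lborel. x \<in> {r..t} \<longrightarrow> L (x, u x, deriv u x) = (F x :: real)"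
    by (rule AC_on_integrand_measurable[OF Lm u])
  have "cost u r s + cost u s t =
      (\<integral>\<^sup>+x. ennreal (F x + c) * indicator {r..s} x + ennreal (F x + c) * indicator {s..t} x \<partial>lborel)"
    using rst by (simp add: lagrangian_cost_eq[OF F] nn_integral_add)
  also have "\<dots> = (\<integral>\<^sup>+x. ennreal (F x + c) * indicator {r..t} x \<partial>lborel)"
    by (intro nn_integral_cong_AE ae_lborel_of_negligible[of "{s}"])
      (use rst in \<open>auto split: split_indicator\<close>)
  also have "\<dots> = cost u r t" by (simp add: lagrangian_cost_eq[OF F])
  finally show "cost u r t = cost u r s + cost u s t" ..
next
  fix K :: real assume K: "0 \<le> K"
  obtain P where P: "P \<ge> 0" "\<And>x y p. P < \<bar>p\<bar> \<Longrightarrow> K * \<bar>p\<bar> \<le> L (x, y, p)"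
    using lagrangian_superlinear_bound[OF lag K] by blast
  have bound: "K * \<bar>p\<bar> \<le> L (x, y, p) + c + K * P" for x y p
  proof (cases "P < \<bar>p\<bar>")
    case True
    have "0 \<le> K * P" using K P(1) by simp
    then show ?thesis using P(2)[OF True, of x y] c by linarith
  next
    case False
    then have "K * \<bar>p\<bar> \<le> K * P" using K by (intro mult_left_mono) auto
    then show ?thesis using Lc[of "(x, y, p)"] by linarith
  qed
  have "ennreal (K * \<bar>u t - u s\<bar>) \<le> cost u s t + ennreal (K * P * (t - s))"
    if st: "s \<le> t" and u: "AC_on s t u" for u s t
  proof -
    obtain F where [measurable]: "F \<in> borel_measurable borel"
      and F: "AE x in lborel. x \<in> {s..t} \<longrightarrow> L (x, u x, deriv u x) = (F x :: real)"
      by (rule AC_on_integrand_measurable[OF Lm u])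
    obtain g where [measurable]: "g \<in> borel_measurable borel" and
      g: "AE x in lborel. x \<in> {s..t} \<longrightarrow> s < x \<and> x < t \<and> u differentiable (at x) \<and> deriv u x = g x"
      by (rule AC_on_deriv_measurable[OF u])
    have "ennreal (K * \<bar>u t - u s\<bar>) = ennreal K * ennreal \<bar>u t - u s\<bar>"
      using K by (simp add: ennreal_mult)
    also have "\<dots> \<le> ennreal K * (\<integral>\<^sup>+x\<in>{s..t}. ennreal \<bar>deriv u x\<bar> \<partial>lborel)"
      by (intro mult_left_mono AC_on_increment_le_nn_integral u st) simp
    also have "(\<integral>\<^sup>+x\<in>{s..t}. ennreal \<bar>deriv u x\<bar> \<partial>lborel) = (\<integral>\<^sup>+x\<in>{s..t}. ennreal \<bar>g x\<bar> \<partial>lborel)"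
      by (rule nn_integral_cong_AE) (use g in \<open>eventually_elim, auto split: split_indicator\<close>)
    also have "ennreal K * \<dots> = (\<integral>\<^sup>+x. ennreal K * (ennreal \<bar>g x\<bar> * indicator {s..t} x) \<partial>lborel)"
      by (rule nn_integral_cmult[symmetric]) measurable
    also have "\<dots> \<le> (\<integral>\<^sup>+x. ennreal (F x + c) * indicator {s..t} x + ennreal (K * P) * indicator {s..t} x \<partial>lborel)"
    proof (rule nn_integral_mono_AE)
      show "AE x in lborel. ennreal K * (ennreal \<bar>g x\<bar> * indicator {s..t} x) \<le>
          ennreal (F x + c) * indicator {s..t} x + ennreal (K * P) * indicator {s..t} x"
        using F g
      proof eventually_elim
        case (elim x)
        show ?case
        proof (cases "x \<in> {s..t}")
          case True
          then have "K * \<bar>g x\<bar> \<le> F x + c + K * P" "0 \<le> F x + c"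
            using elim bound[of "deriv u x" x "u x"] Lc[of "(x, u x, deriv u x)"] by auto
          then have "ennreal (K * \<bar>g x\<bar>) \<le> ennreal ((F x + c) + K * P)" by (intro ennreal_leI)
          also have "\<dots> = ennreal (F x + c) + ennreal (K * P)"
            using K P(1) \<open>0 \<le> F x + c\<close> by (intro ennreal_plus mult_nonneg_nonneg)
          finally have "ennreal (K * \<bar>g x\<bar>) \<le> ennreal (F x + c) + ennreal (K * P)" .
          then show ?thesis using True K by (simp add: ennreal_mult)
        qed simp
      qed
    qed
    also have "\<dots> = cost u s t + (\<integral>\<^sup>+x. ennreal (K * P) * indicator {s..t} x \<partial>lborel)"
      by (subst nn_integral_add) (auto simp: lagrangian_cost_eq[OF F])
    also have "(\<integral>\<^sup>+x. ennreal (K * P) * indicator {s..t} x \<partial>lborel) = ennreal (K * P * (t - s))"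
      using st K P(1) by (simp add: nn_integral_cmult_indicator ennreal_mult)
    finally show ?thesis .
  qed
  then show "\<exists>C\<ge>0. \<forall>u s t. s \<le> t \<longrightarrow> AC_on s t u \<longrightarrow>
      ennreal (K * \<bar>u t - u s\<bar>) \<le> cost u s t + ennreal (C * (t - s))"
    using K P(1) by (intro exI[of _ "K * P"]) auto
next
  fix R M :: real
  obtain C where C: "C \<ge> 0" "\<And>x y p. \<bar>x\<bar> \<le> R \<Longrightarrow> \<bar>y\<bar> \<le> R \<Longrightarrow> \<bar>p\<bar> \<le> M \<Longrightarrow> L (x, y, p) \<le> C"
    using lagrangian_locally_bounded[OF lag, of R M] by blast
  have "cost v s t \<le> ennreal ((C + c) * (t - s))"
    if st: "s \<le> t" "- R \<le> s" "t \<le> R" and v: "\<forall>x\<in>{s..t}. \<bar>v x\<bar> \<le> R"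
      and lip: "\<forall>x\<in>{s..t}. \<forall>y\<in>{s..t}. \<bar>v x - v y\<bar> \<le> M * \<bar>x - y\<bar>" for v s t
  proof -
    have "AC_on s t v" by (rule AC_on_lipschitz) (use lip in blast)
    then have "negligible ({s, t} \<union> {x \<in> {s<..<t}. \<not> v differentiable (at x)})"
      by (intro negligible_Un AC_on_differentiable_ae) auto
    then have "AE x in lborel. x \<in> {s..t} \<longrightarrow> L (x, v x, deriv v x) \<le> C"
    proof (rule ae_lborel_of_negligible)
      fix x assume x: "x \<notin> {s, t} \<union> {x \<in> {s<..<t}. \<not> v differentiable (at x)}"
      show "x \<in> {s..t} \<longrightarrow> L (x, v x, deriv v x) \<le> C"
      proof
        assume xst: "x \<in> {s..t}"
        then have x': "s < x" "x < t" "v differentiable (at x)" using x by auto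
        have "\<bar>deriv v x\<bar> \<le> M"
          by (rule lipschitz_deriv_bound[where v = v and s = s and t = t])
            (use x' xst lip in \<open>auto simp: DERIV_deriv_iff_real_differentiable\<close>)
        then show "L (x, v x, deriv v x) \<le> C" using xst st v by (intro C(2)) auto
      qed
    qed
    then have "cost v s t \<le> (\<integral>\<^sup>+x. ennreal (C + c) * indicator {s..t} x \<partial>lborel)"
      unfolding lagrangian_cost_def
      by (intro nn_integral_mono_AE, eventually_elim) (auto split: split_indicator intro: ennreal_leI)
    also have "\<dots> = ennreal ((C + c) * (t - s))"
      using st C(1) c by (simp add: nn_integral_cmult_indicator ennreal_mult)
    finally show ?thesis .
  qed
  then show "\<exists>C\<ge>0. \<forall>v s t. s \<le> t \<longrightarrow> - R \<le> s \<longrightarrow> t \<le> R \<longrightarrow> (\<forall>x\<in>{s..t}. \<bar>v x\<bar> \<le> R) \<longrightarrow>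
      (\<forall>x\<in>{s..t}. \<forall>y\<in>{s..t}. \<bar>v x - v y\<bar> \<le> M * \<bar>x - y\<bar>) \<longrightarrow> cost v s t \<le> ennreal (C * (t - s))"
    using C(1) c by (intro exI[of _ "C + c"]) auto
qed

sublocale curve_cost cost by (rule curve_cost_lagrangian)

text \<open>As \<open>F \<ge> - c\<close>, the positive part of \<open>F + c\<close> together with the negative part of \<open>F\<close> is the positive part of
\<open>F\<close> together with \<open>c\<close>, pointwise, and the negative part has finite integral.\<close>

lemma action_eq_cost:
  assumes u: "AC_on a b u" and "a \<le> b"
  shows "action L u a b = enn2ereal (cost u a b) - ereal (c * (b - a))"
proof -
  obtain F where [measurable]: "F \<in> borel_measurable borel"
    and F: "AE x in lborel. x \<in> {a..b} \<longrightarrow> L (x, u x, deriv u x) = (F x :: real)"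
    by (rule AC_on_integrand_measurable[OF Lm u])
  define P where "P = (\<integral>\<^sup>+x. ennreal (F x) * indicator {a..b} x \<partial>lborel)"
  define N where "N = (\<integral>\<^sup>+x. ennreal (- F x) * indicator {a..b} x \<partial>lborel)"
  have act: "action L u a b = enn2ereal P - enn2ereal N"
  proof -
    have "(\<integral>\<^sup>+x\<in>{a..b}. ennreal (L (x, u x, deriv u x)) \<partial>lborel) = P"
      "(\<integral>\<^sup>+x\<in>{a..b}. ennreal (- L (x, u x, deriv u x)) \<partial>lborel) = N"
      unfolding P_def N_def
      by (rule nn_integral_cong_AE, use F in \<open>eventually_elim, auto split: split_indicator\<close>)+
    then show ?thesis unfolding action_def by simp
  qed
  have const: "(\<integral>\<^sup>+x. ennreal c * indicator {a..b} x \<partial>lborel) = ennreal (c * (b - a))"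
    using c \<open>a \<le> b\<close> by (simp add: nn_integral_cmult_indicator ennreal_mult)
  have Fc: "AE x in lborel. x \<in> {a..b} \<longrightarrow> 0 \<le> F x + c"
    using F by eventually_elim (metis Lc)
  have "N \<le> (\<integral>\<^sup>+x. ennreal c * indicator {a..b} x \<partial>lborel)"
    unfolding N_def using Fc
    by (intro nn_integral_mono_AE, eventually_elim) (auto split: split_indicator intro: ennreal_leI)
  then have "N < \<infinity>" unfolding const by (rule order.strict_trans1) simp
  then obtain n where n: "N = ennreal n" "0 \<le> n" by (cases N) auto
  have "cost u a b + N = (\<integral>\<^sup>+x. ennreal (F x + c) * indicator {a..b} x + ennreal (- F x) * indicator {a..b} x \<partial>lborel)"
    unfolding N_def lagrangian_cost_eq[OF F order_refl order_refl] by (rule nn_integral_add[symmetric]) auto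
  also have "\<dots> = (\<integral>\<^sup>+x. ennreal (F x) * indicator {a..b} x + ennreal c * indicator {a..b} x \<partial>lborel)"
  proof (rule nn_integral_cong_AE)
    show "AE x in lborel. ennreal (F x + c) * indicator {a..b} x + ennreal (- F x) * indicator {a..b} x =
        ennreal (F x) * indicator {a..b} x + ennreal c * indicator {a..b} x"
      using Fc
    proof eventually_elim
      case (elim x)
      have "ennreal (F x + c) + ennreal (- F x) = ennreal (F x) + ennreal c" if "0 \<le> F x + c"
      proof (cases "0 \<le> F x")
        case True
        then show ?thesis using c by (simp add: ennreal_neg)
      next
        case False
        then have "ennreal (F x + c) + ennreal (- F x) = ennreal (F x + c + - F x)"
          using that by (intro ennreal_plus[symmetric]) auto
        then show ?thesis using False by (simp add: ennreal_neg)
      qed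
      then show ?case using elim by (auto split: split_indicator)
    qed
  qed
  also have "\<dots> = P + ennreal (c * (b - a))"
    unfolding P_def const[symmetric] by (rule nn_integral_add) auto
  finally have eq: "cost u a b + N = P + ennreal (c * (b - a))" .
  have cn: "0 \<le> c * (b - a)" using c \<open>a \<le> b\<close> by simp
  show ?thesis
  proof (cases "cost u a b")
    case (real r)
    then have "P < \<infinity>" using eq n by (metis ennreal_add_eq_top ennreal_neq_top infinity_ennreal_def less_top)
    then obtain p where p: "P = ennreal p" "0 \<le> p" by (cases P) auto
    have "r + n = p + c * (b - a)"
      using eq real n p cn by (simp flip: ennreal_plus add: ennreal_inj)
    then show ?thesis unfolding act using real n p by (simp add: enn2ereal_ennreal)
  next
    case top
    then have "P = \<infinity>" using eq by (metis ennreal_add_eq_top ennreal_neq_top infinity_ennreal_def add_top top_add)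
    then show ?thesis unfolding act using top n by (simp add: enn2ereal_ennreal)
  qed
qed

text \<open>The added constant contributes \<open>c * (b - a)\<close> to every curve on \<open>{a..b}\<close>, so it does not affect
comparisons. If the action of \<open>u\<close> were infinite, the excess would be infinite as well.\<close>

lemma near_minimizer_of_excess:
  assumes u: "AC_on a b u" and ab: "a < b" and ex: "excess L u a b < ereal \<epsilon>"
  shows "near_minimizer cost \<epsilon> u a b"
proof -
  define m where "m = min_action L a (u a) b (u b)"
  have ex': "action L u a b - m < ereal \<epsilon>" using ex unfolding excess_def m_def .
  note act = action_eq_cost[OF u less_imp_le[OF ab]]
  have fin: "cost u a b < \<infinity>"
  proof (rule ccontr)
    assume "\<not> ?thesis"
    then have "cost u a b = \<infinity>" by (simp add: less_top[symmetric])
    then have "action L u a b = \<infinity>" unfolding act by simp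
    then show False using ex' by simp
  qed
  then obtain r where r: "cost u a b = ennreal r" "0 \<le> r" by (cases "cost u a b") auto
  then have A: "action L u a b = ereal (r - c * (b - a))" unfolding act by (simp add: enn2ereal_ennreal)
  have "cost u a b \<le> cost v a b + ennreal \<epsilon>" if v: "AC_on a b v" "v a = u a" "v b = u b" for v
  proof (cases "cost v a b")
    case (real r')
    have "m \<le> action L v a b" unfolding m_def min_action_def using v by (intro Inf_lower) auto
    also have "\<dots> = ereal (r' - c * (b - a))"
      unfolding action_eq_cost[OF v(1) less_imp_le[OF ab]] using real by (simp add: enn2ereal_ennreal)
    finally have m_le: "m \<le> ereal (r' - c * (b - a))" .
    have "r \<le> r' + \<epsilon>"
    proof (cases m)
      case (real m')
      then show ?thesis using m_le ex' A by simp
    qed (use m_le ex' A in auto)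
    then have "ennreal r \<le> ennreal (r' + \<epsilon>)" by (rule ennreal_leI)
    also have "\<dots> \<le> ennreal r' + ennreal \<epsilon>"
      using real by (cases "0 \<le> \<epsilon>") (auto simp: ennreal_neg intro: ennreal_leI)
    finally show ?thesis using r real by simp
  qed simp
  then show ?thesis using u fin unfolding near_minimizer_def by blast
qed

text \<open>On a compact subinterval finitely many of the neighbourhoods from the local uniform convergence
suffice, so a single member of the sequence is close to \<open>u\<close> on all of it.\<close>

lemma approx_minimizer_of_generalized_minimizer:
  assumes "generalized_minimizer L a b u"
  shows "approx_minimizer cost a b u"
  unfolding approx_minimizer_def
proof (intro conjI allI impI)
  show "continuous_on {a..b} u" using assms unfolding generalized_minimizer_def by blast
  fix s t \<epsilon> :: real assume st: "a < s" "s < t" "t < b" and \<epsilon>: "0 < \<epsilon>"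
  obtain un :: "nat \<Rightarrow> real \<Rightarrow> real" and an bn where
    ac: "\<And>n. an n < bn n" "\<And>n. AC_on (an n) (bn n) (un n)" and
    ex: "(\<lambda>n. excess L (un n) (an n) (bn n)) \<longlonglongrightarrow> 0" and
    loc: "\<forall>x\<in>{a<..<b}. \<exists>r>0. ball x r \<subseteq> {a<..<b} \<and>
           (\<forall>\<^sub>F n in sequentially. ball x r \<subseteq> {an n..bn n}) \<and>
           uniform_limit (ball x r) un u sequentially"
    using assms unfolding generalized_minimizer_def by blast
  define Q where "Q = (\<lambda>x r. \<forall>\<^sub>F n in sequentially. ball x r \<subseteq> {an n..bn n} \<and> (\<forall>y\<in>ball x r. \<bar>un n y - u y\<bar> < \<epsilon>))"
  have "\<exists>r>0. (\<forall>\<^sub>F n in sequentially. ball x r \<subseteq> {an n..bn n} \<and> (\<forall>y\<in>ball x r. \<bar>un n y - u y\<bar> < \<epsilon>))"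
    if "x \<in> {s..t}" for x
  proof -
    have "x \<in> {a<..<b}" using that st by auto
    then obtain r where r: "r > 0" "\<forall>\<^sub>F n in sequentially. ball x r \<subseteq> {an n..bn n}"
      "uniform_limit (ball x r) un u sequentially" using loc by blast
    have "\<forall>\<^sub>F n in sequentially. \<forall>y\<in>ball x r. \<bar>un n y - u y\<bar> < \<epsilon>"
      using uniform_limitD[OF r(3) \<epsilon>] unfolding dist_real_def .
    then show ?thesis using r(1,2) by (intro exI[of _ r] conjI eventually_conj)
  qed
  then have "\<forall>x\<in>{s..t}. \<exists>r. r > 0 \<and> Q x r" unfolding Q_def by blast
  from bchoice[OF this] obtain r where r: "\<And>x. x \<in> {s..t} \<Longrightarrow> r x > 0" "\<And>x. x \<in> {s..t} \<Longrightarrow> Q x (r x)"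
    by blast
  obtain D where D: "D \<subseteq> {s..t}" "finite D" "{s..t} \<subseteq> (\<Union>x\<in>D. ball x (r x))"
    by (rule compactE_image[OF compact_Icc, where C = "{s..t}" and f = "\<lambda>x. ball x (r x)"])
      (use r(1) in auto)
  have "\<forall>\<^sub>F n in sequentially. \<forall>x\<in>D. ball x (r x) \<subseteq> {an n..bn n} \<and> (\<forall>y\<in>ball x (r x). \<bar>un n y - u y\<bar> < \<epsilon>)"
    using D(1) r(2) unfolding Q_def by (intro eventually_ball_finite D(2)) blast
  moreover have "\<forall>\<^sub>F n in sequentially. excess L (un n) (an n) (bn n) < ereal \<epsilon>"
    using order_tendstoD(2)[OF ex] \<epsilon> by simp
  ultimately have "\<forall>\<^sub>F n in sequentially.
      (\<forall>x\<in>D. ball x (r x) \<subseteq> {an n..bn n} \<and> (\<forall>y\<in>ball x (r x). \<bar>un n y - u y\<bar> < \<epsilon>)) \<and>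
      excess L (un n) (an n) (bn n) < ereal \<epsilon>" by (rule eventually_conj)
  then obtain n where n: "\<And>x. x \<in> D \<Longrightarrow> ball x (r x) \<subseteq> {an n..bn n}"
    "\<And>x y. x \<in> D \<Longrightarrow> y \<in> ball x (r x) \<Longrightarrow> \<bar>un n y - u y\<bar> < \<epsilon>"
    "excess L (un n) (an n) (bn n) < ereal \<epsilon>"
    using eventually_happens'[OF sequentially_bot] by blast
  have sub: "{s..t} \<subseteq> {an n..bn n}" using D(3) n(1) by blast
  then have "an n \<le> s" "t \<le> bn n" using st by auto
  have "near_minimizer cost \<epsilon> (un n) (an n) (bn n)" by (rule near_minimizer_of_excess[OF ac(2,1) n(3)])
  then have "near_minimizer cost \<epsilon> (un n) s t"
    by (rule near_minimizer_restrict) (use st \<open>an n \<le> s\<close> \<open>t \<le> bn n\<close> in auto)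
  moreover have "\<bar>un n y - u y\<bar> < \<epsilon>" if "y \<in> {s..t}" for y
    using D(3) that n(2) by blast
  ultimately show "\<exists>w. near_minimizer cost \<epsilon> w s t \<and> (\<forall>x\<in>{s..t}. \<bar>w x - u x\<bar> < \<epsilon>)" by blast
qed

end

section \<open>The universal singular set\<close>

lemma approx_minimizer_subinterval:
  assumes "approx_minimizer J a b u" "a \<le> a'" "b' \<le> b"
  shows "approx_minimizer J a' b' u"
  unfolding approx_minimizer_def
proof (intro conjI allI impI)
  show "continuous_on {a'..b'} u"
    using assms unfolding approx_minimizer_def by (auto intro: continuous_on_subset)
  fix s t \<epsilon> :: real assume "a' < s" "s < t" "t < b'" "0 < \<epsilon>"
  then show "\<exists>w. near_minimizer J \<epsilon> w s t \<and> (\<forall>x\<in>{s..t}. \<bar>w x - u x\<bar> < \<epsilon>)"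
    using assms unfolding approx_minimizer_def by (meson le_less_trans less_le_trans)
qed

lemma has_infinite_derivative_on_subset:
  assumes "has_infinite_derivative_on u x S" "T \<subseteq> S"
  shows "has_infinite_derivative_on u x T"
  using assms at_le[OF assms(2), of x] unfolding has_infinite_derivative_on_def
  by (auto intro: filterlim_mono)

lemma has_infinite_derivative_on_reflect:
  assumes "has_infinite_derivative_on u x S"
  shows "has_infinite_derivative_on (\<lambda>z. u (- z)) (- x) (uminus ` S)"
proof -
  have "filterlim uminus (nhds x) (at (- x) within uminus ` S)"
    using tendsto_minus[OF tendsto_ident_at, of "- x" "uminus ` S"] by simp
  moreover have "eventually (\<lambda>z. - z \<in> S - {x}) (at (- x) within uminus ` S)"
    unfolding eventually_at_filter by (rule always_eventually) auto
  ultimately have un: "filterlim uminus (at x within S) (at (- x) within uminus ` S)"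
    unfolding at_within_def filterlim_inf filterlim_principal by auto
  have eq: "(\<lambda>z. (u (- z) - u (- (- x))) / (z - - x)) = (\<lambda>z. - ((u (- z) - u x) / (- z - x)))"
  proof
    fix z
    have "z - - x = - (- z - x)" by simp
    then show "(u (- z) - u (- (- x))) / (z - - x) = - ((u (- z) - u x) / (- z - x))"
      by (simp only: minus_divide_right minus_minus)
  qed
  from assms consider
      "filterlim (\<lambda>y. (u y - u x) / (y - x)) at_top (at x within S)"
    | "filterlim (\<lambda>y. (u y - u x) / (y - x)) at_bot (at x within S)"
    unfolding has_infinite_derivative_on_def by blast
  then show ?thesis
  proof cases
    case 1
    from filterlim_compose[OF this un, THEN iffD1[OF filterlim_uminus_at_top]]
    show ?thesis unfolding has_infinite_derivative_on_def eq by (rule disjI2)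
  next
    case 2
    from filterlim_compose[OF this un, THEN iffD1[OF filterlim_uminus_at_bot]]
    show ?thesis unfolding has_infinite_derivative_on_def eq by (rule disjI1)
  qed
qed

lemma steep_pointsI:
  assumes "approx_minimizer J x0 b u" "x0 < b" "has_infinite_derivative_on u x0 {x0..b}"
  shows "(x0, u x0) \<in> steep_points J \<or> (x0, - u x0) \<in> steep_points (\<lambda>u s t. J (\<lambda>x. - u x) s t)"
proof -
  from assms(3) consider
      "filterlim (\<lambda>x. (u x - u x0) / (x - x0)) at_top (at x0 within {x0..b})"
    | "filterlim (\<lambda>x. (u x - u x0) / (x - x0)) at_bot (at x0 within {x0..b})"
    unfolding has_infinite_derivative_on_def by blast
  then show ?thesis
  proof cases
    case 1
    then have "steep_through J x0 b u" using assms unfolding steep_through_def by blast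
    then show ?thesis unfolding steep_points_def by blast
  next
    case 2
    then have "filterlim (\<lambda>x. - ((u x - u x0) / (x - x0))) at_top (at x0 within {x0..b})"
      by (simp add: filterlim_uminus_at_bot)
    moreover have "(\<lambda>x. - ((u x - u x0) / (x - x0))) = (\<lambda>x. (- u x - - u x0) / (x - x0))"
      by (intro ext) (simp add: minus_divide_left)
    ultimately have "steep_through (\<lambda>u s t. J (\<lambda>x. - u x) s t) x0 b (\<lambda>x. - u x)"
      using assms approx_minimizer_flip unfolding steep_through_def by auto
    then show ?thesis unfolding steep_points_def by blast
  qed
qed

context bounded_below_lagrangian begin

abbreviation "cost_flipped \<equiv> (\<lambda>u s t. cost (\<lambda>x. - u x) s t)"
abbreviation "cost_reversed \<equiv> (\<lambda>u s t. cost (\<lambda>x. u (- x)) (- t) (- s))"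
abbreviation "cost_turned \<equiv> (\<lambda>u s t. cost_reversed (\<lambda>x. - u x) s t)"

text \<open>The right derivative at \<open>x0\<close> is used unless \<open>x0\<close> is the right endpoint; only then the picture is
reversed. If the right derivative is \<open>-\<infinity>\<close> after that, the picture is flipped as well.\<close>

lemma universal_singular_set_cases:
  assumes "(x0, y0) \<in> universal_singular_set L"
  shows "(x0, y0) \<in> steep_points cost \<or> (x0, - y0) \<in> steep_points cost_flipped \<or>
    (- x0, y0) \<in> steep_points cost_reversed \<or> (- x0, - y0) \<in> steep_points cost_turned"
proof -
  obtain a b u where u: "a < b" "a \<le> x0" "x0 \<le> b" "generalized_minimizer L a b u"
    "u x0 = y0" "has_infinite_derivative_on u x0 {a..b}"
    using assms unfolding universal_singular_set_def by auto
  have am: "approx_minimizer cost a b u" by (rule approx_minimizer_of_generalized_minimizer[OF u(4)])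
  show ?thesis
  proof (cases "x0 < b")
    case True
    have "approx_minimizer cost x0 b u" using am u by (auto intro: approx_minimizer_subinterval)
    moreover have "has_infinite_derivative_on u x0 {x0..b}"
      by (rule has_infinite_derivative_on_subset[OF u(6)]) (use u in auto)
    ultimately show ?thesis using steep_pointsI[of cost x0 b u] True u(5) by auto
  next
    case False
    then have x: "- x0 = - b" "- x0 < - a" using u by auto
    have "approx_minimizer cost_reversed (- x0) (- a) (\<lambda>z. u (- z))"
      using approx_minimizer_reverse[OF am] x by simp
    moreover have "has_infinite_derivative_on (\<lambda>z. u (- z)) (- x0) {- x0..- a}"
      using has_infinite_derivative_on_reflect[OF u(6)] x by simp
    ultimately show ?thesis
      using steep_pointsI[of cost_reversed "- x0" "- a" "\<lambda>z. u (- z)"] x(2) u(5) by auto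
  qed
qed

lemma curve_cost_reflections: "curve_cost cost_flipped" "curve_cost cost_reversed" "curve_cost cost_turned"
  using curve_cost_flip[OF curve_cost_lagrangian] curve_cost_reverse[OF curve_cost_lagrangian]
    curve_cost_flip[OF curve_cost_reverse[OF curve_cost_lagrangian]] by simp_all

lemma singular_on_AC_graph_negligible:
  assumes f: "AC_on a b f"
  shows "negligible {t \<in> {a..b}. (t, f t) \<in> universal_singular_set L}"
proof -
  define T1 where "T1 = {t \<in> {a..b}. (t, f t) \<in> steep_points cost}"
  define T2 where "T2 = {t \<in> {a..b}. (t, - f t) \<in> steep_points cost_flipped}"
  define T3 where "T3 = {t \<in> {- b..- a}. (t, f (- t)) \<in> steep_points cost_reversed}"
  define T4 where "T4 = {t \<in> {- b..- a}. (t, - f (- t)) \<in> steep_points cost_turned}"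
  have "negligible T1" "negligible T2" "negligible T3" "negligible T4"
    unfolding T1_def T2_def T3_def T4_def
    by (rule curve_cost.steep_points_on_AC_graph_negligible,
        rule curve_cost_lagrangian curve_cost_reflections,
        intro AC_on_uminus AC_on_reflect f)+
  then have "negligible (T1 \<union> T2 \<union> uminus ` T3 \<union> uminus ` T4)"
    by (intro negligible_Un negligible_uminus_image)
  then show ?thesis
  proof (rule negligible_subset, intro subsetI)
    fix t assume "t \<in> {t \<in> {a..b}. (t, f t) \<in> universal_singular_set L}"
    then have t: "t \<in> {a..b}" "(t, f t) \<in> universal_singular_set L" by auto
    from universal_singular_set_cases[OF t(2)] t(1)
    have "t \<in> T1 \<or> t \<in> T2 \<or> - t \<in> T3 \<or> - t \<in> T4"
      unfolding T1_def T2_def T3_def T4_def by auto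
    then show "t \<in> T1 \<union> T2 \<union> uminus ` T3 \<union> uminus ` T4"
      using image_eqI[of t uminus "- t" T3] image_eqI[of t uminus "- t" T4] by auto
  qed
qed

lemma singular_on_vertical_line_negligible:
  "negligible {y. (x0, y) \<in> universal_singular_set L}"
proof -
  define T1 where "T1 = {y. (x0, y) \<in> steep_points cost}"
  define T2 where "T2 = {y. (x0, y) \<in> steep_points cost_flipped}"
  define T3 where "T3 = {y. (- x0, y) \<in> steep_points cost_reversed}"
  define T4 where "T4 = {y. (- x0, y) \<in> steep_points cost_turned}"
  have "negligible T1" "negligible T2" "negligible T3" "negligible T4"
    unfolding T1_def T2_def T3_def T4_def
    by (rule curve_cost.steep_points_on_vertical_line_negligible,
        rule curve_cost_lagrangian curve_cost_reflections)+
  then have "negligible (T1 \<union> uminus ` T2 \<union> T3 \<union> uminus ` T4)"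
    by (intro negligible_Un negligible_uminus_image)
  then show ?thesis
  proof (rule negligible_subset, intro subsetI)
    fix y assume "y \<in> {y. (x0, y) \<in> universal_singular_set L}"
    then have "(x0, y) \<in> universal_singular_set L" by simp
    from universal_singular_set_cases[OF this]
    have "y \<in> T1 \<or> - y \<in> T2 \<or> y \<in> T3 \<or> - y \<in> T4"
      unfolding T1_def T2_def T3_def T4_def by auto
    then show "y \<in> T1 \<union> uminus ` T2 \<union> T3 \<union> uminus ` T4"
      using image_eqI[of y uminus "- y" T2] image_eqI[of y uminus "- y" T4] by auto
  qed
qed

end

theorem theorem3p2:
  fixes L :: "real \<times> real \<times> real \<Rightarrow> real"
  assumes "lagrangian L"
  shows "(\<forall>a b (f :: real \<Rightarrow> real). a < b \<longrightarrow> AC_on a b f \<longrightarrow>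
            hausdorff1 ((\<lambda>x. (x, f x)) ` {a..b} \<inter> universal_singular_set L) = 0) \<and>
         (\<forall>x\<^sub>0 :: real. hausdorff1 (({x\<^sub>0} \<times> UNIV) \<inter> universal_singular_set L) = 0)"
proof (intro conjI allI impI)
  obtain m where m: "\<And>z. m \<le> L z"
    using assms unfolding lagrangian_def bdd_below_def by auto
  interpret bounded_below_lagrangian L "\<bar>m\<bar>"
  proof
    show "0 \<le> L z + \<bar>m\<bar>" for z using m[of z] by linarith
  qed (use assms in auto)
  {
    fix a b :: real and f assume "a < b" and f: "AC_on a b f"
    define N where "N = {t \<in> {a..b}. (t, f t) \<in> universal_singular_set L}"
    have "hausdorff1 ((\<lambda>t. (t, f t)) ` N) = 0"
    proof (rule hausdorff1_AC_image_null[OF _ _ \<open>a < b\<close>])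
      show "negligible N" unfolding N_def by (rule singular_on_AC_graph_negligible[OF f])
      show "N \<subseteq> {a..b}" unfolding N_def by auto
      fix \<epsilon> :: real assume "0 < \<epsilon>"
      then obtain \<delta> where \<delta>: "0 < \<delta>" "\<And>I. packing a b I \<Longrightarrow> (\<Sum>(s, t)\<in>I. t - s) < \<delta> \<Longrightarrow>
          (\<Sum>(s, t)\<in>I. \<bar>f t - f s\<bar>) < \<epsilon> / 2"
        using AC_onE[OF f, of "\<epsilon> / 2"] by auto
      show "\<exists>\<delta>>0. \<forall>I. packing a b I \<longrightarrow> (\<Sum>(s, t)\<in>I. t - s) < \<delta> \<longrightarrow>
          (\<Sum>(s, t)\<in>I. dist (s, f s) (t, f t)) < \<epsilon>"
      proof (intro exI[of _ "min \<delta> (\<epsilon> / 2)"] conjI allI impI)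
        fix I assume I: "packing a b I" "(\<Sum>(s, t)\<in>I. t - s) < min \<delta> (\<epsilon> / 2)"
        have "dist (s, f s) (t, f t) \<le> (t - s) + \<bar>f t - f s\<bar>" if "(s, t) \<in> I" for s t
        proof -
          have "s < t" using I(1) that unfolding packing_def by auto
          moreover have "dist (s, f s) (t, f t) \<le> \<bar>s - t\<bar> + \<bar>f s - f t\<bar>"
            unfolding dist_Pair_Pair dist_real_def using sqrt_sum_squares_le_sum_abs[of "s - t" "f s - f t"] by simp
          ultimately show ?thesis by (simp add: abs_minus_commute)
        qed
        then have "(\<Sum>(s, t)\<in>I. dist (s, f s) (t, f t)) \<le> (\<Sum>(s, t)\<in>I. (t - s) + \<bar>f t - f s\<bar>)"
          by (intro sum_mono) auto
        also have "\<dots> = (\<Sum>(s, t)\<in>I. t - s) + (\<Sum>(s, t)\<in>I. \<bar>f t - f s\<bar>)"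
          by (simp add: sum.distrib case_prod_beta)
        also have "\<dots> < \<epsilon>" using \<delta>(2)[OF I(1)] I(2) by simp
        finally show "(\<Sum>(s, t)\<in>I. dist (s, f s) (t, f t)) < \<epsilon>" .
      qed (use \<delta> \<open>0 < \<epsilon>\<close> in auto)
    qed
    moreover have "(\<lambda>t. (t, f t)) ` N = (\<lambda>x. (x, f x)) ` {a..b} \<inter> universal_singular_set L"
      unfolding N_def by auto
    ultimately show "hausdorff1 ((\<lambda>x. (x, f x)) ` {a..b} \<inter> universal_singular_set L) = 0" by simp
  next
    fix x0 :: real
    define Y where "Y = {y. (x0, y) \<in> universal_singular_set L}"
    have "hausdorff1 (\<Union>n. (\<lambda>y. (x0, y)) ` (Y \<inter> {- real (Suc n)..real (Suc n)})) = 0"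
    proof (rule hausdorff1_null_UN, rule hausdorff1_AC_image_null)
      fix n
      have "negligible Y" unfolding Y_def by (rule singular_on_vertical_line_negligible)
      then show "negligible (Y \<inter> {- real (Suc n)..real (Suc n)})" by (rule negligible_subset) auto
      fix \<epsilon> :: real assume "0 < \<epsilon>"
      show "\<exists>\<delta>>0. \<forall>I. packing (- real (Suc n)) (real (Suc n)) I \<longrightarrow> (\<Sum>(s, t)\<in>I. t - s) < \<delta> \<longrightarrow>
          (\<Sum>(s, t)\<in>I. dist (x0, s) (x0, t)) < \<epsilon>"
      proof (intro exI[of _ \<epsilon>] conjI allI impI \<open>0 < \<epsilon>\<close>)
        fix I assume I: "packing (- real (Suc n)) (real (Suc n)) I" "(\<Sum>(s, t)\<in>I. t - s) < \<epsilon>"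
        have "(\<Sum>(s, t)\<in>I. dist (x0, s) (x0, t)) = (\<Sum>(s, t)\<in>I. t - s)"
          using I(1) unfolding packing_def by (intro sum.cong) (auto simp: dist_Pair_Pair dist_real_def)
        then show "(\<Sum>(s, t)\<in>I. dist (x0, s) (x0, t)) < \<epsilon>" using I(2) by simp
      qed
    qed auto
    moreover have "{x0} \<times> UNIV \<inter> universal_singular_set L \<subseteq>
        (\<Union>n. (\<lambda>y. (x0, y)) ` (Y \<inter> {- real (Suc n)..real (Suc n)}))"
    proof clarify
      fix y assume "(x0, y) \<in> universal_singular_set L"
      moreover obtain n where "\<bar>y\<bar> < real n" using reals_Archimedean2 by blast
      ultimately have "y \<in> Y \<inter> {- real (Suc n)..real (Suc n)}" unfolding Y_def by auto
      then show "(x0, y) \<in> (\<Union>n. (\<lambda>y. (x0, y)) ` (Y \<inter> {- real (Suc n)..real (Suc n)}))" by blast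
    qed
    ultimately show "hausdorff1 ({x0} \<times> UNIV \<inter> universal_singular_set L) = 0"
      by (rule hausdorff1_null_subset)
  }
qed

end
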